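(* Let $(G,w)$ be a weighted graph with distinguished (not necessarily distinct) vertices $a$ and $z$. Then for any two nonempty compositions $\alpha$ and $\beta$, $$X_{\alpha\circ(G,w)} = X_{\beta\circ(G,w)}\quad\text{if}\quad\alpha\sim\beta.$$ If moreover the underlying graph $G$ of $(G,w)$ is simple and connected, then this strengthens to $$X_{\alpha\circ(G,w)} = X_{\beta\circ(G,w)}\quad\text{if and only if}\quad\alpha\sim\beta.$$
   Context: Graphs are finite, with loops and multiple edges allowed; simple means no loops and no multiple edges. A weighted graph $(G,w)$ is a graph $G$ with a weight function $w:V(G)\to\mathbb{Z}^+$. A proper colouring is a map $\kappa:V(G)\to\mathbb{Z}^+$ with $\kappa(u)\neq\kappa(v)$ whenever $uv$ is an edge. The extended chromatic symmetric function of $(G,w)$, with vertices $v_1,\dots,v_N$, is $X_{(G,w)}=\sum_\kappa x_{\kappa(v_1)}^{w(v_1)}\cdots x_{\kappa(v_N)}^{w(v_N)}$, summed over all proper colourings $\kappa$ of $G$. A composition $\alpha=(\alpha_1,\dots,\alpha_{\ell(\alpha)})$ is a finite ordered list of positive integers; $\ell(\alpha)$ is its length and $|\alpha|=\sum_i\alpha_i$ its size. Put $[m]=\{1,\dots,m\}$. For $\alpha$ of size $n$, $\operatorname{set}(\alpha)=\{\alpha_1,\alpha_1+\alpha_2,\dots,\alpha_1+\cdots+\alpha_{\ell(\alpha)-1}\}\subseteq[n-1]$; the complement $\alpha^c$ is the unique composition of $n$ with $\operatorname{set}(\alpha^c)=[n-1]-\operatorname{set}(\alpha)$; the reversal is $\alpha^r=(\alpha_{\ell(\alpha)},\dots,\alpha_1)$.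 Composition of a composition with a graph: let $(G,w)$ be a weighted graph with distinguished (not necessarily distinct) vertices $a,z$, and let $\alpha$ be a nonempty composition. Take the disjoint union of $|\alpha|$ copies of $(G,w)$, with the copies of $a$ and $z$ in the $i$th copy labelled $a_i$ and $z_i$. Add an edge $z_ia_{i+1}$ for each $i\in[|\alpha|-1]$. Then $\alpha\circ(G,w)$ is the weighted graph resulting from contracting the edges $z_ia_{i+1}$ for all $i\in\operatorname{set}(\alpha^c)$. To contract an edge is to delete it and then identify its endpoints as one vertex, whose weight is the sum of the weights of the vertices identified. Relation $\sim$: for nonempty compositions, the concatenation is $\alpha\cdot\beta=(\alpha_1,\dots,\alpha_{\ell(\alpha)},\beta_1,\dots,\beta_{\ell(\beta)})$ and the near concatenation is $\alpha\odot\beta=(\alpha_1,\dots,\alpha_{\ell(\alpha)}+\beta_1,\dots,\beta_{\ell(\beta)})$. Define $\alpha\circ\beta=\beta^{\odot\alpha_1}\cdot\ \cdots\ \cdot\beta^{\odot\alpha_{\ell(\alpha)}}$ with $\beta^{\odot i}=\beta\odot\cdots\odot\beta$ ($i$ factors); this operation is associative. Write $\alpha\sim\beta$ if for some $\ell$ there exist compositions $\alpha^{(1)},\dots,\alpha^{(\ell)}$ and $\beta^{(1)},\dots,\beta^{(\ell)}$ such that $\alpha=\alpha^{(1)}\circ\cdots\circ\alpha^{(\ell)}$ and $\beta=\beta^{(1)}\circ\cdots\circ\beta^{(\ell)}$, where for each $i$ either $\beta^{(i)}=\alpha^{(i)}$ or $\beta^{(i)}=(\alpha^{(i)})^r$.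 (By a theorem of Billera, Thomas and van Willigenburg, $\alpha\sim\beta$ if and only if the ribbon Schur functions satisfy $r_\alpha=r_\beta$.) *)

theory Defs
  imports Main "HOL-Library.Poly_Mapping" "HOL-Library.FuncSet"
begin

section \<open>Weighted graphs with loops and multiple edges\<close>

text \<open>The set of endpoints of an edge has two elements, or one element if the edge is a loop;
  distinct edges may have the same endpoints.\<close>

record ('v, 'e) wgraph =
  wg_verts :: "'v set"
  wg_edges :: "'e set"
  wg_ends :: "'e \<Rightarrow> 'v set"
  wg_weight :: "'v \<Rightarrow> nat"

definition weighted_graph :: "('v, 'e) wgraph \<Rightarrow> bool" where
  "weighted_graph G \<longleftrightarrow>
     finite (wg_verts G) \<and> finite (wg_edges G) \<and>
     (\<forall>e\<in>wg_edges G. \<exists>u\<in>wg_verts G. \<exists>v\<in>wg_verts G. wg_ends G e = {u, v}) \<and>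
     (\<forall>v\<in>wg_verts G. 0 < wg_weight G v)"

definition simple_wgraph :: "('v, 'e) wgraph \<Rightarrow> bool" where
  "simple_wgraph G \<longleftrightarrow>
     (\<forall>e\<in>wg_edges G. \<forall>v. wg_ends G e \<noteq> {v}) \<and> inj_on (wg_ends G) (wg_edges G)"

definition wg_adjacency :: "('v, 'e) wgraph \<Rightarrow> 'e set \<Rightarrow> 'v rel" where
  "wg_adjacency G S = {(u, v). \<exists>e\<in>S. wg_ends G e = {u, v}}"

definition connected_wgraph :: "('v, 'e) wgraph \<Rightarrow> bool" where
  "connected_wgraph G \<longleftrightarrow>
     (\<forall>u\<in>wg_verts G. \<forall>v\<in>wg_verts G. (u, v) \<in> (wg_adjacency G (wg_edges G))\<^sup>*)"

section \<open>The extended chromatic symmetric function\<close>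

definition proper_colourings :: "('v, 'e) wgraph \<Rightarrow> ('v \<Rightarrow> nat) set" where
  "proper_colourings G =
     {\<kappa> \<in> wg_verts G \<rightarrow>\<^sub>E {1..}. \<forall>e\<in>wg_edges G. \<forall>u v. wg_ends G e = {u, v} \<longrightarrow> \<kappa> u \<noteq> \<kappa> v}"

text \<open>A monomial in the variables \<open>x\<^sub>1, x\<^sub>2, \<dots>\<close> is represented by its exponent vector (so products
  of monomials are sums), and a formal power series in these infinitely many variables by its
  coefficient function.\<close>

type_synonym x_monomial = "nat \<Rightarrow>\<^sub>0 nat"
type_synonym x_series = "x_monomial \<Rightarrow> int"

definition colouring_monomial :: "('v, 'e) wgraph \<Rightarrow> ('v \<Rightarrow> nat) \<Rightarrow> x_monomial" where
  "colouring_monomial G \<kappa> = (\<Sum>v\<in>wg_verts G. Poly_Mapping.single (\<kappa> v) (wg_weight G v))"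

text \<open>The sum of the monomials of all proper colourings, taken coefficientwise. The index set of
  the coefficient sum is finite, see \<open>finite_colourings_of_monomial\<close> below.\<close>

definition chromatic_series :: "('v, 'e) wgraph \<Rightarrow> x_series" where
  "chromatic_series G = (\<lambda>m. \<Sum>\<kappa> | \<kappa> \<in> proper_colourings G \<and> colouring_monomial G \<kappa> = m. 1)"

lemma finite_colourings_of_monomial:
  assumes "weighted_graph G"
  shows "finite {\<kappa>. \<kappa> \<in> proper_colourings G \<and> colouring_monomial G \<kappa> = m}"
proof (rule finite_subset)
  have fin: "finite (wg_verts G)" using assms by (simp add: weighted_graph_def)
  show "finite (wg_verts G \<rightarrow>\<^sub>E Poly_Mapping.keys m)" using fin by (simp add: finite_PiE)
  show "{\<kappa>. \<kappa> \<in> proper_colourings G \<and> colouring_monomial G \<kappa> = m} \<subseteq> wg_verts G \<rightarrow>\<^sub>E Poly_Mapping.keys m"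
  proof clarify
    fix \<kappa> assume k: "\<kappa> \<in> proper_colourings G"
    have "\<kappa> v \<in> Poly_Mapping.keys (colouring_monomial G \<kappa>)" if v: "v \<in> wg_verts G" for v
    proof -
      have "0 < wg_weight G v" using assms v by (simp add: weighted_graph_def)
      also have "\<dots> = Poly_Mapping.lookup (Poly_Mapping.single (\<kappa> v) (wg_weight G v)) (\<kappa> v)" by simp
      also have "\<dots> \<le> (\<Sum>u\<in>wg_verts G. Poly_Mapping.lookup (Poly_Mapping.single (\<kappa> u) (wg_weight G u)) (\<kappa> v))"
        by (rule member_le_sum) (use v fin in auto)
      also have "\<dots> = Poly_Mapping.lookup (colouring_monomial G \<kappa>) (\<kappa> v)"
        by (simp add: colouring_monomial_def lookup_sum)
      finally show ?thesis by (simp add: in_keys_iff)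
    qed
    then show "\<kappa> \<in> wg_verts G \<rightarrow>\<^sub>E Poly_Mapping.keys (colouring_monomial G \<kappa>)"
      using k by (auto simp: proper_colourings_def PiE_iff)
  qed
qed

section \<open>Compositions\<close>

definition composition :: "nat list \<Rightarrow> bool" where
  "composition \<alpha> \<longleftrightarrow> (\<forall>i\<in>set \<alpha>. 0 < i)"

definition composition_set :: "nat list \<Rightarrow> nat set" where
  "composition_set \<alpha> = {sum_list (take i \<alpha>) | i. 1 \<le> i \<and> i < length \<alpha>}"

definition composition_complement :: "nat list \<Rightarrow> nat list" where
  "composition_complement \<alpha> =
     (THE \<gamma>. composition \<gamma> \<and> sum_list \<gamma> = sum_list \<alpha> \<and>
            composition_set \<gamma> = {1..sum_list \<alpha> - 1} - composition_set \<alpha>)"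

lemma composition_snoc [simp]: "composition (\<gamma> @ [k]) \<longleftrightarrow> composition \<gamma> \<and> 0 < k"
  by (auto simp: composition_def)

lemma composition_set_single [simp]: "composition_set [k] = {}"
  by (auto simp: composition_set_def)

lemma composition_set_snoc:
  assumes "\<gamma> \<noteq> []"
  shows "composition_set (\<gamma> @ [k]) = insert (sum_list \<gamma>) (composition_set \<gamma>)"
proof -
  have "{i. 1 \<le> i \<and> i < length (\<gamma> @ [k])} = insert (length \<gamma>) {i. 1 \<le> i \<and> i < length \<gamma>}"
    using assms by (auto simp: Suc_le_eq)
  moreover have "composition_set \<delta> = (\<lambda>i. sum_list (take i \<delta>)) ` {i. 1 \<le> i \<and> i < length \<delta>}"
    for \<delta> by (auto simp: composition_set_def)
  ultimately show ?thesis by auto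
qed

lemma composition_set_less:
  assumes "composition \<gamma>" "x \<in> composition_set \<gamma>"
  shows "x < sum_list \<gamma>"
  using assms
proof (induction \<gamma> arbitrary: x rule: rev_induct)
  case Nil
  then show ?case by (simp add: composition_set_def)
next
  case (snoc k \<gamma>)
  then show ?case
    by (cases "\<gamma> = []") (auto simp: composition_set_snoc, fastforce)
qed

lemma composition_with_set_exists:
  assumes "S \<subseteq> {1..<n}"
  shows "\<exists>\<gamma>. composition \<gamma> \<and> sum_list \<gamma> = n \<and> composition_set \<gamma> = S"
  using assms
proof (induction n arbitrary: S rule: less_induct)
  case (less n)
  have fin: "finite S" using less.prems finite_subset by blast
  show ?case
  proof (cases "S = {}")
    case True
    show ?thesis
    proof (cases "n = 0")
      case True
      then show ?thesis using \<open>S = {}\<close>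
        by (intro exI[of _ "[]"]) (auto simp: composition_def composition_set_def)
    next
      case False
      then show ?thesis using \<open>S = {}\<close>
        by (intro exI[of _ "[n]"]) (auto simp: composition_def)
    qed
  next
    case False
    define m where "m = Max S"
    have m: "m \<in> S" using fin False by (simp add: m_def)
    then have mn: "1 \<le> m" "m < n" using less.prems by auto
    have sub: "S - {m} \<subseteq> {1..<m}"
    proof
      fix x assume x: "x \<in> S - {m}"
      then have "x \<le> m" using fin by (simp add: m_def)
      with x less.prems show "x \<in> {1..<m}" by auto
    qed
    obtain \<gamma> where g: "composition \<gamma>" "sum_list \<gamma> = m" "composition_set \<gamma> = S - {m}"
      using less.IH[OF mn(2) sub] by (elim exE conjE)
    have "\<gamma> \<noteq> []" using g(2) mn(1) by (cases \<gamma>) simp_all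
    then have "composition_set (\<gamma> @ [n - m]) = S"
      using g(2,3) m by (simp add: composition_set_snoc insert_absorb)
    then show ?thesis using g(1,2) mn(2)
      by (intro exI[of _ "\<gamma> @ [n - m]"]) simp
  qed
qed

lemma composition_set_inject:
  assumes "composition \<gamma>" "composition \<delta>" "sum_list \<gamma> = sum_list \<delta>"
    "composition_set \<gamma> = composition_set \<delta>"
  shows "\<gamma> = \<delta>"
  using assms
proof (induction \<gamma> arbitrary: \<delta> rule: rev_induct)
  case Nil
  then show ?case by (cases \<delta>) (auto simp: composition_def)
next
  case (snoc k \<gamma>)
  have "\<delta> \<noteq> []" using snoc.prems by auto
  then obtain \<delta>' j where d: "\<delta> = \<delta>' @ [j]" by (metis append_butlast_last_id)
  show ?case
  proof (cases "\<gamma> = [] \<or> \<delta>' = []")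
    case True
    then have "\<gamma> = [] \<and> \<delta>' = []" using snoc.prems(4) unfolding d
      by (cases "\<gamma> = []"; cases "\<delta>' = []") (simp_all add: composition_set_snoc)
    then show ?thesis using snoc.prems d by simp
  next
    case False
    then have eq: "insert (sum_list \<gamma>) (composition_set \<gamma>)
                 = insert (sum_list \<delta>') (composition_set \<delta>')"
      using snoc.prems d by (simp add: composition_set_snoc)
    have c: "composition \<gamma>" "composition \<delta>'" using snoc.prems d by auto
    have le: "sum_list \<gamma> = sum_list \<delta>'"
    proof (rule ccontr)
      assume ne: "sum_list \<gamma> \<noteq> sum_list \<delta>'"
      then have "sum_list \<gamma> \<in> composition_set \<delta>'" "sum_list \<delta>' \<in> composition_set \<gamma>"
        using eqset_imp_iff[OF eq, of "sum_list \<gamma>"] eqset_imp_iff[OF eq, of "sum_list \<delta>'"]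
        by simp_all
      from composition_set_less[OF c(2) this(1)] composition_set_less[OF c(1) this(2)]
      show False by simp
    qed
    have "sum_list \<gamma> \<notin> composition_set \<gamma>" "sum_list \<delta>' \<notin> composition_set \<delta>'"
      using composition_set_less[OF c(1), of "sum_list \<gamma>"]
        composition_set_less[OF c(2), of "sum_list \<delta>'"] by auto
    with eq le have "composition_set \<gamma> = composition_set \<delta>'"
      by (simp add: insert_ident)
    with le show ?thesis using snoc.IH[OF c] snoc.prems d by simp
  qed
qed

lemma composition_complement:
  assumes "composition \<alpha>"
  shows "composition (composition_complement \<alpha>)"
    and "sum_list (composition_complement \<alpha>) = sum_list \<alpha>"
    and "composition_set (composition_complement \<alpha>) = {1..sum_list \<alpha> - 1} - composition_set \<alpha>"
proof -
  have ex1: "\<exists>!\<gamma>. composition \<gamma> \<and> sum_list \<gamma> = sum_list \<alpha> \<and>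
          composition_set \<gamma> = {1..sum_list \<alpha> - 1} - composition_set \<alpha>"
  proof (rule ex_ex1I)
    show "\<exists>\<gamma>. composition \<gamma> \<and> sum_list \<gamma> = sum_list \<alpha> \<and>
            composition_set \<gamma> = {1..sum_list \<alpha> - 1} - composition_set \<alpha>"
      by (rule composition_with_set_exists) auto
  next
    fix \<gamma> \<delta>
    assume "composition \<gamma> \<and> sum_list \<gamma> = sum_list \<alpha> \<and>
        composition_set \<gamma> = {1..sum_list \<alpha> - 1} - composition_set \<alpha>"
      and "composition \<delta> \<and> sum_list \<delta> = sum_list \<alpha> \<and>
        composition_set \<delta> = {1..sum_list \<alpha> - 1} - composition_set \<alpha>"
    then show "\<gamma> = \<delta>" by (intro composition_set_inject) simp_all
  qed
  from theI'[OF ex1]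
  show "composition (composition_complement \<alpha>)"
    and "sum_list (composition_complement \<alpha>) = sum_list \<alpha>"
    and "composition_set (composition_complement \<alpha>) = {1..sum_list \<alpha> - 1} - composition_set \<alpha>"
    unfolding composition_complement_def by simp_all
qed

text \<open>Only nonempty arguments matter; the convention that the empty list is neutral lets the
  \<open>i\<close>-fold near concatenation power be an iterate started at the empty list.\<close>

definition near_concat :: "nat list \<Rightarrow> nat list \<Rightarrow> nat list" where
  "near_concat \<alpha> \<beta> =
     (if \<alpha> = [] then \<beta> else if \<beta> = [] then \<alpha> else butlast \<alpha> @ (last \<alpha> + hd \<beta>) # tl \<beta>)"

definition near_power :: "nat list \<Rightarrow> nat \<Rightarrow> nat list" where
  "near_power \<beta> i = (near_concat \<beta> ^^ i) []"

definition comp_compose :: "nat list \<Rightarrow> nat list \<Rightarrow> nat list" where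
  "comp_compose \<alpha> \<beta> = concat (map (near_power \<beta>) \<alpha>)"

fun comp_compose_list :: "nat list list \<Rightarrow> nat list" where
  "comp_compose_list [] = [1]"
| "comp_compose_list [\<alpha>] = \<alpha>"
| "comp_compose_list (\<alpha> # \<beta> # \<gamma>s) = comp_compose \<alpha> (comp_compose_list (\<beta> # \<gamma>s))"

definition comp_equiv :: "nat list \<Rightarrow> nat list \<Rightarrow> bool" where
  "comp_equiv \<alpha> \<beta> \<longleftrightarrow>
     (\<exists>\<alpha>s \<beta>s. \<alpha>s \<noteq> [] \<and> (\<forall>\<gamma>\<in>set \<alpha>s. \<gamma> \<noteq> [] \<and> composition \<gamma>) \<and>
        list_all2 (\<lambda>\<gamma> \<delta>. \<delta> = \<gamma> \<or> \<delta> = rev \<gamma>) \<alpha>s \<beta>s \<and>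
        \<alpha> = comp_compose_list \<alpha>s \<and> \<beta> = comp_compose_list \<beta>s)"

section \<open>Composition of a composition with a graph\<close>

text \<open>Contraction of all edges in \<open>S\<close>: these edges are deleted, and the new vertices are the
  classes of the equivalence relation that they generate, weighted by total weight. (The relation
  \<open>wg_adjacency G S\<close> is symmetric.)\<close>

definition contraction_rel :: "('v, 'e) wgraph \<Rightarrow> 'e set \<Rightarrow> 'v rel" where
  "contraction_rel G S = (wg_adjacency G S)\<^sup>*"

definition contract_edges :: "('v, 'e) wgraph \<Rightarrow> 'e set \<Rightarrow> ('v set, 'e) wgraph" where
  "contract_edges G S =
     \<lparr>wg_verts = wg_verts G // contraction_rel G S,
      wg_edges = wg_edges G - S,
      wg_ends = (\<lambda>e. (\<lambda>v. contraction_rel G S `` {v}) ` wg_ends G e),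
      wg_weight = (\<lambda>C. \<Sum>v\<in>C. wg_weight G v)\<rparr>"

lemma contract_single_edge:
  assumes "weighted_graph G" "e \<in> wg_edges G" "wg_ends G e = {u, v}"
  shows "wg_verts (contract_edges G {e}) = insert {u, v} ((\<lambda>x. {x}) ` (wg_verts G - {u, v}))"
    and "wg_edges (contract_edges G {e}) = wg_edges G - {e}"
    and "wg_ends (contract_edges G {e}) f
           = (\<lambda>x. if x \<in> {u, v} then {u, v} else {x}) ` wg_ends G f"
proof -
  have adj: "wg_adjacency G {e} = {(u, v), (v, u)}"
    using assms(3) by (auto simp: wg_adjacency_def doubleton_eq_iff)
  have "(x, y) \<in> {(u, v), (v, u)}\<^sup>* \<longleftrightarrow> x = y \<or> (x \<in> {u, v} \<and> y \<in> {u, v})" for x y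
  proof
    assume "(x, y) \<in> {(u, v), (v, u)}\<^sup>*"
    then show "x = y \<or> (x \<in> {u, v} \<and> y \<in> {u, v})" by induction auto
  qed auto
  then have cl: "contraction_rel G {e} `` {x} = (if x \<in> {u, v} then {u, v} else {x})" for x
    unfolding contraction_rel_def adj by auto
  have uv: "u \<in> wg_verts G" "v \<in> wg_verts G"
    using assms unfolding weighted_graph_def by (metis doubleton_eq_iff)+
  have "wg_verts (contract_edges G {e})
      = (\<lambda>x. if x \<in> {u, v} then {u, v} else {x}) ` wg_verts G"
    by (auto simp: contract_edges_def quotient_def cl)
  also have "\<dots> = insert {u, v} ((\<lambda>x. {x}) ` (wg_verts G - {u, v}))"
    using uv by (auto simp: image_iff)
  finally show "wg_verts (contract_edges G {e})
      = insert {u, v} ((\<lambda>x. {x}) ` (wg_verts G - {u, v}))" .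
  show "wg_edges (contract_edges G {e}) = wg_edges G - {e}"
    by (simp add: contract_edges_def)
  show "wg_ends (contract_edges G {e}) f
      = (\<lambda>x. if x \<in> {u, v} then {u, v} else {x}) ` wg_ends G f"
    by (simp add: contract_edges_def cl)
qed

text \<open>In the chain of \<open>n\<close> copies of \<open>G\<close>, the vertex \<open>(i, v)\<close> and the edge \<open>Inl (i, e)\<close> are the
  \<open>i\<close>th copies of \<open>v\<close> and \<open>e\<close>, and \<open>Inr i\<close> is the added edge \<open>z\<^sub>ia\<^sub>i\<^sub>+\<^sub>1\<close>.\<close>

definition chain_of_copies ::
    "nat \<Rightarrow> ('v, 'e) wgraph \<Rightarrow> 'v \<Rightarrow> 'v \<Rightarrow> (nat \<times> 'v, nat \<times> 'e + nat) wgraph" where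
  "chain_of_copies n G a z =
     \<lparr>wg_verts = {1..n} \<times> wg_verts G,
      wg_edges = Inl ` ({1..n} \<times> wg_edges G) \<union> Inr ` {1..n - 1},
      wg_ends = (\<lambda>f. case f of Inl (i, e) \<Rightarrow> Pair i ` wg_ends G e
                             | Inr i \<Rightarrow> {(i, z), (i + 1, a)}),
      wg_weight = (\<lambda>(i, v). wg_weight G v)\<rparr>"

definition comp_graph ::
    "nat list \<Rightarrow> ('v, 'e) wgraph \<Rightarrow> 'v \<Rightarrow> 'v \<Rightarrow> ((nat \<times> 'v) set, nat \<times> 'e + nat) wgraph" where
  "comp_graph \<alpha> G a z =
     contract_edges (chain_of_copies (sum_list \<alpha>) G a z)
       (Inr ` composition_set (composition_complement \<alpha>))"

end

theory Submission
  imports Defs Complex_Main "HOL-Library.Multiset" "HOL-Combinatorics.Multiset_Permutations"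
    "HOL-Computational_Algebra.Polynomial"
begin

text \<open>Deletion and contraction of a linking edge show that evaluation at finitely many colours turns
  \<open>\<alpha> \<mapsto> X\<close> of \<open>\<alpha> \<circ> G\<close> into a map \<open>F\<close> with \<open>F (\<alpha> \<cdot> \<beta>) + F (\<alpha> \<odot> \<beta>) = F \<alpha> * F \<beta>\<close>. Such a map is the ribbon
  function of the values \<open>h\<^sub>k = F (k)\<close>, and as the target ring is commutative, ribbon functions do not
  change when a factor of a composition is reversed.

  Conversely let \<open>G\<close> be connected and loopless. If the colours are enlarged by \<open>t\<close> times the \<open>N\<close>th roots
  of unity, where \<open>N\<close> is the weight of \<open>k\<close> copies of \<open>G\<close>, then \<open>h\<^sub>j\<close> is unchanged for \<open>j < k\<close> and \<open>h\<^sub>k\<close>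
  grows by a nonzero multiple of \<open>t\<close> to the \<open>N\<close>. Hence the \<open>h\<^sub>k\<close> take arbitrary complex values, so all
  ribbon functions of \<open>\<alpha>\<close> and \<open>\<beta>\<close> agree, and \<open>\<alpha>\<close> and \<open>\<beta>\<close> have equally many coarsenings of each type.

  Extend their sets of partial sums to \<open>n\<close>-periodic \<open>0/1\<close> sequences \<open>a\<close> and \<open>b\<close> on the integers. By the
  coarsenings of length two, at every position \<open>b\<close> agrees with \<open>a\<close> or with the reversal of \<open>a\<close>. If both
  are needed, the coarsenings of length three show that, after reversing \<open>b\<close> if necessary, the
  positions with \<open>b \<noteq> a\<close> lie in a proper subgroup that misses some asymmetric position of \<open>a\<close>.
  Coarsenings of greater length allow to enlarge this subgroup until \<open>a\<close> is periodic outside of it,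
  still missing that position. Then \<open>\<alpha>\<close> and \<open>\<beta>\<close> have a common right factor, which can be cancelled.\<close>

section \<open>Counting arrangements by their partial sums\<close>

text \<open>The pair \<open>a\<close>, \<open>b\<close> is traded for pairs of translates of
  \<open>a\<close>. Suppose that \<open>a\<close> and \<open>b\<close> agree off a subgroup
  containing \<open>u\<close> and take opposite values at \<open>u\<close>, and also, exchanged, at
  the reflected position. Let \<open>X\<close> have no proper subset sum in the subgroup. Then only
  arrangements of \<open>u\<close> and \<open>X\<close> that begin or end with \<open>u\<close> can
  tell \<open>a\<close> from \<open>b\<close>, and equal counts mean that \<open>X\<close> has as
  many arrangements started at \<open>u\<close> as at \<open>0\<close>. So \<open>a\<close> and its
  translate by \<open>u\<close> again have equal counts, and a position where they differ can be fed
  into the same argument for a larger subgroup. Two obstacles shape the proof. Counts only see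
  positions between \<open>0\<close> and the total, so other positions are reached by reflection and
  by reduction modulo a period. And the growing subgroup must not swallow the asymmetric position to
  be missed; this is controlled by keeping it inside a stabilizer. On the graph side evaluations
  take values in any commutative ring: a polynomial ring recovers the coefficients of the series,
  while prescribing the \<open>h\<^sub>k\<close> takes roots, hence complex numbers.\<close>

definition arrangements :: "(int \<Rightarrow> bool) \<Rightarrow> int \<Rightarrow> int multiset \<Rightarrow> int list set" where
  "arrangements c t X =
     {xs. mset xs = X \<and> (\<forall>i. 0 < i \<and> i < length xs \<longrightarrow> c (t + sum_list (take i xs)))}"

definition acount :: "(int \<Rightarrow> bool) \<Rightarrow> int \<Rightarrow> int multiset \<Rightarrow> nat" where
  "acount c t X = card (arrangements c t X)"

text \<open>If the start \<open>t\<close> is a multiple of \<open>l\<close>, this condition makes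
  \<open>acount c t X\<close> depend only on the values of \<open>c\<close> off the multiples of
  \<open>l\<close>. The full sum is exempt, as it is no tested position.\<close>

definition sum_free :: "int \<Rightarrow> int multiset \<Rightarrow> bool" where
  "sum_free l X \<longleftrightarrow> (\<forall>Y. Y \<subseteq># X \<longrightarrow> Y \<noteq> {#} \<longrightarrow> Y \<noteq> X \<longrightarrow> \<not> l dvd sum_mset Y)"

lemma sum_freeD:
  "sum_free l X \<Longrightarrow> Y \<subseteq># X \<Longrightarrow> Y \<noteq> {#} \<Longrightarrow> Y \<noteq> X \<Longrightarrow> \<not> l dvd sum_mset Y"
  by (simp add: sum_free_def)

lemma finite_arrangements [simp]: "finite (arrangements c t X)"
proof (rule finite_subset)
  show "arrangements c t X \<subseteq> permutations_of_multiset X"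
    by (auto simp: arrangements_def permutations_of_multiset_def)
qed simp

lemma proper_prefix_mset:
  assumes "0 < i" "i < length xs"
  shows "mset (take i xs) \<subseteq># mset xs" "mset (take i xs) \<noteq> {#}" "mset (take i xs) \<noteq> mset xs"
proof -
  show "mset (take i xs) \<subseteq># mset xs"
    by (metis append_take_drop_id mset_append mset_subset_eq_add_left)
  show "mset (take i xs) \<noteq> {#}" using assms by auto
  show "mset (take i xs) \<noteq> mset xs" using assms
    by (metis length_take min.absorb4 size_mset less_irrefl)
qed

lemma acount_cong:
  assumes "\<And>Y. Y \<subseteq># X \<Longrightarrow> Y \<noteq> {#} \<Longrightarrow> Y \<noteq> X \<Longrightarrow> c (t + sum_mset Y) = c' (t' + sum_mset Y)"
  shows "acount c t X = acount c' t' X"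
proof -
  have "c (t + sum_list (take i xs)) = c' (t' + sum_list (take i xs))"
    if "mset xs = X" "0 < i" "i < length xs" for xs i
    using assms[of "mset (take i xs)"] proper_prefix_mset[OF that(2,3)] that(1)
    by (simp add: sum_mset_sum_list)
  then have "arrangements c t X = arrangements c' t' X"
    unfolding arrangements_def by blast
  then show ?thesis by (simp add: acount_def)
qed

text \<open>Classification by the first entry \<open>x\<close>; with at least two entries,
  \<open>t + x\<close> is one of the tested positions.\<close>

lemma acount_rec:
  assumes "2 \<le> size X"
  shows "acount c t X = (\<Sum>x\<in>set_mset X. if c (t + x) then acount c (t + x) (X - {#x#}) else 0)"
proof -
  let ?A = "\<lambda>x. if c (t + x) then (#) x ` arrangements c (t + x) (X - {#x#}) else {}"
  have sub: "xs \<in> (\<Union>x\<in>set_mset X. ?A x)" if xs: "xs \<in> arrangements c t X" for xs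
  proof -
    have m: "mset xs = X" using xs by (simp add: arrangements_def)
    with assms obtain x ys where xs': "xs = x # ys" "ys \<noteq> []"
      by (cases xs) (auto, force)
    have P: "c (t + sum_list (take i xs))" if "0 < i" "i < length xs" for i
      using xs that by (auto simp: arrangements_def)
    have "c (t + x)" using P[of 1] xs' by simp
    moreover have "c (t + x + sum_list (take i ys))" if "0 < i" "i < length ys" for i
      using P[of "Suc i"] xs' that by (simp add: add.assoc)
    ultimately show ?thesis using m xs' by (fastforce simp: arrangements_def)
  qed
  have sup: "xs \<in> arrangements c t X" if x: "x \<in># X" and xs: "xs \<in> ?A x" for x xs
  proof -
    from xs have cx: "c (t + x)" by (auto split: if_splits)
    with xs obtain ys where ys: "xs = x # ys" "ys \<in> arrangements c (t + x) (X - {#x#})" by auto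
    have "c (t + sum_list (take i xs))" if "0 < i" "i < length xs" for i
    proof (cases i)
      case (Suc j)
      show ?thesis using Suc that ys cx
        by (cases "j = 0") (auto simp: arrangements_def add.assoc)
    qed (use that in simp)
    then show ?thesis using ys x by (auto simp: arrangements_def)
  qed
  have "arrangements c t X = (\<Union>x\<in>set_mset X. ?A x)"
    using sub sup by blast
  also have "card \<dots> = (\<Sum>x\<in>set_mset X. card (?A x))"
    by (rule card_UN_disjoint) auto
  also have "\<dots> = (\<Sum>x\<in>set_mset X. if c (t + x) then acount c (t + x) (X - {#x#}) else 0)"
    by (intro sum.cong) (auto simp: acount_def card_image)
  finally show ?thesis by (simp add: acount_def)
qed

lemma acount_single [simp]: "acount c t {#x#} = 1"
proof -
  have "arrangements c t {#x#} = {[x]}" by (auto simp: arrangements_def)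
  then show ?thesis by (simp add: acount_def)
qed

lemma acount_pair_same: "acount c t {#x, x#} = of_bool (c (t + x))"
  using acount_rec[of "{#x, x#}" c t] by simp

lemma acount_pair: "x \<noteq> y \<Longrightarrow> acount c t {#x, y#} = of_bool (c (t + x)) + of_bool (c (t + y))"
  using acount_rec[of "{#x, y#}" c t] by (simp add: of_bool_def)

lemma acount_pair_eqD:
  assumes "acount c t {#p, u#} = acount c' t' {#p, u#}"
  shows "of_bool (c (t + p)) + of_bool (c (t + u))
    = (of_bool (c' (t' + p)) + of_bool (c' (t' + u)) :: nat)"
proof (cases "p = u")
  case False
  show ?thesis using assms unfolding acount_pair[OF False] .
qed (use assms in \<open>simp add: acount_pair_same\<close>)

text \<open>Counts orders of three labelled parts, one summand per order, so that coinciding parts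
  cause no case distinction in the Boolean arguments below.\<close>

definition triple_count :: "(int \<Rightarrow> bool) \<Rightarrow> int \<Rightarrow> int \<Rightarrow> int \<Rightarrow> int \<Rightarrow> nat" where
  "triple_count c t p u v =
     of_bool (c (t + p) \<and> c (t + p + u)) + of_bool (c (t + u) \<and> c (t + p + u)) +
     of_bool (c (t + p) \<and> c (t + p + v)) + of_bool (c (t + v) \<and> c (t + p + v)) +
     of_bool (c (t + u) \<and> c (t + u + v)) + of_bool (c (t + v) \<and> c (t + u + v))"

text \<open>The factor is the product of the factorials of the multiplicities: so many labelled
  orders give the same list.\<close>

lemma acount_triple:
  "triple_count c t p u v = acount c t {#p, u, v#} *
     (if p = u \<and> u = v then 6 else if p = u \<or> u = v \<or> p = v then 2 else 1)"
proof -
  note 3 = acount_rec[of "{#p, u, v#}" c t]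
  consider "p = u" "u = v" | "p = u" "u \<noteq> v" | "u = v" "p \<noteq> u" | "p = v" "p \<noteq> u"
    | "p \<noteq> u" "u \<noteq> v" "p \<noteq> v" by blast
  then show ?thesis
  proof cases
    case 1
    then have "acount c t {#p, u, v#} = of_bool (c (t + u)) * of_bool (c (t + u + u))"
      using 3 by (simp add: acount_pair_same)
    then show ?thesis using 1 by (simp add: triple_count_def of_bool_def)
  next
    case 2
    then have "acount c t {#p, u, v#}
      = of_bool (c (t + u)) * (of_bool (c (t + u + u)) + of_bool (c (t + u + v)))
       + of_bool (c (t + v)) * of_bool (c (t + v + u))"
      using 3 by (simp add: acount_pair_same acount_pair add_mset_commute)
    then show ?thesis using 2 by (simp add: triple_count_def of_bool_def add_ac)
  next
    case c: 3
    then have "acount c t {#p, u, v#}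
      = of_bool (c (t + u)) * (of_bool (c (t + u + u)) + of_bool (c (t + u + p)))
       + of_bool (c (t + p)) * of_bool (c (t + p + u))"
      using 3 by (simp add: acount_pair_same acount_pair add_mset_commute)
    then show ?thesis using c by (simp add: triple_count_def of_bool_def add_ac)
  next
    case 4
    then have "acount c t {#p, u, v#}
      = of_bool (c (t + p)) * (of_bool (c (t + p + u)) + of_bool (c (t + p + p)))
       + of_bool (c (t + u)) * of_bool (c (t + u + p))"
      using 3 by (simp add: acount_pair_same acount_pair add_mset_commute)
    then show ?thesis using 4 by (simp add: triple_count_def of_bool_def add_ac)
  next
    case 5
    then have "acount c t {#p, u, v#}
      = of_bool (c (t + p)) * (of_bool (c (t + p + u)) + of_bool (c (t + p + v)))
       + of_bool (c (t + u)) * (of_bool (c (t + u + p)) + of_bool (c (t + u + v)))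
       + of_bool (c (t + v)) * (of_bool (c (t + v + p)) + of_bool (c (t + v + u)))"
      using 3 by (simp add: acount_pair add_mset_commute)
    then show ?thesis using 5 by (simp add: triple_count_def of_bool_def add_ac)
  qed
qed

lemma acount_triple_eqD:
  assumes "acount c t {#p, u, v#} = acount c' t' {#p, u, v#}"
  shows "triple_count c t p u v = triple_count c' t' p u v"
  using assms by (simp add: acount_triple)

lemma mset_split:
  assumes "Y \<subseteq># add_mset x X"
  shows "Y \<subseteq># X \<or> (\<exists>Z. Y = add_mset x Z \<and> Z \<subseteq># X)"
proof (cases "x \<in># Y")
  case True
  then obtain Z where "Y = add_mset x Z" by (meson mset_add)
  then show ?thesis using assms by auto
next
  case False
  then have "Y \<subseteq># X" using assms
    by (metis diff_single_trivial subset_eq_diff_conv add_mset_add_single)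
  then show ?thesis by simp
qed

text \<open>A proper nonempty part of \<open>X\<close> has a sum not divisible by \<open>l'\<close>,
  and adding the multiple \<open>u\<close> of \<open>l'\<close> does not change this. Only
  \<open>{#u#}\<close> and \<open>X\<close> itself remain, and they are the last two
  hypotheses.\<close>

lemma sum_free_add:
  assumes "sum_free l' X" "l' dvd l" "l' dvd u" "\<not> l dvd u" "\<not> l dvd sum_mset X"
  shows "sum_free l (add_mset u X)"
  unfolding sum_free_def
proof (intro allI impI)
  fix Y assume Y: "Y \<subseteq># add_mset u X" "Y \<noteq> {#}" "Y \<noteq> add_mset u X"
  have free: "\<not> l dvd s + sum_mset Z" if "Z \<subseteq># X" "Z \<noteq> {#}" "Z \<noteq> X" "l' dvd s" for Z s
  proof
    assume "l dvd s + sum_mset Z"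
    then have "l' dvd sum_mset Z"
      using that(4) assms(2) by (meson dvd_add_right_iff dvd_trans)
    then show False using assms(1) that by (auto simp: sum_free_def)
  qed
  from mset_split[OF Y(1)] show "\<not> l dvd sum_mset Y"
  proof (elim disjE exE conjE)
    assume "Y \<subseteq># X"
    then show ?thesis using free[of Y 0] Y(2) assms(5) by (cases "Y = X") auto
  next
    fix Z assume Z: "Y = add_mset u Z" "Z \<subseteq># X"
    then show ?thesis using free[of Z u] Y(3) assms(3,4) by (cases "Z = {#}") auto
  qed
qed

lemma sum_free_triple:
  assumes "\<not> l dvd p" "\<not> l dvd u" "\<not> l dvd v" "\<not> l dvd p + u" "\<not> l dvd p + v" "\<not> l dvd u + v"
  shows "sum_free l {#p, u, v#}"
  unfolding sum_free_def
proof (intro allI impI)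
  fix Y assume Y: "Y \<subseteq># {#p, u, v#}" "Y \<noteq> {#}" "Y \<noteq> {#p, u, v#}"
  have "Y \<in> {{#p#}, {#u#}, {#v#}, {#p, u#}, {#p, v#}, {#u, v#}}"
    using Y by (auto dest!: mset_split)
  then show "\<not> l dvd sum_mset Y" using assms by auto
qed

text \<open>In an arrangement of \<open>add_mset u X\<close> with \<open>u\<close> neither first nor last, no proper prefix sum is
  divisible by \<open>l\<close>; so \<open>c\<close> and \<open>c'\<close> only disagree on the arrangements that start or end with \<open>u\<close>.\<close>

lemma acount_shift:
  assumes X: "sum_mset X = N - u" "sum_free l X" and l: "l dvd u" "l dvd N"
    and agree: "\<And>i. \<not> l dvd i \<Longrightarrow> c i = c' i"
    and flip: "c u \<noteq> c' u" "c (N - u) = c' u" "c' (N - u) = c u"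
    and eq: "acount c 0 (add_mset u X) = acount c' 0 (add_mset u X)"
  shows "acount c u X = acount c 0 X"
proof (cases "size X \<le> 1")
  case True
  then have "X = {#} \<or> (\<exists>x. X = {#x#})"
    by (metis One_nat_def le_Suc_eq le_zero_eq size_1_singleton_mset size_eq_0_iff_empty)
  then show ?thesis by (intro acount_cong) (auto dest!: mset_split)
next
  case False
  have uX: "u \<notin># X"
  proof
    assume "u \<in># X"
    then have "{#u#} \<subseteq># X" by simp
    moreover have "{#u#} \<noteq> X" using False by auto
    ultimately have "\<not> l dvd sum_mset {#u#}" by (intro sum_freeD[OF X(2)]) simp_all
    then show False using l(1) by simp
  qed
  have cong: "acount f s X = acount f' s X" if "l dvd s" "\<And>i. \<not> l dvd i \<Longrightarrow> f i = f' i" for f f' s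
  proof (rule acount_cong)
    fix Y assume "Y \<subseteq># X" "Y \<noteq> {#}" "Y \<noteq> X"
    then have "\<not> l dvd sum_mset Y" using X(2) by (simp add: sum_free_def)
    then show "f (s + sum_mset Y) = f' (s + sum_mset Y)"
      using that by (simp add: dvd_add_right_iff)
  qed
  define Mid where "Mid f = {xs \<in> arrangements f 0 (add_mset u X). hd xs \<noteq> u \<and> last xs \<noteq> u}" for f
  have nd: "\<not> l dvd sum_list (take i xs)"
    if xs: "mset xs = add_mset u X" "hd xs \<noteq> u" "last xs \<noteq> u" and i: "0 < i" "i < length xs" for xs i
  proof -
    let ?Y = "mset (take i xs)"
    note Y = proper_prefix_mset[OF i, unfolded xs(1)]
    have "\<not> l dvd sum_mset ?Y"
      using mset_split[OF Y(1)]
    proof (elim disjE exE conjE)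
      assume sub: "?Y \<subseteq># X"
      have "?Y \<noteq> X"
      proof
        assume "?Y = X"
        then have "mset (drop i xs) = {#u#}"
          using xs(1) by (metis add_mset_add_single append_take_drop_id mset_append add_left_cancel)
        then have "drop i xs = [u]" by simp
        then show False using xs(3) i(2) by (metis last_drop last_ConsL)
      qed
      then show ?thesis using sub Y(2) X(2) by (simp add: sum_free_def)
    next
      fix Z assume Z: "?Y = add_mset u Z" "Z \<subseteq># X"
      have "Z \<noteq> {#}"
      proof
        assume "Z = {#}"
        then have "take i xs = [u]" using Z(1) by simp
        then show False using xs(2) i by (cases xs; cases i) auto
      qed
      moreover have "Z \<noteq> X" using Y(3) Z(1) by auto
      ultimately have "\<not> l dvd sum_mset Z" using Z(2) X(2) by (simp add: sum_free_def)
      then show ?thesis using Z(1) l(1) by (simp add: dvd_add_right_iff)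
    qed
    then show ?thesis by (simp add: sum_mset_sum_list)
  qed
  have Mid: "Mid c = Mid c'"
    unfolding Mid_def arrangements_def using nd agree by auto
  \<comment> \<open>The arrangements beginning with \<open>u\<close>, those ending with
    \<open>u\<close>, and the others; the first two classes are disjoint because \<open>u\<close>
    does not occur in \<open>X\<close>.\<close>
  have split: "acount f 0 (add_mset u X) = (if f u then acount f u X else 0)
        + (if f (N - u) then acount f 0 X else 0) + card (Mid f)" for f
  proof -
    let ?F = "if f u then (#) u ` arrangements f u X else {}"
    let ?L = "if f (N - u) then (\<lambda>ys. ys @ [u]) ` arrangements f 0 X else {}"
    have ne: "ys \<noteq> []" if "ys \<in> arrangements g s X" for ys g s
      using that False by (auto simp: arrangements_def)
    have sumX: "sum_list ys = N - u" if "mset ys = X" for ys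
      using that X(1) by (metis sum_mset_sum_list)
    have 1: "xs \<in> ?F" if xs: "xs \<in> arrangements f 0 (add_mset u X)" "hd xs = u" for xs
    proof -
      obtain ys where ys: "xs = u # ys" using xs by (cases xs) (auto simp: arrangements_def)
      have P: "f (sum_list (take i xs))" if "0 < i" "i < length xs" for i
        using xs that by (auto simp: arrangements_def)
      have m: "mset ys = X" using xs ys by (auto simp: arrangements_def)
      then have "ys \<noteq> []" using False by auto
      then have "f u" using P[of 1] ys by simp
      moreover have "f (u + sum_list (take i ys))" if "0 < i" "i < length ys" for i
        using P[of "Suc i"] ys that by simp
      ultimately show ?thesis using m ys by (auto simp: arrangements_def)
    qed
    have 2: "xs \<in> ?L" if xs: "xs \<in> arrangements f 0 (add_mset u X)" "last xs = u" for xs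
    proof -
      have "xs \<noteq> []" using xs by (auto simp: arrangements_def)
      then obtain ys where ys: "xs = ys @ [u]" using xs(2) by (metis append_butlast_last_id)
      have P: "f (sum_list (take i xs))" if "0 < i" "i < length xs" for i
        using xs that by (auto simp: arrangements_def)
      have m: "mset ys = X" using xs ys by (auto simp: arrangements_def)
      then have "ys \<noteq> []" using False by auto
      then have "f (N - u)" using P[of "length ys"] ys sumX[OF m] by simp
      moreover have "f (sum_list (take i ys))" if "0 < i" "i < length ys" for i
        using P[of i] ys that by simp
      ultimately show ?thesis using m ys by (auto simp: arrangements_def)
    qed
    have 3: "xs \<in> arrangements f 0 (add_mset u X)" if "xs \<in> ?F" for xs
    proof -
      from that have fu: "f u" by (auto split: if_splits)
      with that obtain ys where ys: "xs = u # ys" "ys \<in> arrangements f u X" by auto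
      have "f (sum_list (take i xs))" if "0 < i" "i < length xs" for i
        using that ys fu by (cases i; cases "i = 1") (auto simp: arrangements_def)
      then show ?thesis using ys by (auto simp: arrangements_def)
    qed
    have 4: "xs \<in> arrangements f 0 (add_mset u X)" if "xs \<in> ?L" for xs
    proof -
      from that have fu: "f (N - u)" by (auto split: if_splits)
      with that obtain ys where ys: "xs = ys @ [u]" "ys \<in> arrangements f 0 X" by auto
      then have m: "mset ys = X" by (simp add: arrangements_def)
      have "f (sum_list (take i xs))" if "0 < i" "i < length xs" for i
        using that ys fu sumX[OF m] by (cases "i = length ys") (auto simp: arrangements_def)
      then show ?thesis using ys by (auto simp: arrangements_def)
    qed
    have eq: "arrangements f 0 (add_mset u X) = (?F \<union> ?L) \<union> Mid f"
      using 1 2 3 4 unfolding Mid_def by blast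
    have hF: "hd xs = u" "last xs \<noteq> u" if "xs \<in> ?F" for xs
      using that uX ne by (auto split: if_splits simp: arrangements_def)
    have hL: "last xs = u" if "xs \<in> ?L" for xs
      using that by (auto split: if_splits)
    have d1: "?F \<inter> ?L = {}" using hF(2) hL by blast
    have d2: "(?F \<union> ?L) \<inter> Mid f = {}" using hF(1) hL unfolding Mid_def by blast
    have fin: "finite ?F" "finite ?L" "finite (Mid f)" by (auto simp: Mid_def)
    have "acount f 0 (add_mset u X) = card ?F + card ?L + card (Mid f)"
      unfolding acount_def eq
      using card_Un_disjoint[OF _ fin(3) d2] card_Un_disjoint[OF fin(1,2) d1] fin
      by (metis finite_Un)
    moreover have "card ?F = (if f u then acount f u X else 0)"
      by (simp add: acount_def card_image)
    moreover have "card ?L = (if f (N - u) then acount f 0 X else 0)"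
      by (simp add: acount_def card_image inj_on_def)
    ultimately show ?thesis by simp
  qed
  \<comment> \<open>By \<open>flip\<close> exactly one of \<open>c u\<close> and
    \<open>c (N - u)\<close> holds, and for \<open>c'\<close> it is the other one. So in
    \<open>eq\<close> one side counts \<open>X\<close> from \<open>u\<close> and the other from
    \<open>0\<close>; off the multiples of \<open>l\<close> both sequences are the same.\<close>
  have "acount c' 0 X = acount c 0 X" "acount c' u X = acount c u X"
    using cong agree l(1) by (metis dvd_0_right)+
  then show ?thesis
    using eq flip unfolding split Mid by (auto split: if_splits)
qed

section \<open>Subgroups and periods of the integers\<close>

lemma subgroup_mult:
  fixes H :: "int set"
  assumes H: "0 \<in> H" "\<And>x y. x \<in> H \<Longrightarrow> y \<in> H \<Longrightarrow> x - y \<in> H" and g: "g \<in> H" "g dvd x"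
  shows "x \<in> H"
proof -
  have neg: "- x \<in> H" if "x \<in> H" for x using H(2)[OF H(1) that] by simp
  have add: "x + y \<in> H" if "x \<in> H" "y \<in> H" for x y using H(2)[OF that(1) neg[OF that(2)]] by simp
  have mul: "y * int j \<in> H" if "y \<in> H" for y j
    by (induction j) (use H(1) add that in \<open>auto simp: algebra_simps\<close>)
  obtain j where "x = g * j" using g(2) by auto
  then show ?thesis using mul[OF g(1), of "nat j"] mul[OF neg[OF g(1)], of "nat (- j)"]
    by (cases "0 \<le> j") auto
qed

text \<open>By division with remainder the least positive element of \<open>H\<close> divides all of
  \<open>M\<close>, and hence the Gcd.\<close>

lemma Gcd_mem_subgroup:
  fixes H :: "int set"
  assumes H: "0 \<in> H" "\<And>x y. x \<in> H \<Longrightarrow> y \<in> H \<Longrightarrow> x - y \<in> H"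
    and M: "M \<subseteq> H" "m \<in> M" "0 < m"
  shows "Gcd M \<in> H"
proof -
  define k where "k = (LEAST k::nat. 0 < k \<and> int k \<in> H)"
  have ex: "\<exists>k::nat. 0 < k \<and> int k \<in> H" using M by (intro exI[of _ "nat m"]) auto
  have k: "0 < k" "int k \<in> H" using LeastI_ex[OF ex] by (auto simp: k_def)
  have "int k dvd x" if "x \<in> M" for x
  proof (rule ccontr)
    assume "\<not> int k dvd x"
    then have "x mod int k \<noteq> 0" by (simp add: mod_eq_0_iff_dvd)
    moreover have "0 \<le> x mod int k" using k(1) by simp
    ultimately have "0 < nat (x mod int k)" by linarith
    moreover have "x mod int k = x - int k * (x div int k)" by (simp add: minus_mult_div_eq_mod)
    then have "x mod int k \<in> H" using H(2) subgroup_mult[OF H k(2)] M(1) that by auto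
    then have "int (nat (x mod int k)) \<in> H" using k(1) by simp
    ultimately have "k \<le> nat (x mod int k)" unfolding k_def by (intro Least_le) auto
    moreover have "x mod int k < int k" using k(1) by simp
    ultimately show False using k(1) by linarith
  qed
  then have "int k dvd Gcd M" by (rule Gcd_greatest)
  then show ?thesis using subgroup_mult[OF H k(2)] by blast
qed

text \<open>The elements of \<open>H\<close> whose negatives also lie in \<open>H\<close> form a
  subgroup. This suits sets of translations that preserve something, where closure under sums is
  immediate.\<close>

lemma Gcd_mem_submonoid:
  fixes H :: "int set"
  assumes H: "0 \<in> H" "\<And>x y. x \<in> H \<Longrightarrow> y \<in> H \<Longrightarrow> x + y \<in> H"
    and M: "\<And>x. x \<in> M \<Longrightarrow> x \<in> H \<and> - x \<in> H" "m \<in> M" "0 < m"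
  shows "Gcd M \<in> H"
proof -
  have "Gcd M \<in> {x \<in> H. - x \<in> H}"
  proof (rule Gcd_mem_subgroup)
    fix x y assume "x \<in> {x \<in> H. - x \<in> H}" "y \<in> {x \<in> H. - x \<in> H}"
    then show "x - y \<in> {x \<in> H. - x \<in> H}" using H(2)[of x "- y"] H(2)[of "- x" y] by simp
  qed (use H(1) M in auto)
  then show ?thesis by simp
qed

lemma full_periodic:
  fixes f :: "int \<Rightarrow> 'a"
  assumes per: "\<And>i. f (i + m) = f i" and "m dvd j - i"
  shows "f j = f i"
proof -
  have nat: "f (i + m * int t) = f i" for i t
  proof (induction t)
    case (Suc t)
    from per[of "i + m * int t"] show ?case using Suc by (simp add: algebra_simps)
  qed simp
  obtain s where s: "j - i = m * s" using assms(2) by auto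
  show ?thesis
  proof (cases "0 \<le> s")
    case True
    then show ?thesis using nat[of i "nat s"] s by (simp add: algebra_simps)
  next
    case False
    have i: "i = j + m * int (nat (- s))" using s False by (simp add: algebra_simps)
    show ?thesis unfolding i by (rule nat[symmetric])
  qed
qed

text \<open>Overwriting \<open>f\<close> by a constant on the multiples of \<open>l\<close> makes it
  periodic everywhere, which reduces the claim to \<open>full_periodic\<close>.\<close>

lemma dvd_periodic:
  fixes f :: "int \<Rightarrow> 'a"
  assumes per: "\<And>i. \<not> l dvd i \<Longrightarrow> f (i + m) = f i" and lm: "l dvd m" "m dvd j - i" and i: "\<not> l dvd i"
  shows "f j = f i"
proof -
  have "(if l dvd j then undefined else f j) = (if l dvd i then undefined else f i)"
    by (rule full_periodic[of "\<lambda>i. if l dvd i then undefined else f i" m])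
      (use per lm in \<open>auto simp: dvd_add_left_iff\<close>)
  moreover have "\<not> l dvd j"
  proof
    assume "l dvd j"
    then have "l dvd j - (j - i)" using dvd_trans[OF lm] by (rule dvd_diff)
    then show False using i by simp
  qed
  ultimately show ?thesis using i by simp
qed

text \<open>The periods off the multiples of \<open>l\<close> that are themselves multiples of
  \<open>l\<close> form a subgroup: translating by them never leaves the complement.\<close>

lemma periodic_Gcd:
  fixes f :: "int \<Rightarrow> 'a"
  assumes per: "\<And>x u. x \<in> M \<Longrightarrow> \<not> l dvd u \<Longrightarrow> f (u + x) = f u"
    and dvd: "\<And>x. x \<in> M \<Longrightarrow> l dvd x" and m: "m \<in> M" "0 < m" and u: "\<not> l dvd u"
  shows "f (u + Gcd M) = f u"
proof -
  define S where "S = {g. l dvd g \<and> (\<forall>u. \<not> l dvd u \<longrightarrow> f (u + g) = f u)}"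
  have "Gcd M \<in> S"
  proof (rule Gcd_mem_subgroup)
    show "0 \<in> S" by (simp add: S_def)
    show "x - y \<in> S" if xy: "x \<in> S" "y \<in> S" for x y
    proof -
      have "f (u + (x - y)) = f u" if u: "\<not> l dvd u" for u
      proof -
        have ly: "l dvd y" using xy(2) by (simp add: S_def)
        have nd: "\<not> l dvd u - y" using u ly by (metis diff_add_cancel dvd_add)
        have "f (u - y + x) = f (u - y)" "f (u - y + y) = f (u - y)"
          using xy nd unfolding S_def by blast+
        then show ?thesis by (simp add: algebra_simps)
      qed
      then show ?thesis using xy by (simp add: S_def)
    qed
    show "M \<subseteq> S" using per dvd by (auto simp: S_def)
  qed (use m in auto)
  then show ?thesis using u by (simp add: S_def)
qed

section \<open>Invisible shifts\<close>

text \<open>Relates \<open>a\<close> and its translate by \<open>y\<close> in the way in which equal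
  counts relate \<open>a\<close> and \<open>b\<close>, but only for sum-free multisets of total
  \<open>N\<close>.\<close>

definition shift_inv :: "(int \<Rightarrow> bool) \<Rightarrow> int \<Rightarrow> int \<Rightarrow> int \<Rightarrow> bool" where
  "shift_inv a l y N \<longleftrightarrow>
     (\<forall>X. (\<forall>x\<in>#X. 0 < x) \<longrightarrow> sum_mset X = N \<longrightarrow> sum_free l X \<longrightarrow> acount a y X = acount a 0 X)"

text \<open>An application of \<open>acount_shift\<close> to \<open>a\<close> and its translate by
  \<open>y\<close>. The subgroup grows from the multiples of \<open>l\<close> to those of
  \<open>l'\<close>, at the price of reducing the total by \<open>u\<close>.\<close>

lemma shift_inv_step:
  assumes inv: "shift_inv a l y N" and l: "l' dvd l" "l dvd N" "l' dvd u" "\<not> l dvd u" and u: "0 < u"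
    and off: "\<And>i. \<not> l' dvd i \<Longrightarrow> a (y + i) = a i"
    and flip: "a u \<noteq> a (y + u)" "a (N - u) = a (y + u)" "a (y + (N - u)) = a u"
  shows "shift_inv a l' u (N - u)"
  unfolding shift_inv_def
proof (intro allI impI)
  fix X assume X: "\<forall>x\<in>#X. 0 < x" "sum_mset X = N - u" "sum_free l' X"
  have "\<not> l dvd N - u" using l(2,4) by (metis dvd_diff diff_diff_eq2 add_diff_cancel_left')
  then have "sum_free l (add_mset u X)" using sum_free_add[OF X(3) l(1,3,4)] X(2) by simp
  then have "acount a y (add_mset u X) = acount a 0 (add_mset u X)"
    using inv X(1,2) u by (simp add: shift_inv_def)
  moreover have "acount a y (add_mset u X) = acount (\<lambda>i. a (y + i)) 0 (add_mset u X)"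
    by (rule acount_cong) simp
  ultimately have eq: "acount a 0 (add_mset u X) = acount (\<lambda>i. a (y + i)) 0 (add_mset u X)" by simp
  show "acount a u X = acount a 0 X"
    by (rule acount_shift[OF X(2,3) l(3) _ _ _ _ _ eq]) (use l off flip in \<open>auto intro: dvd_trans\<close>)
qed

text \<open>The subgroup \<open>H\<close> below stabilizes both \<open>P\<close> and the values of \<open>a\<close> on \<open>P\<close>. As \<open>0 \<notin> P\<close>, no subgroup of
  \<open>H\<close> meets \<open>P\<close>.\<close>

locale odd_part =
  fixes a :: "int \<Rightarrow> bool" and P :: "int set" and k :: int
  assumes k_pos: "0 < k"
    and P_def: "P = {i. \<not> k dvd i \<and> a i \<noteq> a (- i)}"
    and P_k: "p \<in> P \<Longrightarrow> p + k \<in> P \<and> a (p + k) = a p"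
begin

definition H :: "int set" where "H = {g. \<forall>p\<in>P. p + g \<in> P \<and> a (p + g) = a p}"

lemma P_uminus: "p \<in> P \<Longrightarrow> - p \<in> P" "p \<in> P \<Longrightarrow> a (- p) \<longleftrightarrow> \<not> a p"
  by (auto simp: P_def)

lemma P_sym: "\<not> k dvd i \<Longrightarrow> i \<notin> P \<Longrightarrow> a (- i) = a i"
  by (auto simp: P_def)

lemma zero_notin_P: "0 \<notin> P" by (simp add: P_def)

lemma H_plus: "g \<in> H \<Longrightarrow> p \<in> P \<Longrightarrow> p + g \<in> P" "g \<in> H \<Longrightarrow> p \<in> P \<Longrightarrow> a (p + g) = a p"
  by (auto simp: H_def)

lemma H_zero: "0 \<in> H" by (simp add: H_def)

lemma k_mem_H: "k \<in> H" using P_k by (simp add: H_def)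

lemma H_minus: "g \<in> H \<Longrightarrow> - g \<in> H"
proof -
  assume g: "g \<in> H"
  have "p - g \<in> P \<and> a (p - g) = a p" if p: "p \<in> P" for p
  proof -
    have 1: "- p + g \<in> P" "a (- p + g) = a (- p)" using H_plus[OF g P_uminus(1)[OF p]] by auto
    then show ?thesis using P_uminus[OF 1(1)] P_uminus(2)[OF p] by auto
  qed
  then show ?thesis by (simp add: H_def)
qed

lemma H_add: "g \<in> H \<Longrightarrow> h \<in> H \<Longrightarrow> g + h \<in> H"
  unfolding H_def by (simp add: add.assoc[symmetric])

lemma H_diff: "g \<in> H \<Longrightarrow> h \<in> H \<Longrightarrow> g - h \<in> H"
  using H_add[OF _ H_minus, of g h] by simp

lemma H_mult: "g \<in> H \<Longrightarrow> g dvd x \<Longrightarrow> x \<in> H"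
  using subgroup_mult H_zero H_diff by blast

lemma P_cong:
  assumes "l \<in> H" "l dvd j - i" "i \<in> P"
  shows "j \<in> P" "a j = a i"
  using H_plus[OF H_mult[OF assms(1,2)] assms(3)] by simp_all

lemma P_not_dvd: assumes "l \<in> H" "i \<in> P" shows "\<not> l dvd i"
  using P_cong(1)[OF assms(1) _ assms(2), of 0] zero_notin_P by auto

text \<open>As \<open>l\<close> stabilizes \<open>P\<close> and the values of \<open>a\<close> on
  it, an element of \<open>P\<close> that witnesses \<open>u \<notin> H\<close> may be reduced
  modulo \<open>l\<close>, and it serves as witness for the whole residue class of
  \<open>u\<close>.\<close>

lemma notin_H:
  assumes l: "l \<in> H" "0 < l" and "u \<notin> H"
  obtains p where "p \<in> P" "0 < p" "p < l"
    "\<And>i. l dvd i - u \<Longrightarrow> \<not> (p + i \<in> P \<and> a (p + i) = a p)"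
proof -
  obtain p where p: "p \<in> P" "\<not> (p + u \<in> P \<and> a (p + u) = a p)"
    using assms(3) by (auto simp: H_def)
  have d: "l dvd p mod l - p"
    by (metis dvd_minus_iff minus_diff_eq dvd_minus_mod)
  have m: "p mod l \<in> P" "a (p mod l) = a p" using P_cong[OF l(1) d p(1)] by auto
  have "p mod l \<noteq> 0" using m(1) zero_notin_P by metis
  then have "0 < p mod l" using pos_mod_sign[OF l(2), of p] by linarith
  moreover have "\<not> (p mod l + i \<in> P \<and> a (p mod l + i) = a (p mod l))" if i: "l dvd i - u" for i
  proof
    assume *: "p mod l + i \<in> P \<and> a (p mod l + i) = a (p mod l)"
    have "(p + u) - (p mod l + i) = - ((p mod l - p) + (i - u))" by simp
    then have "l dvd (p + u) - (p mod l + i)" using d i by (metis dvd_add dvd_minus_iff)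
    from P_cong[OF l(1) this] * p(2) m(2) show False by auto
  qed
  ultimately show ?thesis using that[OF m(1)] l(2) by simp
qed

text \<open>Compares the arrangements of \<open>p\<close>, \<open>u\<close> and
  \<open>N - p - u\<close>. As \<open>m\<close> divides \<open>N + y\<close>, the positions
  \<open>N - i\<close> and \<open>y + (N - i)\<close> carry the values of \<open>a\<close> at
  \<open>- y - i\<close> and \<open>- i\<close>, which are known by antisymmetry on \<open>P\<close>
  and symmetry off \<open>P\<close>. The remaining Boolean equation leaves two outcomes:
  \<open>p + u\<close> behaves like \<open>p\<close> or like \<open>u\<close>.\<close>

lemma triple_rule:
  assumes inv: "shift_inv a l y N"
    and l: "l \<in> H" "l dvd k" "l dvd m" "l dvd y" "l dvd N" "m dvd N + y"
    and per: "\<And>i. \<not> l dvd i \<Longrightarrow> a (i + m) = a i"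
    and u: "0 < u" "\<not> l dvd u" "a u \<noteq> a (u + y)"
    and p: "p \<in> P" "0 < p" "p + u < N"
  shows "p + u \<in> P \<and> a (p + u) = a p \<or> p + u \<notin> P \<and> a (p + u) = a u \<and> a (p + u + y) \<noteq> a (p + u)"
    and "\<not> l dvd p + u"
proof -
  define w where "w = p + u"
  define v where "v = N - w"
  have nk: "\<not> k dvd i" if "\<not> l dvd i" for i using that l(2) dvd_trans by blast
  have y: "y \<in> H" "- y \<in> H" using H_mult[OF l(1,4)] H_minus by auto
  have u': "u \<notin> P" "u + y \<notin> P"
    using u(3) H_plus(2)[OF y(1), of u] H_plus[OF y(2), of "u + y"] by auto
  have lp: "\<not> l dvd p" using P_not_dvd l(1) p(1) .
  have lw: "\<not> l dvd w"
  proof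
    assume "l dvd w"
    then have "l dvd u - (- p)" by (simp add: w_def add.commute)
    from P_cong(1)[OF l(1) this P_uminus(1)[OF p(1)]] u'(1) show False by simp
  qed
  show "\<not> l dvd p + u" using lw by (simp add: w_def)
  have sub: "\<not> l dvd N - i" "\<not> l dvd - y - i" "\<not> l dvd - i" "\<not> l dvd i + y" if "\<not> l dvd i" for i
  proof -
    show "\<not> l dvd N - i" using that l(5) by (metis dvd_diff diff_diff_eq2 add_diff_cancel_left')
    show "\<not> l dvd - y - i" using that l(4)
      by (metis dvd_minus_iff minus_diff_eq diff_minus_eq_add dvd_add_left_iff)
    show "\<not> l dvd - i" using that by simp
    show "\<not> l dvd i + y" using that l(4) by (simp add: dvd_add_left_iff)
  qed
  have end1: "a (N - i) = a (- y - i)" if "\<not> l dvd i" for i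
    by (rule dvd_periodic[of l a m, OF per l(3)]) (use sub[OF that] l(6) in auto)
  have end2: "a (y + (N - i)) = a (- i)" if "\<not> l dvd i" for i
    by (rule dvd_periodic[of l a m, OF per l(3)]) (use sub[OF that] l(6) in \<open>auto simp: add.commute\<close>)
  have free: "sum_free l {#p, u, v#}"
  proof (rule sum_free_triple)
    show "\<not> l dvd p + v" "\<not> l dvd u + v"
      using sub(1)[OF u(2)] sub(1)[OF lp] by (simp_all add: v_def w_def)
  qed (use lp u(2) lw sub(1)[OF lw] in \<open>simp_all add: v_def w_def\<close>)
  have pos: "0 < v" using p(3) by (simp add: v_def w_def)
  have sum: "sum_mset {#p, u, v#} = N" by (simp add: v_def w_def)
  have "acount a y {#p, u, v#} = acount a 0 {#p, u, v#}"
    by (rule inv[unfolded shift_inv_def, rule_format, OF _ sum free]) (use pos u(1) p(2) in auto)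
  from acount_triple_eqD[OF this]
  have T: "triple_count a y p u v = triple_count a 0 p u v" .
  have e: "p + v = N - u" "u + v = N - p" "p + u = w" "y + p + v = y + (N - u)"
    "y + u + v = y + (N - p)" "y + p + u = y + w" "v = N - w" "y + v = y + (N - w)"
    by (simp_all add: v_def w_def)
  have sw: "- y - i = - i - y" for i by simp
  have pa: "a (y + p) = a p" "a (- p) = (\<not> a p)" "a (- y - p) = (\<not> a p)"
    using H_plus(2)[OF y(1) p(1)] P_uminus(2)[OF p(1)] H_plus(2)[OF y(2) P_uminus(1)[OF p(1)]]
    by (simp_all add: add.commute sw)
  have ua: "a (- u) = a u" "a (- y - u) = a (y + u)" "a (y + u) = (\<not> a u)"
    using P_sym[OF nk[OF u(2)] u'(1)] P_sym[OF nk[OF sub(4)[OF u(2)]] u'(2)] u(3)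
    by (simp_all add: add.commute sw)
  have T': "of_bool (a p \<and> a w) + of_bool (a u \<and> a w) + of_bool (a p \<and> a (y + u)) +
      of_bool (a (- y - w) \<and> a (y + u)) + of_bool (a u \<and> \<not> a p) + of_bool (a (- y - w) \<and> \<not> a p)
    = (of_bool (a p \<and> a (y + w)) + of_bool (a (y + u) \<and> a (y + w)) + of_bool (a p \<and> a u) +
      of_bool (a (- w) \<and> a u) + of_bool (a (y + u) \<and> \<not> a p) + of_bool (a (- w) \<and> \<not> a p) :: nat)"
    using T unfolding triple_count_def add_0 e(1-6)
    unfolding e(7,8) end1[OF lp] end1[OF u(2)] end1[OF lw] end2[OF lp] end2[OF
      u(2)] end2[OF lw] pa ua(1,2)
    by (simp only:)
  have main: "w \<in> P \<and> a w = a p \<or> w \<notin> P \<and> a w = a u \<and> a (w + y) \<noteq> a w"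
  proof (cases "w \<in> P")
    case True
    have "a (y + w) = a w" "a (- w) = (\<not> a w)" "a (- y - w) = (\<not> a w)"
      using H_plus(2)[OF y(1) True] P_uminus(2)[OF True] H_plus(2)[OF y(2) P_uminus(1)[OF True]]
      by (simp_all add: add.commute sw)
    then have "a w = a p" using T' unfolding ua(3)
      by (cases "a w"; cases "a p"; cases "a u") simp_all
    then show ?thesis using True by simp
  next
    case False
    have "w + y \<notin> P" using H_plus(1)[OF y(2), of "w + y"] False by auto
    then have "a (- w) = a w" "a (- y - w) = a (y + w)"
      using P_sym[OF nk[OF lw] False] P_sym[OF nk[OF sub(4)[OF lw]] \<open>w + y \<notin> P\<close>]
      unfolding sw[of w] add.commute[of y w] by simp_all
    then have "a w = a u \<and> a (y + w) \<noteq> a w" using T' unfolding ua(3)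
      by (cases "a w"; cases "a p"; cases "a u"; cases "a (y + w)") simp_all
    then show ?thesis using False by (simp only: add.commute[of w y] simp_thms)
  qed
  show "p + u \<in> P \<and> a (p + u) = a p \<or> p + u \<notin> P \<and> a (p + u) = a u \<and> a (p + u + y) \<noteq> a (p + u)"
    using main by (simp add: w_def)
qed

text \<open>If \<open>u \<notin> H\<close>, then \<open>triple_rule\<close> propagates the failure at \<open>u\<close> of \<open>y\<close>-periodicity to \<open>u + l\<close>, with the
  same value of \<open>a\<close>, and finally to \<open>u + y\<close>, where it is absurd.\<close>

lemma bad_in_H:
  assumes inv: "shift_inv a l y N"
    and l: "l \<in> H" "l dvd k" "l dvd m" "l dvd y" "m dvd N + y"
    and pos: "0 < l" "0 < m" "0 < y" "m < N"
    and per: "\<And>i. \<not> l dvd i \<Longrightarrow> a (i + m) = a i"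
    and u: "\<not> l dvd u" "a u \<noteq> a (u + y)"
  shows "u \<in> H"
proof (rule ccontr)
  assume "u \<notin> H"
  then obtain p where p: "p \<in> P" "0 < p" "p < l"
    and fail: "\<And>i. l dvd i - u \<Longrightarrow> \<not> (p + i \<in> P \<and> a (p + i) = a p)"
    using notin_H[OF l(1) pos(1)] by blast
  have lN: "l dvd N"
    using l(3-5) by (metis dvd_trans dvd_add_left_iff)
  \<comment> \<open>Both \<open>m < N\<close> are multiples of \<open>l\<close>. So parts below
    \<open>m\<close> and below \<open>l\<close> still leave a positive third part.\<close>
  have mlN: "m + l \<le> N"
  proof -
    have "l dvd N - m" using lN l(3) by (rule dvd_diff)
    then show ?thesis using pos(4) by (auto dest: zdvd_imp_le)
  qed
  have y: "y \<in> H" "- y \<in> H" using H_mult[OF l(1,4)] H_minus by auto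
  have badP: "i \<notin> P" if "a i \<noteq> a (i + y)" for i
    using H_plus(2)[OF y(1)] that by blast
  have lp: "l - p \<in> P" "0 < l - p"
    using P_cong(1)[OF l(1) _ P_uminus(1)[OF p(1)], of "l - p"] p(3) by simp_all
  have perm: "a j = a i" if "m dvd j - i" "\<not> l dvd i" for i j
    by (rule dvd_periodic[of l a m, OF per l(3)]) (use that in auto)
  \<comment> \<open>Two uses of \<open>triple_rule\<close>, with \<open>p\<close> and then with
    \<open>l - p\<close>, lead from \<open>i\<close> to \<open>i + l\<close>; before each, the
    position is reduced modulo \<open>m\<close> to fit below \<open>N\<close>. The outcome in
    \<open>P\<close> is excluded by \<open>fail\<close> the first time, and by the stability of
    \<open>P\<close> under \<open>l\<close> the second time.\<close>
  have step: "a (i + l) = a i \<and> a (i + l) \<noteq> a (i + l + y)"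
    if i: "l dvd i - u" "\<not> l dvd i" "a i \<noteq> a (i + y)" for i
  proof -
    have ly: "\<not> l dvd x + y" if "\<not> l dvd x" for x using that l(4) by (simp add: dvd_add_left_iff)
    define r where "r = i mod m"
    have r0: "m dvd r - i" unfolding r_def by (metis dvd_minus_iff minus_diff_eq dvd_minus_mod)
    then have lr: "l dvd r - i" using l(3) dvd_trans by blast
    have ldr: "\<not> l dvd r" using i(2) lr by (metis dvd_diff diff_diff_eq2 add_diff_cancel_left')
    have r: "0 < r" "r < m" "a r = a i" "a (r + y) = a (i + y)"
    proof -
      have "r \<noteq> 0" using ldr by auto
      then show "0 < r" "r < m" using pos_mod_sign[OF pos(2), of i] pos_mod_bound[OF pos(2), of i]
        unfolding r_def by linarith+
      show "a r = a i" "a (r + y) = a (i + y)"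
        using perm[OF r0 i(2)] perm[OF _ ly[OF i(2)], of "r + y"] r0 by simp_all
    qed
    have lru: "l dvd r - u" using dvd_add[OF lr i(1)] by simp
    have w: "p + r \<notin> P" "a (p + r) = a i" "a (p + r + y) \<noteq> a (p + r)" "\<not> l dvd p + r"
      using triple_rule[OF inv l(1-4) lN l(5) per r(1) ldr _ p(1,2)] fail[OF lru] r i(3) p(3) mlN by auto
    define s where "s = (p + r) mod m"
    have s0: "m dvd s - (p + r)" unfolding s_def by (metis dvd_minus_iff minus_diff_eq dvd_minus_mod)
    then have ls: "l dvd s - (p + r)" using l(3) dvd_trans by blast
    have lds: "\<not> l dvd s" using w(4) ls by (metis dvd_diff diff_diff_eq2 add_diff_cancel_left')
    have s: "0 < s" "s < m" "a s = a i" "a (s + y) = a (p + r + y)"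
    proof -
      have "s \<noteq> 0" using lds by auto
      then show "0 < s" "s < m"
        using pos_mod_sign[OF pos(2), of "p + r"] pos_mod_bound[OF pos(2), of "p + r"]
        unfolding s_def by linarith+
      show "a s = a i" "a (s + y) = a (p + r + y)"
        using perm[OF s0 w(4)] perm[OF _ ly[OF w(4)], of "s + y"] s0 w(2) by simp_all
    qed
    define z where "z = (l - p) + s"
    have z0: "m dvd (i + l) - z"
    proof -
      have "(i + l) - z = - (r - i) - (s - (p + r))" by (simp add: z_def)
      then show ?thesis using r0 s0 by (metis dvd_diff dvd_minus_iff)
    qed
    have "z \<notin> P"
    proof
      assume z: "z \<in> P"
      have "l dvd (i + l) - z" using z0 l(3) dvd_trans by blast
      then have "l dvd ((i + l) - z) - l" by (rule dvd_diff) simp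
      moreover have "((i + l) - z) - l = i - z" by simp
      ultimately have "l dvd i - z" by simp
      from P_cong(1)[OF l(1) this z] show False using badP[OF i(3)] by simp
    qed
    then have z: "a z = a i" "a (z + y) \<noteq> a z" "\<not> l dvd z"
      using triple_rule[OF inv l(1-4) lN l(5) per s(1) lds _ lp] s w(2,3) p(2) mlN
      unfolding z_def by auto
    then show ?thesis using perm[OF z0 z(3)] perm[OF _ ly[OF z(3)], of "i + l + y"] z0 by auto
  qed
  have run: "a (u + l * int j) = a u \<and> a (u + l * int j) \<noteq> a (u + l * int j + y)" for j
  proof (induction j)
    case (Suc j)
    have "\<not> l dvd u + l * int j" using u(1) by (simp add: dvd_add_left_iff)
    then have "a (u + l * int j + l) = a (u + l * int j) \<and>
      a (u + l * int j + l) \<noteq> a (u + l * int j + l + y)"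
      by (intro step) (use Suc in auto)
    moreover have "u + l * int (Suc j) = u + l * int j + l" by (simp add: algebra_simps)
    ultimately show ?case using Suc by metis
  qed (use u in simp)
  obtain j where j: "y = l * j" using l(4) by auto
  then have "0 \<le> j" using pos(1,3) by (simp add: zero_less_mult_iff)
  then have "a (u + y) = a u" using run[of "nat j"] j by simp
  then show False using u(2) by simp
qed

text \<open>A failure at \<open>u\<close> of \<open>y\<close>-periodicity, where \<open>y\<close> is an invisible shift for \<open>l\<close>, makes \<open>u\<close> itself an
  invisible shift, for the smaller subgroup generated by \<open>l\<close> and all such failures.\<close>

lemma descent:
  assumes "0 < l" "l \<in> H" "l dvd k" "0 < m" "l = Gcd (insert m (fst ` Q))"
    and "\<And>i. \<not> l dvd i \<Longrightarrow> a (i + m) = a i"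
    and "\<And>y N. (y, N) \<in> Q \<Longrightarrow> 0 < y \<and> m < N \<and> m dvd N + y \<and> shift_inv a l y N"
  shows "\<exists>d. 0 < d \<and> d dvd l \<and> d \<in> H \<and> (\<forall>i. \<not> d dvd i \<longrightarrow> a (i + d) = a i)"
  using assms
proof (induction "nat l" arbitrary: l m Q rule: less_induct)
  case less
  note l = less.prems
  have lm: "l dvd m" unfolding l(5) by (rule Gcd_dvd) simp
  have ly: "l dvd y" if "(y, N) \<in> Q" for y N
    unfolding l(5) by (rule Gcd_dvd) (use that in force)
  have per: "a j = a i" if "m dvd j - i" "\<not> l dvd i" for i j
    by (rule dvd_periodic[of l a m, OF l(6) lm]) (use that in auto)
  \<comment> \<open>Each failure is stored with the total that remains after it, the form in which
    it serves as an element of \<open>Q\<close> in the next round.\<close>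
  define B where "B = {(u, N - u) | u y N. (y, N) \<in> Q \<and> 0 < u \<and> u < m \<and> \<not> l dvd u \<and> a u \<noteq> a (u + y)}"
  define l' where "l' = Gcd (insert l (fst ` B))"
  have BH: "u \<in> H" if u: "(u, M) \<in> B" for u M
  proof -
    obtain y N where "(y, N) \<in> Q" "\<not> l dvd u" "a u \<noteq> a (u + y)"
      using u unfolding B_def by blast
    then show ?thesis using bad_in_H[OF _ l(2,3) lm ly _ l(1,4) _ _ l(6)] l(7) by blast
  qed
  have l'H: "l' \<in> H" unfolding l'_def
    by (rule Gcd_mem_subgroup[where m = l]) (use H_zero H_diff l(1,2) BH in auto)
  have l'l: "l' dvd l" unfolding l'_def by (rule Gcd_dvd) simp
  have l'u: "l' dvd u" if "(u, M) \<in> B" for u M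
    unfolding l'_def by (rule Gcd_dvd) (use that in force)
  have l'0: "0 < l'"
  proof -
    have "l' \<noteq> 0" using l'l l(1) by auto
    then show ?thesis unfolding l'_def using Gcd_int_greater_eq_0 by (metis order_less_le)
  qed
  \<comment> \<open>Off the multiples of \<open>l'\<close> no failure is left. So \<open>m\<close>
    and all shifts from \<open>Q\<close> are periods there, and with them their Gcd
    \<open>l\<close>.\<close>
  have off: "a (i + x) = a i" if "l dvd x" "\<not> l' dvd i" for i x
  proof -
    have nl: "\<not> l dvd u" if "\<not> l' dvd u" for u using that l'l dvd_trans by blast
    have yper: "a (u + y) = a u" if y: "(y, N) \<in> Q" and u: "\<not> l' dvd u" for y N u
        proof -
          define r where "r = u mod m"
          have r0: "m dvd u - r" unfolding r_def by (rule dvd_minus_mod)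
          then have lr: "l dvd u - r" using lm dvd_trans by blast
          then have l'r: "\<not> l' dvd r" using u l'l by (metis diff_add_cancel dvd_add dvd_trans)
          note ldr = nl[OF l'r]
          have "r \<noteq> 0" using l'r by auto
          then have r: "0 < r" "r < m" using pos_mod_sign[OF l(4), of u] pos_mod_bound[OF l(4), of u]
          unfolding r_def by linarith+
          have "a r = a (r + y)"
          proof (rule ccontr)
            assume "a r \<noteq> a (r + y)"
            then have "(r, N - r) \<in> B" using y r ldr unfolding B_def by blast
            from l'u[OF this] show False using l'r by simp
          qed
          moreover have "\<not> l dvd r + y" using ldr ly[OF y] by (simp add: dvd_add_left_iff)
          ultimately show ?thesis using per[OF r0 ldr] per[of "u + y" "r + y"] r0 by simp
        qed
    have "a (i + Gcd (insert m (fst ` Q))) = a i" if "\<not> l' dvd i" for i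
    proof (rule periodic_Gcd[where l = l' and m = m])
      show "a (u + x) = a u" if "x \<in> insert m (fst ` Q)" "\<not> l' dvd u" for x u
        using that(1)
      proof (elim insertE imageE)
        fix z assume "x = fst z" "z \<in> Q"
        then show ?thesis using yper[OF _ that(2), of x "snd z"] by simp
      qed (use l(6)[OF nl[OF that(2)]] in simp)
      show "l' dvd x" if "x \<in> insert m (fst ` Q)" for x
        using that
      proof (elim insertE imageE)
        fix z assume "x = fst z" "z \<in> Q"
        then show ?thesis using dvd_trans[OF l'l ly, of x "snd z"] by simp
      qed (use dvd_trans[OF l'l lm] in simp)
    qed (use l(4) that in simp_all)
    then have "\<And>i. \<not> l' dvd i \<Longrightarrow> a (i + l) = a i" unfolding l(5)[symmetric] .
    from dvd_periodic[of l' a l, OF this l'l] that show ?thesis by simp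
  qed
  show ?case
  proof (cases "B = {}")
    case True
    then have l': "l' = l" using l(1) by (simp add: l'_def)
    show ?thesis
      by (intro exI[of _ l] conjI allI impI dvd_refl l(1,2) off[of l, unfolded l'])
  next
    case False
    obtain u0 M0 where u0: "(u0, M0) \<in> B" using False by fast
    \<comment> \<open>A failure is divisible by \<open>l'\<close> but not by \<open>l\<close>, so
      the subgroup grows strictly and the recursion ends.\<close>
    have "l' \<noteq> l" using l'u[OF u0] u0 unfolding B_def by blast
    then have lt: "nat l' < nat l" using l'l l'0 l(1) zdvd_imp_le[OF l'l] by simp
    have Q': "0 < u \<and> l < M \<and> l dvd M + u \<and> shift_inv a l' u M" if uM: "(u, M) \<in> B" for u M
    proof -
      obtain y N where y: "M = N - u" "(y, N) \<in> Q" "0 < u" "u < m" "\<not> l dvd u" "a u \<noteq> a (u + y)"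
        using uM unfolding B_def by blast
      have yN: "0 < y" "m < N" "m dvd N + y" "shift_inv a l y N" using l(7)[OF y(2)] by auto
      note lly = ly[OF y(2)]
      have lN: "l dvd N" using lm lly yN(3) by (metis dvd_trans dvd_add_left_iff)
      have mlN: "m + l \<le> N"
      proof -
        have "l dvd N - m" using lN lm by (rule dvd_diff)
        then show ?thesis using yN(2) by (auto dest: zdvd_imp_le)
      qed
      have nk: "\<not> k dvd i" if "\<not> l dvd i" for i using that l(3) dvd_trans by blast
      have yH: "y \<in> H" "- y \<in> H" using H_mult[OF l(2) lly] H_minus by auto
      have uP: "u \<notin> P" "u + y \<notin> P"
        using y(6) H_plus(2)[OF yH(1), of u] H_plus[OF yH(2), of "u + y"] by auto
      have luy: "\<not> l dvd u + y" using y(5) lly by (simp add: dvd_add_left_iff)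
      have sy: "a (- u) = a u" "a (- (u + y)) = a (u + y)"
        using P_sym[OF nk[OF y(5)] uP(1)] P_sym[OF nk[OF luy] uP(2)] by auto
      have e1: "a (N - u) = a (- (u + y))" 
      proof (rule per)
        show "\<not> l dvd - (u + y)" using luy by (simp only: dvd_minus_iff not_False_eq_True)
      qed (use yN(3) in simp)
      have e2: "a (y + (N - u)) = a (- u)" by (rule per) (use yN(3) y(5) in \<open>auto simp: add.commute\<close>)
      have "shift_inv a l' u (N - u)"
        by (rule shift_inv_step[OF yN(4) l'l lN l'u[OF uM] y(5,3)])
          (use off[OF lly] y(6) e1 e2 sy in \<open>auto simp: add.commute\<close>)
      moreover have "l < M" using mlN y(1,4) by simp
      ultimately show ?thesis using y(1,3) lN by simp
    qed
    \<comment> \<open>In the next round \<open>l\<close> takes over the role of the period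
      \<open>m\<close>, and \<open>B\<close> that of \<open>Q\<close>.\<close>
    have "\<exists>d. 0 < d \<and> d dvd l' \<and> d \<in> H \<and> (\<forall>i. \<not> d dvd i \<longrightarrow> a (i + d) = a i)"
    proof (rule less.hyps[OF lt l'0 l'H dvd_trans[OF l'l l(3)] l(1) l'_def])
      show "a (i + l) = a i" if "\<not> l' dvd i" for i using off[OF _ that, of l] by simp
    qed (use Q' in blast)
    then show ?thesis using l'l dvd_trans by blast
  qed
qed

end

section \<open>Periodic sequences with equal arrangement counts\<close>

text \<open>Models two compositions of \<open>n\<close> with equally many coarsenings of every type.
  Positions divisible by \<open>n\<close> are never tested by \<open>counts\<close>.\<close>

locale twins =
  fixes n :: int and a b :: "int \<Rightarrow> bool"
  assumes n_pos: "0 < n"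
    and a_n: "\<And>i. a (i + n) = a i" and b_n: "\<And>i. b (i + n) = b i"
    and counts: "\<And>X. (\<forall>x\<in>#X. 0 < x) \<Longrightarrow> sum_mset X = n \<Longrightarrow> acount a 0 X = acount b 0 X"
begin

definition D :: "int set" where "D = {i. a i \<noteq> a (- i)}"

text \<open>At each position of \<open>D\<close>, the values of \<open>a\<close> and of its reversal
  are opposite, and \<open>b\<close> takes one of them; here it takes that of the reversal.\<close>

definition Dm :: "int set" where "Dm = {i \<in> D. b i \<noteq> a i}"

lemma a_cong: "n dvd j - i \<Longrightarrow> a j = a i"
  by (rule full_periodic[of a n]) (use a_n in auto)

lemma b_cong: "n dvd j - i \<Longrightarrow> b j = b i"
  by (rule full_periodic[of b n]) (use b_n in auto)

lemma D_cong: "n dvd j - i \<Longrightarrow> i \<in> D \<Longrightarrow> j \<in> D"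
  using a_cong[of j i] a_cong[of "- j" "- i"] unfolding D_def
  by (simp add: dvd_diff_commute)

lemma Dm_cong: "n dvd j - i \<Longrightarrow> i \<in> Dm \<Longrightarrow> j \<in> Dm"
  using D_cong a_cong b_cong unfolding Dm_def by auto

lemma D_not_dvd: assumes "i \<in> D" shows "\<not> n dvd i"
proof
  assume d: "n dvd i"
  then have "n dvd i - (- i)" by simp
  from a_cong[OF this] show False using assms by (simp add: D_def)
qed

lemma mod_n: "n dvd i mod n - i" "n dvd i - i mod n" "\<not> n dvd i \<Longrightarrow> 0 < i mod n" "i mod n < n"
proof -
  show 1: "n dvd i - i mod n" by (rule dvd_minus_mod)
  then show "n dvd i mod n - i" by (simp add: dvd_diff_commute)
  show "0 < i mod n" if "\<not> n dvd i"
    using that pos_mod_sign[OF n_pos, of i]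
      by (simp add: order_less_le mod_eq_0_iff_dvd eq_commute[of 0])
  show "i mod n < n" using n_pos by simp
qed

lemma pair_count:
  assumes "\<not> n dvd i"
  shows "of_bool (a i) + of_bool (a (- i)) = (of_bool (b i) + of_bool (b (- i)) :: nat)"
proof -
  define r where "r = i mod n"
  have r: "0 < r" "r < n" using mod_n[of i] assms by (auto simp: r_def)
  have d: "n dvd r - i" "n dvd (n - r) - (- i)"
    using mod_n(1,2)[of i] by (auto simp: r_def algebra_simps)
  have "acount a 0 {#r, n - r#} = acount b 0 {#r, n - r#}"
    by (rule counts) (use r in auto)
  from acount_pair_eqD[OF this] show ?thesis
    using a_cong[OF d(1)] a_cong[OF d(2)] b_cong[OF d(1)] b_cong[OF d(2)] by simp
qed

lemma D_uminus: assumes "i \<in> D" shows "- i \<in> D" "a (- i) = (\<not> a i)" "b (- i) = (\<not> b i)"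
  using assms pair_count[OF D_not_dvd[OF assms]] unfolding D_def
  by (auto split: if_splits simp: of_bool_def)

lemma Dm_uminus: "i \<in> Dm \<Longrightarrow> - i \<in> Dm"
  using D_uminus by (auto simp: Dm_def)

lemma not_D: assumes "\<not> n dvd i" "i \<notin> D" shows "a (- i) = a i" "b i = a i"
  using assms pair_count[OF assms(1)] unfolding D_def by (auto split: if_splits simp: of_bool_def)

text \<open>Equality of counts for the parts \<open>p\<close>, \<open>u\<close>,
  \<open>n - p - u\<close>. The sequences agree at \<open>p\<close>, are opposite at
  \<open>u\<close>, and both are antisymmetric on \<open>D\<close>. So only the values at
  \<open>p + u\<close> and its negative are unknown, and \<open>pair_count\<close> ties these
  together.\<close>

lemma rule_aux:
  assumes p: "p \<in> D" "b p = a p" and u: "u \<in> Dm" and r: "0 < p" "0 < u" "p + u < n"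
  shows "p + u \<in> D \<and> (b (p + u) = a (p + u) \<longrightarrow> a (p + u) = a p)
     \<and> (b (p + u) \<noteq> a (p + u) \<longrightarrow> a (p + u) = a u)"
proof -
  define w where "w = p + u"
  have "acount a 0 {#p, u, n - w#} = acount b 0 {#p, u, n - w#}"
    by (rule counts) (use r in \<open>auto simp: w_def\<close>)
  from acount_triple_eqD[OF this]
  have T: "triple_count a 0 p u (n - w) = triple_count b 0 p u (n - w)" .
  have c: "c (n - w) = c (- w)" "c (p + (n - w)) = c (- u)" "c (u + (n - w)) = c (- p)" "c (p + u) = c w"
    if "\<And>i. c (i + n) = c i" for c :: "int \<Rightarrow> bool"
    using that[of "- w"] that[of "- u"] that[of "- p"] by (simp_all add: w_def algebra_simps)
  have uD: "u \<in> D" "b u = (\<not> a u)" using u by (auto simp: Dm_def)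
  have "of_bool (a w) + of_bool (a (- w)) = (of_bool (b w) + of_bool (b (- w)) :: nat)"
    by (rule pair_count) (use r zdvd_not_zless in \<open>auto simp: w_def\<close>)
  moreover have "of_bool (a p \<and> a w) + of_bool (a u \<and> a w) + of_bool (a p \<and> \<not> a u) +
      of_bool (a (- w) \<and> \<not> a u) + of_bool (a u \<and> \<not> a p) + of_bool (a (- w) \<and> \<not> a p)
    = (of_bool (a p \<and> b w) + of_bool (\<not> a u \<and> b w) + of_bool (a p \<and> a u) +
      of_bool (b (- w) \<and> a u) + of_bool (\<not> a u \<and> \<not> a p) + of_bool (b (- w) \<and> \<not> a p) :: nat)"
    using T unfolding triple_count_def add_0 c[of a, OF a_n] c[of b, OF b_n] p(2) uD(2)
      D_uminus(2)[OF p(1)] D_uminus(3)[OF p(1)] D_uminus(2)[OF uD(1)] D_uminus(3)[OF uD(1)]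
    by simp
  ultimately have "a w \<noteq> a (- w) \<and> (b w = a w \<longrightarrow> a w = a p) \<and> (b w \<noteq> a w \<longrightarrow> a w = a u)"
    by (cases "a w"; cases "a (- w)"; cases "b w"; cases "b (- w)"; cases "a p"; cases "a u") simp_all
  then show ?thesis by (simp add: D_def w_def)
qed

text \<open>Residues modulo \<open>n\<close> whose sum is below \<open>n\<close> fall under
  \<open>rule_aux\<close>. A sum above \<open>n\<close> is brought below it by negating both, and
  the sum \<open>n\<close> is impossible since it would put \<open>- p\<close> into
  \<open>Dm\<close>.\<close>

lemma pair_rule:
  assumes p: "p \<in> D" "b p = a p" and u: "u \<in> Dm"
  shows "p + u \<in> D" "b (p + u) = a (p + u) \<Longrightarrow> a (p + u) = a p"
    "b (p + u) \<noteq> a (p + u) \<Longrightarrow> a (p + u) = a u"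
proof -
  define r where "r = p mod n"
  define s where "s = u mod n"
  have uD: "u \<in> D" using u by (simp add: Dm_def)
  have r: "0 < r" "r < n" "n dvd r - p" "n dvd p - r"
    using mod_n[of p] D_not_dvd[OF p(1)] by (auto simp: r_def)
  have s: "0 < s" "s < n" "n dvd s - u" "n dvd u - s"
    using mod_n[of u] D_not_dvd[OF uD] by (auto simp: s_def)
  have nuD: "- p \<notin> Dm" using p D_uminus[OF p(1)] by (simp add: Dm_def)
  have main: "p + u \<in> D \<and> (b (p + u) = a (p + u) \<longrightarrow> a (p + u) = a p)
     \<and> (b (p + u) \<noteq> a (p + u) \<longrightarrow> a (p + u) = a u)"
  proof (cases "r + s" n rule: linorder_cases)
    case less
    have rD: "r \<in> D" "b r = a r" "s \<in> Dm"
      using p D_cong[OF r(3)] a_cong[OF r(3)] b_cong[OF r(3)] Dm_cong[OF s(3) u] by auto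
    have d: "n dvd (p + u) - (r + s)" using dvd_add[OF r(4) s(4)] by (simp add: algebra_simps)
    from rule_aux[OF rD r(1) s(1) less] show ?thesis
      using D_cong[OF d] a_cong[OF d] b_cong[OF d] a_cong[OF r(3)] a_cong[OF s(3)] by simp
  next
    case equal
    have "n dvd (- p) - u"
    proof -
      have e: "(- p) - u = (r - p) + (s - u) - n" using equal by simp
      show ?thesis unfolding e by (rule dvd_diff[OF dvd_add[OF r(3) s(3)] dvd_refl])
    qed
    from Dm_cong[OF this u] nuD show ?thesis by simp
  next
    case greater
    have d1: "n dvd (n - r) - (- p)" "n dvd (n - s) - (- u)"
      using r(4) s(4) by (auto simp: algebra_simps dvd_diff_commute)
    have rD: "n - r \<in> D" "b (n - r) = a (n - r)" "n - s \<in> Dm"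
      using p D_uminus[OF p(1)] D_cong[OF d1(1)] a_cong[OF d1(1)] b_cong[OF d1(1)]
        Dm_cong[OF d1(2) Dm_uminus[OF u]] by auto
    have d: "n dvd - (p + u) - ((n - r) + (n - s))"
    proof -
      have "- (p + u) - ((n - r) + (n - s)) = (r - p) + (s - u) - n * 2" by simp
      then show ?thesis using r(3) s(3) by (metis dvd_add dvd_diff dvd_triv_left)
    qed
    define w where "w = - (p + u)"
    have wm: "p + u = - w" by (simp add: w_def)
    have "w \<in> D \<and> (b w = a w \<longrightarrow> a w = a (- p)) \<and> (b w \<noteq> a w \<longrightarrow> a w = a (- u))"
      using rule_aux[OF rD] r s greater
        D_cong[OF d] a_cong[OF d] b_cong[OF d] a_cong[OF d1(1)] a_cong[OF d1(2)]
      unfolding w_def by simp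
    then show ?thesis unfolding wm
      using D_uminus[of w] D_uminus(2)[OF p(1)] D_uminus(2)[OF uD] by auto
  qed
  show "p + u \<in> D" "b (p + u) = a (p + u) \<Longrightarrow> a (p + u) = a p"
    "b (p + u) \<noteq> a (p + u) \<Longrightarrow> a (p + u) = a u" using main by auto
qed

end

text \<open>The least positive mismatch \<open>q\<close> comes after some position \<open>x\<close>
  of \<open>D\<close>, at which \<open>b\<close> then agrees with \<open>a\<close>. If
  \<open>D\<close> contains agreements and mismatches, this order can be reached by reversing
  \<open>b\<close>.\<close>

locale ordered_twins = twins +
  fixes q x :: int
  assumes q: "q \<in> Dm" "0 < q" and q_min: "\<And>i. i \<in> Dm \<Longrightarrow> 0 < i \<Longrightarrow> q \<le> i"
    and x: "x \<in> D" "0 < x" "x < q"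
begin

lemma below_q: "i \<in> D \<Longrightarrow> 0 < i \<Longrightarrow> i < q \<Longrightarrow> b i = a i"
  using q_min[of i] by (auto simp: Dm_def)

text \<open>Otherwise all multiples of \<open>q\<close> would lie in \<open>Dm\<close> and have the same value of \<open>a\<close> as \<open>q\<close>; but \<open>0\<close> is a
  multiple of \<open>q\<close> modulo \<open>n\<close>.\<close>

lemma orbit_nat:
  assumes y: "y \<in> D" "0 < y" "y < q"
  shows "y + int t * q \<in> D \<and> b (y + int t * q) = a (y + int t * q) \<and> a (y + int t * q) = a y"
proof (rule ccontr)
  define good where "good t \<longleftrightarrow> y + int t * q \<in> D \<and> b (y + int t * q) = a (y + int t * q) \<and>
    a (y + int t * q) = a y" for t
  assume "\<not> ?thesis"
  then have ex: "\<exists>t. \<not> good t" by (auto simp: good_def)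
  define j where "j = (LEAST t. \<not> good t)"
  have j: "\<not> good j" using LeastI_ex[OF ex] by (simp add: j_def)
  have less_j: "good i" if "i < j" for i using not_less_Least[of i "\<lambda>t. \<not> good t"] that
    by (auto simp: j_def)
  have "good 0" using y below_q by (simp add: good_def)
  then have j0: "0 < j" using j by (cases j) auto
  have qD: "q \<in> D" "b q = (\<not> a q)" "- q \<in> Dm" "a (- q) = (\<not> a q)"
    using q Dm_uminus D_uminus(2) by (auto simp: Dm_def)
  \<comment> \<open>The first element of the orbit that fails: it lies in \<open>Dm\<close> and has
    the value of \<open>a\<close> at \<open>q\<close>.\<close>
  define r where "r = y + int j * q"
  have prev: "y + int (j - 1) * q \<in> D" "b (y + int (j - 1) * q)
    = a (y + int (j - 1) * q)" "a (y + int (j - 1) * q) = a y"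
    using less_j[of "j - 1"] j0 by (auto simp: good_def)
  have rr: "y + int (j - 1) * q + q = r" using j0 by (simp add: r_def algebra_simps of_nat_diff)
  have r: "r \<in> Dm" "a r = a q"
  proof -
    note R = pair_rule[OF prev(1,2) q(1), unfolded rr]
    have "b r \<noteq> a r" using R j prev(3) unfolding good_def r_def by auto
    then show "r \<in> Dm" "a r = a q" using R by (auto simp: Dm_def)
  qed
  \<comment> \<open>The mirror image of \<open>y\<close> between \<open>0\<close> and
    \<open>q\<close>; adding \<open>r\<close> to its translates by multiples of \<open>q\<close>
    yields the multiples of \<open>q\<close> beyond \<open>j * q\<close>.\<close>
  define y' where "y' = q - y"
  have y': "y' \<in> D" "b y' = a y'"
  proof -
    have "- y + q \<in> D" using pair_rule(1)[OF _ _ q(1), of "- y"] D_uminus[OF y(1)] below_q[OF y] by auto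
    then show "y' \<in> D" by (simp add: y'_def)
    then show "b y' = a y'" using below_q y by (simp add: y'_def)
  qed
  have mult: "int t * q \<in> Dm \<and> a (int t * q) = a q" if "0 < t" for t
    using that
  proof (induction t rule: less_induct)
    case (less t)
    show ?case
    proof (cases "t = 1")
      case True
      then show ?thesis using q by simp
    next
      case False
      define s where "s = t - 1"
      have s: "0 < s" "t = Suc s" using False less.prems by (auto simp: s_def)
      have IH: "int i * q \<in> Dm" "a (int i * q) = a q" if "0 < i" "i \<le> s" for i
        using less.IH[of i] that s by auto
      \<comment> \<open>\<open>pair_rule\<close> is applied to a sum of an agreeing position and an
        element of \<open>Dm\<close> with the value of \<open>q\<close>. The latter is
        \<open>r\<close> if \<open>t \<le> j\<close>; for larger \<open>t\<close> it is
        \<open>r\<close> or \<open>d\<close>, depending on whether \<open>b\<close> agrees with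
        \<open>a\<close> at \<open>y' + int c * q\<close>.\<close>
      have tD: "int t * q \<in> D \<and> (b (int t * q) \<noteq> a (int t * q) \<longrightarrow> a (int t * q) = a q)"
      proof (cases "t \<le> j")
        case True
        define i where "i = y + int (j - t) * q"
        have i: "i \<in> D" "b i = a i"
          using less_j[of "j - t"] True less.prems j0 by (auto simp: good_def i_def)
        have e: "- i + r = int t * q" using True by (simp add: i_def r_def algebra_simps of_nat_diff)
        have ni: "- i \<in> D" "b (- i) = a (- i)" using D_uminus[OF i(1)] i(2) by auto
        show ?thesis using pair_rule[OF ni r(1), unfolded e] r(2) by auto
      next
        case False
        define c where "c = s - j"
        have c: "s = c + j" using False s by (simp add: c_def)
        have cD: "y' + int c * q \<in> D"
        proof (cases "c = 0")
          case True then show ?thesis using y' by simp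
        next
          case False
          then show ?thesis using pair_rule(1)[OF y' IH(1)[of c]] c by auto
        qed
        show ?thesis
        proof (cases "b (y' + int c * q) = a (y' + int c * q)")
          case True
          have e: "y' + int c * q + r = int t * q"
            using s c by (simp add: y'_def r_def algebra_simps)
          show ?thesis using pair_rule[OF cD True r(1), unfolded e] r(2) by auto
        next
          case F: False
          then have c0: "0 < c" using y' by (cases c) auto
          have ac: "a (y' + int c * q) = a q"
            using pair_rule(3)[OF y' IH(1)[of c]] IH(2)[of c] F c c0 by auto
          define d where "d = y' + int (Suc c) * q"
          have IHc: "int (Suc c) * q \<in> Dm" "a (int (Suc c) * q) = a q"
            using IH[of "Suc c"] c j0 by auto
          have dD: "d \<in> D" using pair_rule(1)[OF y' IHc(1)] by (simp add: d_def)
          have de: "d + - q = y' + int c * q" by (simp add: d_def algebra_simps)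
          have "b d \<noteq> a d"
          proof
            assume "b d = a d"
            from pair_rule(3)[OF dD this qD(3), unfolded de] F ac qD(4) show False by simp
          qed
          then have d: "d \<in> Dm" "a d = a q"
            using dD pair_rule(3)[OF y' IHc(1)] IHc(2) by (auto simp: Dm_def d_def)
          have e: "y + int (j - 1) * q + d = int t * q"
            using s c j0 by (simp add: y'_def d_def algebra_simps of_nat_diff)
          show ?thesis using pair_rule[OF prev(1,2) d(1), unfolded e] d(2) by auto
        qed
      qed
      \<comment> \<open>After an agreement at \<open>int t * q\<close>, the step by
        \<open>- q\<close> would give \<open>int s * q\<close> the value of \<open>a\<close> at
        \<open>- q\<close>, which is opposite to that at \<open>q\<close>.\<close>
      have "b (int t * q) \<noteq> a (int t * q)"
      proof
        assume *: "b (int t * q) = a (int t * q)"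
        have e: "int t * q + - q = int s * q" using s by (simp add: algebra_simps)
        have "b (int s * q) \<noteq> a (int s * q)" using IH(1)[of s] s by (auto simp: Dm_def)
        then have "a (int s * q) = a (- q)"
          using pair_rule(3)[OF _ * qD(3), unfolded e] tD by blast
        then show False using IH(2)[of s] s qD(4) by auto
      qed
      then show ?thesis using tD by (simp add: Dm_def)
    qed
  qed
  have "int (nat n) * q \<in> Dm" using mult[of "nat n"] n_pos by simp
  then show False using D_not_dvd[of "n * q"] n_pos by (simp add: Dm_def)
qed

text \<open>Asking for the whole orbit under \<open>q\<close> makes this set stable under
  translation by all of \<open>Dm\<close>.\<close>

definition T :: "int set" where
  "T = {y. \<forall>t::int. y + t * q \<in> D \<and> b (y + t * q) = a (y + t * q) \<and> a (y + t * q) = a y}"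

lemma T_below: assumes "y \<in> D" "0 < y" "y < q" shows "y \<in> T"
proof -
  have "y + t * q \<in> D \<and> b (y + t * q) = a (y + t * q) \<and> a (y + t * q) = a y" for t
  proof -
    define s where "s = nat (t mod n)"
    have s: "int s = t mod n" using n_pos by (simp add: s_def)
    have "(y + t * q) - (y + int s * q) = (t - t mod n) * q" by (simp add: s algebra_simps)
    then have d: "n dvd (y + t * q) - (y + int s * q)" using mod_n(2)[of t] by simp
    show ?thesis using orbit_nat[OF assms, of s] D_cong[OF d] a_cong[OF d] b_cong[OF d] by simp
  qed
  then show ?thesis by (simp add: T_def)
qed

lemma T_D: "y \<in> T \<Longrightarrow> y \<in> D \<and> b y = a y"
  unfolding T_def using mult_zero_left add_0_right by (metis (mono_tags, lifting) mem_Collect_eq)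

text \<open>By \<open>pair_rule\<close> the orbit of \<open>y + u\<close> stays in \<open>D\<close>.
  So its representative between \<open>0\<close> and \<open>q\<close> lies in \<open>D\<close>, and
  hence in \<open>T\<close> by \<open>T_below\<close>.\<close>

lemma T_Dm: assumes y: "y \<in> T" and u: "u \<in> Dm" shows "y + u \<in> T"
proof -
  have D: "y + u + t * q \<in> D" for t
  proof -
    have "y + t * q \<in> D" "b (y + t * q) = a (y + t * q)" using y by (auto simp: T_def)
    then have "y + t * q + u \<in> D" using pair_rule(1) u by blast
    moreover have "y + t * q + u = y + u + t * q" by simp
    ultimately show ?thesis by simp
  qed
  define z where "z = (y + u) mod q"
  define s where "s = (y + u) div q"
  have z: "y + u = z + s * q" by (simp add: z_def s_def)
  have "z \<in> D" using D[of "- s"] z by (simp add: algebra_simps)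
  moreover have "z \<noteq> 0" using D_not_dvd[OF \<open>z \<in> D\<close>] by auto
  ultimately have zT: "z \<in> T" using T_below q(2) pos_mod_sign[OF q(2), of "y + u"] pos_mod_bound[OF q(2), of "y + u"]
    by (simp add: z_def order_less_le)
  have "a (y + u) = a z" using zT unfolding z T_def by blast
  moreover have "y + u + t * q = z + (s + t) * q" for t using z by (simp add: algebra_simps)
  ultimately show ?thesis using zT unfolding T_def by simp
qed

section \<open>The subgroup generated by the mismatches\<close>

definition k :: int where "k = Gcd (insert n Dm)"

lemma k_dvd: "k dvd n" "u \<in> Dm \<Longrightarrow> k dvd u"
  unfolding k_def by (rule Gcd_dvd; simp)+

lemma k_pos: "0 < k"
proof -
  have "k \<noteq> 0" using k_dvd(1) n_pos by auto
  then show ?thesis using Gcd_int_greater_eq_0 unfolding k_def by (metis order_less_le)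
qed

text \<open>\<open>T\<close> contains \<open>x\<close> and is stable under translation by
  \<open>n\<close> and \<open>Dm\<close>, hence by all multiples of \<open>k\<close>; but
  \<open>0\<close> is not in \<open>T\<close>.\<close>

lemma k_not_dvd_x: "\<not> k dvd x"
proof
  assume kx: "k dvd x"
  define S where "S = {g. \<forall>y\<in>T. y + g \<in> T \<and> y - g \<in> T}"
  have S0: "0 \<in> S" by (simp add: S_def)
  have Sd: "g - h \<in> S" if "g \<in> S" "h \<in> S" for g h
  proof -
    have "y + (g - h) \<in> T \<and> y - (g - h) \<in> T" if "y \<in> T" for y
    proof -
      have "y + g - h \<in> T" "y + h - g \<in> T" using \<open>g \<in> S\<close> \<open>h \<in> S\<close> that by (auto simp: S_def)
      then show ?thesis by (simp add: algebra_simps)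
    qed
    then show ?thesis by (simp add: S_def)
  qed
  have Tn: "y + g \<in> T" if "y \<in> T" "n dvd g" for y g
  proof -
    have d: "n dvd (y + g + t * q) - (y + t * q)" for t using that(2) by simp
    show ?thesis using that(1) D_cong[OF d] a_cong[OF d] b_cong[OF d] a_cong[OF d[of 0]]
      unfolding T_def by simp
  qed
  have "k \<in> S" unfolding k_def
  proof (rule Gcd_mem_subgroup[OF S0 Sd])
    have "n \<in> S" using Tn[of _ n] Tn[of _ "- n"] by (simp add: S_def)
    moreover have "u \<in> S" if "u \<in> Dm" for u
      using T_Dm[OF _ that] T_Dm[OF _ Dm_uminus[OF that]] by (simp add: S_def)
    ultimately show "insert n Dm \<subseteq> S" by auto
  qed (use n_pos in auto)
  from subgroup_mult[OF S0 Sd this kx] have "x - x \<in> T"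
    using T_below[OF x] by (auto simp: S_def)
  then show False using T_D D_not_dvd by fastforce
qed

definition P :: "int set" where "P = {i. \<not> k dvd i \<and> a i \<noteq> a (- i)}"

lemma P_D: "p \<in> P \<Longrightarrow> p \<in> D \<and> b p = a p"
  using k_dvd(2) by (auto simp: P_def D_def Dm_def)

text \<open>\<open>Dm\<close> consists of multiples of \<open>k\<close>, so translation by it cannot
  move an element of \<open>P\<close> into \<open>Dm\<close>; this leaves the agreeing branch of
  \<open>pair_rule\<close>.\<close>

lemma P_Dm: assumes p: "p \<in> P" and u: "u \<in> Dm" shows "p + u \<in> P \<and> a (p + u) = a p"
proof -
  have nk: "\<not> k dvd p + u" using p k_dvd(2)[OF u] by (simp add: P_def dvd_add_left_iff)
  note R = pair_rule[OF conjunct1[OF P_D[OF p]] conjunct2[OF P_D[OF p]] u]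
  have "b (p + u) = a (p + u)" using R(1) nk k_dvd(2) by (auto simp: Dm_def)
  then show ?thesis using R(1,2) nk by (simp add: P_def D_def)
qed

lemma P_periodic: assumes p: "p \<in> P" shows "p + k \<in> P \<and> a (p + k) = a p"
proof -
  define S where "S = {g. \<forall>p\<in>P. p + g \<in> P \<and> a (p + g) = a p}"
  have Pn: "p + g \<in> P \<and> a (p + g) = a p" if "p \<in> P" "n dvd g" for p g
  proof -
    have "k dvd g" using k_dvd(1) that(2) dvd_trans by blast
    moreover have "n dvd (p + g) - p" "n dvd (- (p + g)) - (- p)" using that(2) by auto
    ultimately show ?thesis using that(1) a_cong[of "p + g" p] a_cong[of "- (p + g)" "- p"]
      by (simp add: P_def dvd_add_left_iff)
  qed
  have "Gcd (insert n Dm) \<in> S"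
  proof (rule Gcd_mem_submonoid)
    show "g + h \<in> S" if "g \<in> S" "h \<in> S" for g h
      using that by (simp add: S_def add.assoc[symmetric])
    show "u \<in> S \<and> - u \<in> S" if "u \<in> insert n Dm" for u
      using that
    proof
      assume "u = n"
      then show ?thesis using Pn[of _ n] Pn[of _ "- n"] by (simp add: S_def)
    next
      assume "u \<in> Dm"
      then show ?thesis using P_Dm[of _ u] P_Dm[of _ "- u"] Dm_uminus by (simp add: S_def)
    qed
  qed (use n_pos in \<open>auto simp: S_def\<close>)
  then show ?thesis using p by (simp add: S_def k_def)
qed

sublocale odd_part a P k
  by unfold_locales (use k_pos P_periodic in \<open>auto simp: P_def\<close>)

lemma agree_off_k: assumes "\<not> k dvd i" shows "b i = a i"
proof (cases "i \<in> D")
  case True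
  then show ?thesis using k_dvd(2)[of i] assms by (auto simp: Dm_def)
next
  case False
  then show ?thesis using not_D(2)[of i] assms k_dvd(1) dvd_trans by blast
qed

text \<open>The only round in which \<open>acount_shift\<close> is applied to \<open>a\<close> and
  \<open>b\<close> themselves: the mismatches become the initial invisible shifts.\<close>

lemma shift_inv_Dm: assumes u: "u \<in> Dm" and that: "0 < u" "u < n" shows "shift_inv a k u (n - u)"
  unfolding shift_inv_def
proof (intro allI impI)
  fix X assume X: "\<forall>x\<in>#X. 0 < x" "sum_mset X = n - u" "sum_free k X"
  have d: "n dvd (n - u) - (- u)" by simp
  have uD: "u \<in> D" "b u = (\<not> a u)" using u by (auto simp: Dm_def)
  show "acount a u X = acount a 0 X"
  proof (rule acount_shift[OF X(2,3) k_dvd(2)[OF u] k_dvd(1)])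
    show "acount a 0 (add_mset u X) = acount b 0 (add_mset u X)"
      by (rule counts) (use X that in auto)
  qed (use agree_off_k uD a_cong[OF d] b_cong[OF d] D_uminus[OF uD(1)] in auto)
qed

text \<open>A failure outside \<open>H\<close> of periodicity under \<open>y \<in> Dm\<close> spreads over its residue class modulo \<open>k\<close>, with
  constant value of \<open>a\<close>, but only within the window \<open>0 < i < n - y\<close>, because arrangements do not see
  positions beyond \<open>n\<close>. This is why small and large \<open>y\<close> lead to different contradictions.\<close>

lemma k_bad_run:
  assumes y: "y \<in> Dm" "0 < y" "y < n" and c: "c \<notin> H"
    and i: "k dvd i - c" "\<not> k dvd i" "0 < i" "i + k < n - y" "a i \<noteq> a (i + y)"
  shows "a (i + k) = a i" "a (i + k) \<noteq> a (i + k + y)"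
proof -
  obtain p where p: "p \<in> P" "0 < p" "p < k"
    and fail: "\<And>i. k dvd i - c \<Longrightarrow> \<not> (p + i \<in> P \<and> a (p + i) = a p)"
    using notin_H[OF k_mem_H k_pos c] by blast
  note ky = k_dvd(2)[OF y(1)]
  have kN: "k dvd n - y" using k_dvd(1) ky by simp
  note rule = triple_rule[OF shift_inv_Dm[OF y] k_mem_H dvd_refl k_dvd(1) ky kN]
  have nN: "n dvd n - y + y" by simp
  have w: "p + i \<notin> P" "a (p + i) = a i" "a (p + i + y) \<noteq> a (p + i)" "\<not> k dvd p + i"
    using rule[OF nN a_n i(3,2,5) p(1,2)] fail[OF i(1)] i(4) p(3) by auto
  have kp: "k - p \<in> P" "0 < k - p"
    using P_cong(1)[OF k_mem_H _ P_uminus(1)[OF p(1)], of "k - p"] p(3) by simp_all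
  have e: "k - p + (p + i) = i + k" by simp
  have "i \<notin> P"
    using H_plus(2)[OF H_mult[OF k_mem_H ky], of i] i(5) by auto
  then have "i + k \<notin> P" using P_cong(1)[OF k_mem_H, of i "i + k"] by auto
  then show "a (i + k) = a i" "a (i + k) \<noteq> a (i + k + y)"
    using rule[OF nN a_n _ w(4) _ kp, unfolded e] w i(3,4) p(2) by auto
qed

text \<open>Neither \<open>i\<close> nor \<open>i + y\<close> is in \<open>P\<close>, so
  \<open>a\<close> is symmetric at both. Hence the reflection \<open>i \<mapsto> n - y - i\<close>
  of the window exchanges the values at \<open>i\<close> and \<open>i + y\<close>, and maps failures
  to failures.\<close>

lemma bad_symmetric:
  assumes y: "y \<in> Dm" and i: "\<not> k dvd i" "a i \<noteq> a (i + y)"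
  shows "a (- i) = a i" "a (n - y - i) = a (i + y)" "a (n - y - i + y) = a i" "i \<notin> P" "i + y \<notin> P"
proof -
  note yH = H_mult[OF k_mem_H k_dvd(2)[OF y]]
  show iP: "i \<notin> P" using H_plus(2)[OF yH, of i] i(2) by auto
  show iyP: "i + y \<notin> P"
  proof
    assume "i + y \<in> P"
    from P_cong(1)[OF yH _ this, of i] iP show False by simp
  qed
  have k2: "\<not> k dvd i + y" using i(1) k_dvd(2)[OF y] by (simp add: dvd_add_left_iff)
  show 1: "a (- i) = a i" using P_sym[OF i(1) iP] .
  have "n dvd (n - y - i) - (- (i + y))" by simp
  from a_cong[OF this] show "a (n - y - i) = a (i + y)" using P_sym[OF k2 iyP] by simp
  have "n dvd (n - y - i + y) - (- i)" by simp
  from a_cong[OF this] show "a (n - y - i + y) = a i" using 1 by simp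
qed

text \<open>This is \<open>k_bad_run\<close> at the reflected position \<open>n - y - i\<close>,
  whose class is that of \<open>- c\<close> and again outside \<open>H\<close>.\<close>

lemma k_bad_run_down:
  assumes y: "y \<in> Dm" "0 < y" "y < n" and c: "c \<notin> H"
    and i: "k dvd i - c" "\<not> k dvd i" "i < n - y" "0 < i - k" "a i \<noteq> a (i + y)"
  shows "a (i - k) = a i" "a (i - k) \<noteq> a (i - k + y)"
proof -
  note ky = k_dvd(2)[OF y(1)]
  have kN: "k dvd n - y" using k_dvd(1) ky by simp
  note S = bad_symmetric[OF y(1) i(2,5)]
  define i' where "i' = n - y - i"
  have c': "- c \<notin> H" using H_minus[of "- c"] c by auto
  have "k dvd i' - (- c)"
  proof -
    have "i' - (- c) = (n - y) - (i - c)" by (simp add: i'_def)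
    then show ?thesis using kN i(1) by (metis dvd_diff)
  qed
  moreover have "\<not> k dvd i'"
  proof
    assume "k dvd i'"
    with kN have "k dvd (n - y) - i'" by (rule dvd_diff)
    then show False using i(2) by (simp add: i'_def)
  qed
  moreover have "0 < i'" "i' + k < n - y" using i(3,4) by (auto simp: i'_def)
  moreover have "a i' \<noteq> a (i' + y)" using S(2,3) i(5) by (auto simp: i'_def)
  ultimately have R: "a (i' + k) = a i'" "a (i' + k) \<noteq> a (i' + k + y)"
    using k_bad_run[OF y c'] by blast+
  define j where "j = i - k"
  have kj: "\<not> k dvd j" using i(2) unfolding j_def by (metis diff_add_cancel dvd_add dvd_refl)
  have jP: "j \<notin> P" using P_cong(1)[OF k_mem_H, of i j] S(4) by (auto simp: j_def)
  then have jyP: "j + y \<notin> P" using P_cong(1)[OF k_mem_H, of j "j + y"] ky by auto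
  have kjy: "\<not> k dvd j + y" using kj ky by (simp add: dvd_add_left_iff)
  have "n dvd (i' + k) - (- (j + y))" "n dvd (i' + k + y) - (- j)" by (simp_all add: i'_def j_def)
  then have "a (i' + k) = a (j + y)" "a (i' + k + y) = a j"
    using a_cong P_sym[OF kj jP] P_sym[OF kjy jyP] by metis+
  then show "a (i - k) = a i" "a (i - k) \<noteq> a (i - k + y)"
    using R S(2) i(5) by (auto simp: i'_def j_def)
qed

lemma k_bad_class:
  assumes y: "y \<in> Dm" "0 < y" "y < n" and c: "c \<notin> H" "\<not> k dvd c" "0 < c" "c < n - y" "a c \<noteq> a (c + y)"
    and i: "k dvd i - c" "0 < i" "i < n - y"
  shows "a i = a c" "a i \<noteq> a (i + y)"
proof -
  have up: "a (c + k * int t) = a c \<and> a (c + k * int t) \<noteq> a (c + k * int t + y)"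
    if "c + k * int t < n - y" for t
    using that
  proof (induction t)
    case (Suc t)
    define j where "j = c + k * int t"
    have e: "c + k * int (Suc t) = j + k" by (simp add: j_def algebra_simps)
    have pos: "0 < j" using c(3) k_pos by (simp add: j_def add_pos_nonneg)
    have jc: "k dvd j - c" "\<not> k dvd j" using c(2) by (simp_all add: j_def dvd_add_left_iff)
    have lt: "j + k < n - y" using Suc.prems e by simp
    have IH: "a j = a c" "a j \<noteq> a (j + y)" using Suc.IH lt k_pos by (auto simp: j_def)
    show ?case unfolding e using k_bad_run[OF y c(1) jc pos lt IH(2)] IH(1) by simp
  qed (use c in simp)
  have down: "a (c - k * int t) = a c \<and> a (c - k * int t) \<noteq> a (c - k * int t + y)"
    if "0 < c - k * int t" for t
    using that
  proof (induction t)
    case (Suc t)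
    define j where "j = c - k * int t"
    have e: "c - k * int (Suc t) = j - k" by (simp add: j_def algebra_simps)
    have "0 \<le> k * int t" using k_pos by simp
    then have lt: "j < n - y" using c(4) by (simp add: j_def)
    have nd: "\<not> k dvd j" using c(2) unfolding j_def by (metis diff_add_cancel dvd_add dvd_triv_left)
    have jc: "k dvd j - c" by (simp add: j_def)
    have pos: "0 < j - k" using Suc.prems e by simp
    have IH: "a j = a c" "a j \<noteq> a (j + y)" using Suc.IH pos k_pos by (auto simp: j_def)
    show ?case unfolding e using k_bad_run_down[OF y c(1) jc nd lt pos IH(2)] IH(1) by simp
  qed (use c in simp)
  obtain s where s: "i - c = k * s" using i(1) by auto
  have "a i = a c \<and> a i \<noteq> a (i + y)"
  proof (cases "0 \<le> s")
    case True
    then have "i = c + k * int (nat s)" using s by simp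
    then show ?thesis using up[of "nat s"] i by auto
  next
    case False
    then have "i = c - k * int (nat (- s))" using s by simp
    then show ?thesis using down[of "nat (- s)"] i by auto
  qed
  then show "a i = a c" "a i \<noteq> a (i + y)" by auto
qed

text \<open>Half of \<open>n\<close> is congruent to its negative, hence a symmetric
  position.\<close>

lemma Dm_half: assumes "y \<in> Dm" shows "2 * y \<noteq> n"
proof
  assume "2 * y = n"
  then have "n dvd y - (- y)" by simp
  from a_cong[OF this] show False using assms by (simp add: Dm_def D_def)
qed

lemma mod_k_pos: "\<not> k dvd i \<Longrightarrow> 0 < i mod k" "i mod k < k"
  using pos_mod_sign[OF k_pos, of i] pos_mod_bound[OF k_pos, of i]
  by (auto simp: order_less_le mod_eq_0_iff_dvd eq_commute[of 0])

text \<open>Since \<open>n - 2 * y\<close> is a positive multiple of \<open>k\<close>, the window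
  contains the residue \<open>r\<close> of \<open>c\<close> modulo \<open>k\<close> and also
  \<open>r + y\<close>. Both get the value of \<open>a\<close> at \<open>c\<close>, although
  \<open>r\<close> is a failure.\<close>

lemma k_bad_in_H_small:
  assumes y: "y \<in> Dm" "0 < y" "2 * y < n" and c: "\<not> k dvd c" "0 < c" "c < n - y" "a c \<noteq> a (c + y)"
  shows "c \<in> H"
proof (rule ccontr)
  assume cH: "c \<notin> H"
  define r where "r = c mod k"
  have r: "0 < r" "r < k" "k dvd r - c"
    using mod_k_pos(1)[OF c(1)] mod_k_pos(2)[of c] dvd_minus_mod[of k c]
      by (auto simp: r_def dvd_diff_commute)
  have "k dvd n - 2 * y" using k_dvd(1) k_dvd(2)[OF y(1)] by simp
  then have "k \<le> n - 2 * y" using y(3) by (intro zdvd_imp_le) auto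
  then have r2: "r + y < n - y" using r by simp
  have "k dvd (r + y) - c" using dvd_add[OF r(3) k_dvd(2)[OF y(1)]] by (simp add: algebra_simps)
  note C = k_bad_class[OF y(1,2) _ cH c]
  have "a r = a c" "a r \<noteq> a (r + y)" using C[OF _ r(3,1)] y(2,3) r2 by auto
  moreover have "a (r + y) = a c" using C(1)[OF _ \<open>k dvd (r + y) - c\<close>] y(2,3) r r2 by auto
  ultimately show False by simp
qed

text \<open>For \<open>y\<close> above half of \<open>n\<close> the complement
  \<open>q' = n - y\<close> is a small element of \<open>Dm\<close>, so along a class outside
  \<open>H\<close> there is \<open>q'\<close>-periodicity between \<open>0\<close> and
  \<open>n\<close>. It connects \<open>c + y\<close> with its residue modulo \<open>q'\<close>,
  which lies in the window of \<open>y\<close> and thus has the value of \<open>a\<close> at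
  \<open>c\<close>.\<close>

lemma k_bad_in_H:
  assumes y: "y \<in> Dm" "0 < y" "y < n" and c: "\<not> k dvd c" "0 < c" "c < n - y" "a c \<noteq> a (c + y)"
  shows "c \<in> H"
proof (cases "2 * y < n")
  case True
  then show ?thesis using k_bad_in_H_small y c by blast
next
  case False
  define q' where "q' = n - y"
  have q': "q' \<in> Dm" "0 < q'" "2 * q' < n"
    using Dm_cong[of "n - y" "- y"] Dm_uminus[OF y(1)] y(3) False Dm_half[OF y(1)] by (auto simp: q'_def)
  note kq' = k_dvd(2)[OF q'(1)]
  show ?thesis
  proof (rule ccontr)
    assume cH: "c \<notin> H"
    note C = k_bad_class[OF y cH c]
    have step: "a (i + q') = a i" if "k dvd i - c" "0 < i" "i + q' < n" for i
    proof (rule ccontr)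
      assume "a (i + q') \<noteq> a i"
      moreover have "\<not> k dvd i"
        using that(1) c(1) by (metis dvd_diff diff_diff_eq2 add_diff_cancel_left')
      ultimately have "i \<in> H" using k_bad_in_H_small[OF q', of i] that by auto
      then have "i - (i - c) \<in> H" using H_diff H_mult[OF k_mem_H that(1)] by blast
      then show False using cH by simp
    qed
    define r where "r = (c + y) mod q'"
    define s where "s = (c + y) div q'"
    have rs: "c + y = r + q' * s" by (simp add: r_def s_def)
    have kcy: "\<not> k dvd c + y" using c(1) k_dvd(2)[OF y(1)] by (simp add: dvd_add_left_iff)
    have kr: "k dvd r - (c + y)" using rs kq' by simp
    have "r \<noteq> 0"
    proof
      assume "r = 0"
      then have "k dvd - (c + y)" using kr by simp
      then show False using kcy by (simp only: dvd_minus_iff)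
    qed
    then have r: "0 < r" "r < q'"
      using pos_mod_sign[OF q'(2), of "c + y"] pos_mod_bound[OF q'(2), of "c + y"] unfolding r_def
        by linarith+
    have krc: "k dvd r - c" using dvd_add[OF kr k_dvd(2)[OF y(1)]] by (simp add: algebra_simps)
    have run: "a (r + q' * int t) = a r" if "r + q' * int t < n" for t
      using that
    proof (induction t)
      case (Suc t)
      define j where "j = r + q' * int t"
      have e: "r + q' * int (Suc t) = j + q'" by (simp add: j_def algebra_simps)
      have "0 < j" using r q'(2) by (simp add: j_def add_pos_nonneg)
      moreover have "k dvd j - c"
      proof -
        have e: "j - c = (r - c) + q' * int t" by (simp add: j_def)
        show ?thesis unfolding e by (intro dvd_add krc dvd_mult2 kq')
      qed
      ultimately have "a (j + q') = a j" using step Suc.prems e by simp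
      moreover have "a j = a r" using Suc e q'(2) by (simp add: j_def)
      ultimately show ?case unfolding e by simp
    qed simp
    have "0 \<le> s" using c(2) y(2) q'(2) by (simp add: s_def pos_imp_zdiv_nonneg_iff)
    then have "a (c + y) = a r" using run[of "nat s"] rs c(3) by simp
    also have "a r = a c" using C(1)[OF krc r(1)] r(2) by (simp add: q'_def)
    finally show False using c(4) by simp
  qed
qed

text \<open>Failures of periodicity under \<open>Dm\<close> lie in \<open>H\<close>. Adjoining them
  to \<open>k\<close> gives a subgroup off which \<open>a\<close> is \<open>k\<close>-periodic, and
  they are the invisible shifts with which \<open>descent\<close> starts. Its result stays in
  \<open>H\<close> and so misses \<open>x\<close>, an element of \<open>P\<close>.\<close>

theorem common_period:
  "\<exists>d. 0 < d \<and> d dvd n \<and> (\<forall>i\<in>Dm. d dvd i) \<and> \<not> d dvd x \<and>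
     (\<forall>i. \<not> d dvd i \<longrightarrow> a (i + d) = a i \<and> b i = a i)"
proof -
  \<comment> \<open>The two bounds make the remaining total \<open>n - y - u\<close> at least
    \<open>k\<close>, and larger since \<open>k\<close> does not divide \<open>u\<close>, as
    \<open>descent\<close> demands. Failures excluded by the bounds are handled below by reflection
    and by steps of length \<open>k\<close>.\<close>
  define B where "B = {(u, n - y - u) | u y. y \<in> Dm \<and> 0 < y \<and> y < n \<and> 2 * k \<le> n - y \<and>
      0 < u \<and> 2 * u \<le> n - y \<and> \<not> k dvd u \<and> a u \<noteq> a (u + y)}"
  define l where "l = Gcd (insert k (fst ` B))"
  have lk: "l dvd k" unfolding l_def by (rule Gcd_dvd) simp
  have lu: "l dvd u" if "(u, M) \<in> B" for u M unfolding l_def by (rule Gcd_dvd) (use that in force)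
  have lpos: "0 < l"
  proof -
    have "l \<noteq> 0" using lk k_pos by auto
    then show ?thesis unfolding l_def using Gcd_int_greater_eq_0 by (metis order_less_le)
  qed
  have BH: "u \<in> H" if "(u, M) \<in> B" for u M
  proof -
    obtain y where y: "y \<in> Dm" "0 < y" "y < n" "0 < u" "2 * u \<le> n - y" "\<not> k dvd u" "a u \<noteq> a (u + y)"
      using \<open>(u, M) \<in> B\<close> unfolding B_def by blast
    then show ?thesis using k_bad_in_H[OF y(1-3,6,4) _ y(7)] by simp
  qed
  have lH: "l \<in> H" unfolding l_def
    by (rule Gcd_mem_subgroup[where m = k]) (use H_zero H_diff k_mem_H k_pos BH in auto)
  have nlk: "\<not> k dvd i" if "\<not> l dvd i" for i using that lk dvd_trans by blast
  have lDm: "l dvd y" if "y \<in> Dm" for y using lk k_dvd(2)[OF that] dvd_trans by blast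
  have ln: "l dvd n" using lk k_dvd(1) dvd_trans by blast
  have wide: "a i = a (i + y)"
    if y: "y \<in> Dm" "0 < y" "y < n" "2 * k \<le> n - y" and i: "0 < i" "i < n - y" "\<not> l dvd i" for i y
  proof (rule ccontr)
    assume ne: "a i \<noteq> a (i + y)"
    note S = bad_symmetric[OF y(1) nlk[OF i(3)] ne]
    show False
    proof (cases "2 * i \<le> n - y")
      case True
      then have "(i, n - y - i) \<in> B" using y i ne nlk unfolding B_def by blast
      then show False using lu i(3) by blast
    next
      case False
      \<comment> \<open>A failure in the upper half of the window is reflected into the lower
        half.\<close>
      have "\<not> l dvd n - y - i"
      proof
        assume "l dvd n - y - i"
        with dvd_diff[OF ln lDm[OF y(1)]] have "l dvd (n - y) - (n - y - i)" by (rule dvd_diff)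
        then show False using i(3) by simp
      qed
      then have "(n - y - i, n - y - (n - y - i)) \<in> B"
        using y i ne nlk S(2,3) False unfolding B_def by fastforce
      then show False using lu \<open>\<not> l dvd n - y - i\<close> by blast
    qed
  qed
  have nonwrap: "a i = a (i + y)"
    if y: "y \<in> Dm" "0 < y" "y < n" and i: "0 < i" "i < n - y" "\<not> l dvd i" for i y
  proof (cases "2 * k \<le> n - y")
    case True
    then show ?thesis using wide that by blast
  next
    case False
    have "k dvd n - y" using k_dvd(1) k_dvd(2)[OF y(1)] by simp
    then obtain s where s: "n - y = k * s" by auto
    then have "0 < s" using y(3) k_pos by (metis diff_gt_0_iff_gt zero_less_mult_pos)
    moreover have "s < 2" using False s k_pos by (simp add: not_le)
    ultimately have e: "n - y = k" using s by simp
    \<comment> \<open>In the remaining case \<open>n - y = k\<close>, so \<open>k\<close> itself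
      lies in \<open>Dm\<close>. Its window is wide because \<open>n\<close> is at least
      \<open>3 * k\<close>, and the shift by \<open>y\<close> is composed of shifts by
      \<open>k\<close>.\<close>
    have kDm: "k \<in> Dm" using Dm_cong[of "n - y" "- y"] Dm_uminus[OF y(1)] by (simp add: e[symmetric])
    obtain s' where s': "n = k * s'" using k_dvd(1) by auto
    have "k < n" using e y(2) by simp
    then have "k * 1 < k * s'" using s' by simp
    then have "1 < s'" using k_pos by (simp only: mult_less_cancel_left_pos)
    moreover have "s' \<noteq> 2" using Dm_half[OF kDm] s' by auto
    ultimately have "3 \<le> s'" by simp
    then have k3: "2 * k \<le> n - k" using s' k_pos mult_left_mono[of 3 s' k] by simp
    have run: "a (i + k * int t) = a i" if "i + k * int t < n" for t
      using that
    proof (induction t)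
      case (Suc t)
      define j where "j = i + k * int t"
      have e: "i + k * int (Suc t) = j + k" by (simp add: j_def algebra_simps)
      have "0 < j" using i(1) k_pos by (simp add: j_def add_pos_nonneg)
      moreover have "\<not> l dvd j" using i(3) lk by (simp add: j_def dvd_add_left_iff)
      ultimately have "a j = a (j + k)" using wide[OF kDm k_pos \<open>k < n\<close> k3] Suc.prems e by simp
      moreover have "a j = a i" using Suc e k_pos by (simp add: j_def)
      ultimately show ?case unfolding e by simp
    qed simp
    have "y = k * (s' - 1)" using e s' by (simp add: algebra_simps)
    moreover have "0 \<le> s' - 1" using \<open>1 < s'\<close> by simp
    ultimately have "y = k * int (nat (s' - 1))" by simp
    then show ?thesis using run[of "nat (s' - 1)"] i(2) by simp
  qed
  have Dm_per: "a (i + y) = a i" if y: "y \<in> Dm" and i: "\<not> l dvd i" for i y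
  proof -
    define s where "s = y mod n"
    define r where "r = i mod n"
    have s: "s \<in> Dm" "0 < s" "s < n" "n dvd y - s"
      using mod_n[of y] Dm_cong[OF mod_n(1) y] D_not_dvd[of y] y by (auto simp: s_def Dm_def)
    have ni: "\<not> n dvd i" using i ln dvd_trans by blast
    have r: "0 < r" "r < n" "n dvd i - r" using mod_n[of i] ni by (auto simp: r_def)
    have lr: "\<not> l dvd r"
    proof
      assume "l dvd r"
      then have "l dvd r + (i - r)" using r(3) ln dvd_trans by (intro dvd_add) blast+
      then show False using i by simp
    qed
    have d: "n dvd (i + y) - (r + s)" using dvd_add[OF r(3) s(4)] by (simp add: algebra_simps)
    have "a (r + s) = a r"
    proof (cases "r + s" n rule: linorder_cases)
      case less
      then show ?thesis using nonwrap[OF s(1-3) r(1) _ lr] by simp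
    next
      case equal
      then have "r = n - s" by simp
      then show ?thesis using lr ln lDm[OF s(1)] by simp
    next
      case greater
      \<comment> \<open>A shift by \<open>s\<close> past \<open>n\<close> is undone by the shift by
        \<open>n - s\<close>, again in \<open>Dm\<close>, which starts at \<open>i1\<close> and does
        not wrap around.\<close>
      define i1 where "i1 = r + s - n"
      have n1: "n - s \<in> Dm" using Dm_cong[of "n - s" "- s"] Dm_uminus[OF s(1)] by simp
      have l1: "\<not> l dvd i1"
      proof
        assume "l dvd i1"
        then have "l dvd i1 + (n - s)" using lDm[OF n1] by (rule dvd_add)
        then show False using lr by (simp add: i1_def)
      qed
      have "a i1 = a (i1 + (n - s))"
        by (rule nonwrap[OF n1 _ _ _ _ l1]) (use s r greater in \<open>auto simp: i1_def\<close>)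
      moreover have "a (r + s) = a i1" by (rule a_cong) (simp add: i1_def)
      ultimately show ?thesis by (simp add: i1_def)
    qed
    then show ?thesis using a_cong[OF d] a_cong[OF r(3)] by simp
  qed
  have per: "a (i + k) = a i" if "\<not> l dvd i" for i
    unfolding k_def
  proof (rule periodic_Gcd[where l = l and m = n])
    show "a (u + z) = a u" if "z \<in> insert n Dm" "\<not> l dvd u" for z u
      using that Dm_per a_n by blast
    show "l dvd z" if "z \<in> insert n Dm" for z using that lDm ln by blast
  qed (use n_pos that in simp_all)
  have pk: "a j = a i" if "k dvd j - i" "\<not> l dvd i" for i j
    by (rule dvd_periodic[of l a k, OF per lk]) (use that in auto)
  have "\<exists>d. 0 < d \<and> d dvd l \<and> d \<in> H \<and> (\<forall>i. \<not> d dvd i \<longrightarrow> a (i + d) = a i)"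
  proof (rule descent[OF lpos lH lk k_pos l_def per])
    fix u M assume uM: "(u, M) \<in> B"
    then obtain y where y: "M = n - y - u" "y \<in> Dm" "0 < y" "y < n" "2 * k \<le> n - y" "0 < u"
      "2 * u \<le> n - y" "\<not> k dvd u" "a u \<noteq> a (u + y)"
      unfolding B_def by blast
    have kN: "k dvd n - y" using k_dvd(1) k_dvd(2)[OF y(2)] by simp
    note S = bad_symmetric[OF y(2,8,9)]
    have off: "a (y + i) = a i" if "\<not> l dvd i" for i
      by (rule pk) (use that k_dvd(2)[OF y(2)] in auto)
    have "shift_inv a l u (n - y - u)"
      by (rule shift_inv_step[OF shift_inv_Dm[OF y(2-4)] lk kN lu[OF uM] y(8,6) off])
        (use S y(9) in \<open>simp_all add: add.commute\<close>)
    moreover have "M \<noteq> k"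
    proof
      assume "M = k"
      then have "k dvd (n - y) - k" "(n - y) - k = u" using kN y(1) by auto
      then show False using y(8) by simp
    qed
    then have "k < M" using y(1,5,7) by linarith
    ultimately show "0 < u \<and> k < M \<and> k dvd M + u \<and> shift_inv a l u M"
      using y(1,6) kN by simp
  qed
  then obtain d where d: "0 < d" "d dvd l" "d \<in> H" "\<forall>i. \<not> d dvd i \<longrightarrow> a (i + d) = a i" by blast
  have xP: "x \<in> P" using k_not_dvd_x x(1) by (simp add: P_def D_def)
  have "\<not> d dvd x" by (rule P_not_dvd[OF d(3) xP])
  moreover have "b i = a i" if "\<not> d dvd i" for i
    using agree_off_k[of i] that dvd_trans[OF dvd_trans[OF d(2) lk], of i] by blast
  moreover have "d dvd i" if "i \<in> Dm" for i using d(2) lDm[OF that] by (rule dvd_trans)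
  moreover have "d dvd n" using d(2) ln by (rule dvd_trans)
  ultimately show ?thesis using d(1,4) by (intro exI[of _ d]) auto
qed

end

section \<open>Near concatenation and composition of compositions\<close>

lemma near_concat_Nil [simp]: "near_concat [] b = b" "near_concat a [] = a"
  by (auto simp: near_concat_def)

lemma near_concat_single [simp]: "near_concat [k] (l # ys) = (k + l) # ys"
  by (simp add: near_concat_def)

lemma near_concat_Cons: "xs \<noteq> [] \<Longrightarrow> near_concat (k # xs) b = k # near_concat xs b"
  by (auto simp: near_concat_def)

lemma near_concat_snoc: "near_concat (xs @ [k]) (l # ys) = xs @ (k + l) # ys"
  by (simp add: near_concat_def)

lemma near_concat_append1: "b \<noteq> [] \<Longrightarrow> near_concat (a @ b) c = a @ near_concat b c"
  by (auto simp: near_concat_def butlast_append)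

lemma near_concat_append2: "b \<noteq> [] \<Longrightarrow> near_concat a (b @ c) = near_concat a b @ c"
  by (cases b) (auto simp: near_concat_def)

lemma near_concat_eq_Nil [simp]: "near_concat a b = [] \<longleftrightarrow> a = [] \<and> b = []"
  by (auto simp: near_concat_def)

text \<open>Only a middle factor with a single part is special: both joints then meet in that
  part.\<close>

lemma near_concat_assoc: "near_concat (near_concat a b) c = near_concat a (near_concat b c)"
proof (cases "a = [] \<or> b = [] \<or> c = []")
  case False
  then obtain a' k l b' m c' where a: "a = a' @ [k]" and b: "b = l # b'" and c: "c = m # c'"
    by (metis append_butlast_last_id neq_Nil_conv)
  show ?thesis
  proof (cases b' rule: rev_cases)
    case Nil
    then show ?thesis by (simp add: a b c near_concat_snoc)
  next
    case (snoc b'' r)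
    have "near_concat (near_concat a b) c = near_concat ((a' @ (k + l) # b'') @ [r]) (m # c')"
      using snoc by (simp add: a b c near_concat_snoc)
    also have "\<dots> = a' @ (k + l) # b'' @ (r + m) # c'" by (subst near_concat_snoc) simp
    also have "\<dots> = near_concat (a' @ [k]) (l # b'' @ (r + m) # c')" by (simp add: near_concat_snoc)
    also have "l # b'' @ (r + m) # c' = near_concat ((l # b'') @ [r]) (m # c')"
      by (subst near_concat_snoc) simp
    finally show ?thesis using snoc by (simp add: a b c)
  qed
qed auto

lemma rev_near_concat: "rev (near_concat a b) = near_concat (rev b) (rev a)"
proof (cases "a = [] \<or> b = []")
  case False
  then obtain a' k l b' where "a = a' @ [k]" "b = l # b'"
    by (metis append_butlast_last_id neq_Nil_conv)
  then show ?thesis by (simp add: near_concat_snoc add.commute)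
qed auto

lemma sum_near_concat [simp]: "sum_list (near_concat a b) = sum_list a + sum_list b"
proof (cases "a = [] \<or> b = []")
  case False
  then obtain a' k l b' where "a = a' @ [k]" "b = l # b'"
    by (metis append_butlast_last_id neq_Nil_conv)
  then show ?thesis by (simp add: near_concat_snoc)
qed auto

lemma composition_Cons [simp]: "composition (k # xs) \<longleftrightarrow> 0 < k \<and> composition xs"
  by (auto simp: composition_def)

lemma composition_Nil [simp]: "composition []"
  by (simp add: composition_def)

lemma composition_append [simp]: "composition (a @ b) \<longleftrightarrow> composition a \<and> composition b"
  by (auto simp: composition_def)

lemma composition_rev [simp]: "composition (rev a) \<longleftrightarrow> composition a"
  by (simp add: composition_def)

lemma composition_near_concat:
  assumes "composition a" "composition b" shows "composition (near_concat a b)"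
proof (cases "a = [] \<or> b = []")
  case False
  then obtain a' k l b' where "a = a' @ [k]" "b = l # b'"
    by (metis append_butlast_last_id neq_Nil_conv)
  then show ?thesis using assms by (simp add: near_concat_snoc)
qed (use assms in auto)

lemma composition_sum_pos: "composition a \<Longrightarrow> a \<noteq> [] \<Longrightarrow> 0 < sum_list a"
  by (cases a) auto

lemma near_power_0 [simp]: "near_power b 0 = []" by (simp add: near_power_def)

lemma near_power_Suc: "near_power b (Suc i) = near_concat b (near_power b i)"
  by (simp add: near_power_def)

lemma near_power_1 [simp]: "near_power b (Suc 0) = b" by (simp add: near_power_Suc)

lemma near_power_add: "near_power b (i + j) = near_concat (near_power b i) (near_power b j)"
  by (induction i) (simp_all add: near_power_Suc near_concat_assoc)

lemma near_power_eq_Nil: "b \<noteq> [] \<Longrightarrow> near_power b i = [] \<longleftrightarrow> i = 0"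
  by (cases i) (simp_all add: near_power_Suc)

lemma sum_near_power [simp]: "sum_list (near_power b i) = i * sum_list b"
  by (induction i) (simp_all add: near_power_Suc)

lemma composition_near_power: "composition b \<Longrightarrow> composition (near_power b i)"
  by (induction i) (simp_all add: near_power_Suc composition_near_concat)

lemma rev_near_power: "rev (near_power b i) = near_power (rev b) i"
proof (induction i)
  case (Suc i)
  have "rev (near_power b (Suc i)) = near_concat (near_power (rev b) i) (near_power (rev b) 1)"
    by (simp add: near_power_Suc rev_near_concat Suc)
  also have "\<dots> = near_power (rev b) (Suc i)" using near_power_add[of "rev b" i 1] by simp
  finally show ?case .
qed simp

lemma comp_compose_Nil [simp]: "comp_compose [] b = []" by (simp add: comp_compose_def)

lemma comp_compose_Cons: "comp_compose (k # a) b = near_power b k @ comp_compose a b"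
  by (simp add: comp_compose_def)

lemma comp_compose_append: "comp_compose (a @ b) c = comp_compose a c @ comp_compose b c"
  by (simp add: comp_compose_def)

lemma comp_compose_single [simp]: "comp_compose [k] b = near_power b k"
  by (simp add: comp_compose_def)

lemma comp_compose_eq_Nil:
  "composition a \<Longrightarrow> b \<noteq> [] \<Longrightarrow> comp_compose a b = [] \<longleftrightarrow> a = []"
  by (cases a) (auto simp: comp_compose_Cons near_power_eq_Nil)

lemma composition_comp_compose: "composition b \<Longrightarrow> composition (comp_compose a b)"
  by (induction a) (simp_all add: comp_compose_Cons composition_near_power)

lemma sum_comp_compose [simp]: "sum_list (comp_compose a b) = sum_list a * sum_list b"
  by (induction a) (simp_all add: comp_compose_Cons algebra_simps)

text \<open>The merged part \<open>k + l\<close> yields a near power that splits into two by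
  \<open>near_power_add\<close>. Positivity of \<open>k\<close> and \<open>l\<close> keeps both
  pieces nonempty, so the joint lies between them.\<close>

lemma comp_compose_near_concat:
  assumes "composition a" "composition b" "c \<noteq> []"
  shows "comp_compose (near_concat a b) c = near_concat (comp_compose a c) (comp_compose b c)"
proof (cases "a = [] \<or> b = []")
  case False
  then obtain a' k l b' where ab: "a = a' @ [k]" "b = l # b'"
    by (metis append_butlast_last_id neq_Nil_conv)
  then have kl: "0 < k" "0 < l" using assms by auto
  have "comp_compose (near_concat a b) c
      = comp_compose a' c @ near_concat (near_power c k) (near_power c l) @ comp_compose b' c"
    by (simp add: ab near_concat_snoc comp_compose_append comp_compose_Cons near_power_add)
  then show ?thesis using kl assms(3)
    by (simp add: ab comp_compose_append comp_compose_Cons near_concat_append1 near_concat_append2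
        near_power_eq_Nil)
qed auto

lemma comp_compose_near_power:
  assumes "composition b" "c \<noteq> []"
  shows "comp_compose (near_power b k) c = near_power (comp_compose b c) k"
  by (induction k)
    (simp_all add: near_power_Suc comp_compose_near_concat assms composition_near_power)

lemma comp_compose_assoc:
  assumes "composition b" "c \<noteq> []"
  shows "comp_compose (comp_compose a b) c = comp_compose a (comp_compose b c)"
  by (induction a) (simp_all add: comp_compose_Cons comp_compose_append comp_compose_near_power assms)

lemma rev_comp_compose: "rev (comp_compose a b) = comp_compose (rev a) (rev b)"
  by (induction a) (simp_all add: comp_compose_Cons comp_compose_append rev_near_power)

section \<open>Ribbon functions\<close>

text \<open>The ribbon Schur function as a polynomial in the complete homogeneous symmetric
  functions, evaluated at \<open>h\<close>.\<close>

fun ribbon :: "(nat \<Rightarrow> 'a::comm_ring_1) \<Rightarrow> nat list \<Rightarrow> 'a" where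
  "ribbon h [] = 1"
| "ribbon h [k] = h k"
| "ribbon h (k # l # xs) = h k * ribbon h (l # xs) - ribbon h ((k + l) # xs)"

lemma ribbon_append:
  assumes "a \<noteq> []" "b \<noteq> []"
  shows "ribbon h (a @ b) = ribbon h a * ribbon h b - ribbon h (near_concat a b)"
  using assms
proof (induction h a rule: ribbon.induct)
  case (2 h k)
  then show ?case by (cases b) auto
next
  case (3 h k l xs)
  have c: "ribbon h (k # near_concat (l # xs) b)
      = h k * ribbon h (near_concat (l # xs) b) - ribbon h (near_concat ((k + l) # xs) b)"
  proof (cases xs)
    case Nil
    then show ?thesis using 3(4) by (cases b) (auto simp: add.assoc)
  next
    case (Cons m ys)
    then show ?thesis by (simp add: near_concat_Cons)
  qed
  have e: "near_concat (k # l # xs) b = k # near_concat (l # xs) b"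
    by (simp add: near_concat_Cons)
  have IH: "ribbon h (l # xs @ b) = ribbon h (l # xs) * ribbon h b - ribbon h (near_concat (l # xs) b)"
    "ribbon h ((k + l) # xs @ b)
      = ribbon h ((k + l) # xs) * ribbon h b - ribbon h (near_concat ((k + l) # xs) b)"
    using 3 by auto
  show ?case unfolding e c append_Cons ribbon.simps(3) IH by (simp add: algebra_simps)
qed auto

text \<open>The rule expresses \<open>F\<close> by its values on shorter compositions, down to those
  with one part.\<close>

lemma ribbon_unique:
  assumes F: "\<And>a b. composition a \<Longrightarrow> composition b \<Longrightarrow> a \<noteq> [] \<Longrightarrow> b \<noteq> [] \<Longrightarrow>
      F (a @ b) = F a * F b - F (near_concat a b)"
    and "composition a" "a \<noteq> []"
  shows "F a = ribbon (\<lambda>k. F [k]) a"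
  using assms(2,3)
proof (induction "\<lambda>k. F [k]" a rule: ribbon.induct)
  case (3 k l xs)
  have "F (k # l # xs) = F [k] * F (l # xs) - F ((k + l) # xs)"
    using F[of "[k]" "l # xs"] 3(3) by simp
  then show ?case using 3 by simp
qed auto

text \<open>The first part can also be split off as the last part of the reversal; commutativity
  makes the two recursions equal.\<close>

lemma ribbon_rev: "ribbon h (rev a) = ribbon h a"
proof (induction h a rule: ribbon.induct)
  case (3 h k l xs)
  have "ribbon h (rev (k # l # xs)) = ribbon h (rev (l # xs) @ [k])" by simp
  also have "\<dots> = ribbon h (rev (l # xs)) * h k - ribbon h (near_concat (rev (l # xs)) [k])"
    by (subst ribbon_append) auto
  also have "near_concat (rev (l # xs)) [k] = rev ((k + l) # xs)"
    by (simp add: near_concat_snoc add.commute)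
  finally show ?case using 3 by (simp add: mult.commute)
qed auto

text \<open>For fixed \<open>b\<close> the left side obeys the ribbon rule in \<open>a\<close>. So
  composing with \<open>b\<close> on the right is a substitution for the values of
  \<open>h\<close>.\<close>

lemma ribbon_comp_compose:
  assumes "composition a" "a \<noteq> []" "b \<noteq> []"
  shows "ribbon h (comp_compose a b) = ribbon (\<lambda>k. ribbon h (near_power b k)) a"
proof -
  have "ribbon h (comp_compose a b) = ribbon (\<lambda>k. ribbon h (comp_compose [k] b)) a"
  proof (rule ribbon_unique[where F = "\<lambda>a. ribbon h (comp_compose a b)", OF _ assms(1,2)])
    fix x y assume "composition x" "composition y" "x \<noteq> []" "y \<noteq> []"
    then show "ribbon h (comp_compose (x @ y) b)
        = ribbon h (comp_compose x b) * ribbon h (comp_compose y b)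
          - ribbon h (comp_compose (near_concat x y) b)"
      using assms(3) by (simp add: comp_compose_append comp_compose_near_concat
        ribbon_append comp_compose_eq_Nil)
  qed
  then show ?thesis by simp
qed

lemma comp_compose_list_Cons:
  "as \<noteq> [] \<Longrightarrow> comp_compose_list (a # as) = comp_compose a (comp_compose_list as)"
  by (cases as) auto

lemma comp_compose_list_composition:
  assumes "as \<noteq> []" "\<forall>a\<in>set as. a \<noteq> [] \<and> composition a"
  shows "composition (comp_compose_list as)" "comp_compose_list as \<noteq> []"
proof -
  have "composition (comp_compose_list as) \<and> comp_compose_list as \<noteq> []"
    using assms
  proof (induction as)
    case (Cons a as)
    then show ?case
      by (cases "as = []") (auto simp: comp_compose_list_Cons composition_comp_compose
        comp_compose_eq_Nil)
  qed simp
  then show "composition (comp_compose_list as)" "comp_compose_list as \<noteq> []" by auto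
qed

lemma comp_compose_list_snoc:
  assumes "as \<noteq> []" "\<forall>a\<in>set as. a \<noteq> [] \<and> composition a" "d \<noteq> []"
  shows "comp_compose_list (as @ [d]) = comp_compose (comp_compose_list as) d"
  using assms
proof (induction as)
  case (Cons a as)
  show ?case
  proof (cases "as = []")
    case False
    then show ?thesis using Cons comp_compose_list_composition[of as]
      by (simp add: comp_compose_list_Cons comp_compose_assoc)
  qed simp
qed simp

text \<open>Reversing \<open>c\<close> reverses its near powers and so leaves the values substituted
  into the ribbon function of \<open>A\<close> unchanged.\<close>

lemma ribbon_rev_factor:
  assumes "composition A" "A \<noteq> []" "composition c" "c \<noteq> []"
  shows "ribbon h (comp_compose A (rev c)) = ribbon h (comp_compose A c)"
proof -
  have "ribbon h (near_power (rev c) k) = ribbon h (near_power c k)" for k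
    using ribbon_rev[of h "near_power c k"] by (simp add: rev_near_power)
  then show ?thesis using assms by (simp add: ribbon_comp_compose)
qed

lemma equiv_factors_composition:
  assumes "list_all2 (\<lambda>\<gamma> \<delta>. \<delta> = \<gamma> \<or> \<delta> = rev \<gamma>) as bs" "\<forall>a\<in>set as. a \<noteq> [] \<and> composition a"
  shows "\<forall>b\<in>set bs. b \<noteq> [] \<and> composition b"
  using assms by (induction rule: list_all2_induct) auto

text \<open>\<open>A\<close> collects the factors already treated. In front of any further factors,
  \<open>a\<close> may be replaced by \<open>b\<close>: by \<open>ribbon_comp_compose\<close> the
  factors on the right only change the values at which ribbon functions are taken.\<close>

lemma ribbon_equiv_lists:
  assumes "list_all2 (\<lambda>\<gamma> \<delta>. \<delta> = \<gamma> \<or> \<delta> = rev \<gamma>) as bs" "as \<noteq> []"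
    "\<forall>a\<in>set as. a \<noteq> [] \<and> composition a" "composition A" "A \<noteq> []"
  shows "ribbon h (comp_compose A (comp_compose_list as))
    = ribbon h (comp_compose A (comp_compose_list bs))"
  using assms
proof (induction as bs arbitrary: A rule: list_all2_induct)
  case (Cons a as b bs)
  have a: "a \<noteq> []" "composition a" and as: "\<forall>a\<in>set as. a \<noteq> [] \<and> composition a" using Cons.prems by auto
  have b: "b \<noteq> []" "composition b" using Cons.hyps(1) a by auto
  have eqab: "ribbon g (comp_compose A b) = ribbon g (comp_compose A a)" for g :: "nat \<Rightarrow> 'a"
    using Cons.hyps(1) ribbon_rev_factor[OF Cons.prems(3,4) a(2,1)] by auto
  show ?case
  proof (cases "as = []")
    case True
    then show ?thesis using Cons.hyps(2) eqab by simp
  next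
    case False
    then have bs: "bs \<noteq> []" using Cons.hyps(2) by auto
    have bs': "\<forall>a\<in>set bs. a \<noteq> [] \<and> composition a"
      using equiv_factors_composition[OF Cons.hyps(2) as] .
    let ?R = "comp_compose_list as" and ?S = "comp_compose_list bs"
    note R = comp_compose_list_composition[OF False as] and S = comp_compose_list_composition[OF bs bs']
    have Aa: "composition (comp_compose A a)" "comp_compose A a \<noteq> []"
      "composition (comp_compose A b)" "comp_compose A b \<noteq> []"
      using Cons.prems(3,4) a b by (auto simp: composition_comp_compose comp_compose_eq_Nil)
    have "ribbon h (comp_compose A (comp_compose_list (a # as)))
      = ribbon h (comp_compose (comp_compose A a) ?R)"
      using False a R by (simp add: comp_compose_list_Cons comp_compose_assoc)
    also have "\<dots> = ribbon h (comp_compose (comp_compose A a) ?S)"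
      by (rule Cons.IH[OF False as Aa(1,2)])
    also have "\<dots> = ribbon h (comp_compose (comp_compose A b) ?S)"
      using Aa S by (simp add: ribbon_comp_compose eqab)
    also have "\<dots> = ribbon h (comp_compose A (comp_compose_list (b # bs)))"
      using bs b S by (simp add: comp_compose_list_Cons comp_compose_assoc)
    finally show ?thesis .
  qed
qed simp

lemma comp_equiv_ribbon:
  assumes "comp_equiv \<alpha> \<beta>"
  shows "ribbon h \<alpha> = ribbon h \<beta>"
proof -
  obtain as bs where *: "as \<noteq> []" "\<forall>\<gamma>\<in>set as. \<gamma> \<noteq> [] \<and> composition \<gamma>"
      "list_all2 (\<lambda>\<gamma> \<delta>. \<delta> = \<gamma> \<or> \<delta> = rev \<gamma>) as bs"
      "\<alpha> = comp_compose_list as" "\<beta> = comp_compose_list bs"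
    using assms unfolding comp_equiv_def by blast
  then show ?thesis using ribbon_equiv_lists[OF *(3,1,2), of "[1]" h] by simp
qed

section \<open>Closure properties of the equivalence of compositions\<close>

lemma comp_equiv_refl: "composition \<alpha> \<Longrightarrow> \<alpha> \<noteq> [] \<Longrightarrow> comp_equiv \<alpha> \<alpha>"
  unfolding comp_equiv_def by (intro exI[of _ "[\<alpha>]"]) auto

lemma comp_equiv_rev_self: "composition \<alpha> \<Longrightarrow> \<alpha> \<noteq> [] \<Longrightarrow> comp_equiv \<alpha> (rev \<alpha>)"
  unfolding comp_equiv_def by (intro exI[of _ "[\<alpha>]"] exI[of _ "[rev \<alpha>]"]) auto

lemma rev_comp_compose_list: "rev (comp_compose_list as) = comp_compose_list (map rev as)"
proof (induction as)
  case (Cons a as)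
  then show ?case by (cases as) (simp_all add: comp_compose_list_Cons rev_comp_compose)
qed simp

text \<open>Reversing a composite reverses each of its factors, which the relation permits.\<close>

lemma comp_equiv_rev:
  assumes "comp_equiv \<alpha> \<beta>" shows "comp_equiv \<alpha> (rev \<beta>)"
proof -
  obtain as bs where *: "as \<noteq> []" "\<forall>\<gamma>\<in>set as. \<gamma> \<noteq> [] \<and> composition \<gamma>"
      "list_all2 (\<lambda>\<gamma> \<delta>. \<delta> = \<gamma> \<or> \<delta> = rev \<gamma>) as bs"
      "\<alpha> = comp_compose_list as" "\<beta> = comp_compose_list bs"
    using assms unfolding comp_equiv_def by blast
  have "list_all2 (\<lambda>\<gamma> \<delta>. \<delta> = \<gamma> \<or> \<delta> = rev \<gamma>) as (map rev bs)"
    using *(3) by (auto simp: list_all2_conv_all_nth)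
  moreover have "rev \<beta> = comp_compose_list (map rev bs)" using *(5) by (simp add: rev_comp_compose_list)
  ultimately show ?thesis unfolding comp_equiv_def
    using *(1,2,4) by (intro exI[of _ as] exI[of _ "map rev bs"] conjI)
qed

lemma comp_equiv_compose:
  assumes "comp_equiv \<alpha> \<beta>" "composition d" "d \<noteq> []"
  shows "comp_equiv (comp_compose \<alpha> d) (comp_compose \<beta> d)"
proof -
  obtain as bs where *: "as \<noteq> []" "\<forall>\<gamma>\<in>set as. \<gamma> \<noteq> [] \<and> composition \<gamma>"
      "list_all2 (\<lambda>\<gamma> \<delta>. \<delta> = \<gamma> \<or> \<delta> = rev \<gamma>) as bs"
      "\<alpha> = comp_compose_list as" "\<beta> = comp_compose_list bs"
    using assms unfolding comp_equiv_def by blast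
  have bs: "bs \<noteq> []" using * by auto
  have bs': "\<forall>a\<in>set bs. a \<noteq> [] \<and> composition a"
    using equiv_factors_composition[OF *(3,2)] .
  show ?thesis unfolding comp_equiv_def
  proof (intro exI conjI)
    show "as @ [d] \<noteq> []" by simp
    show "\<forall>\<gamma>\<in>set (as @ [d]). \<gamma> \<noteq> [] \<and> composition \<gamma>" using *(2) assms(2,3) by auto
    show "list_all2 (\<lambda>\<gamma> \<delta>. \<delta> = \<gamma> \<or> \<delta> = rev \<gamma>) (as @ [d]) (bs @ [d])"
      using *(3) by (rule list_all2_appendI) simp
    show "comp_compose \<alpha> d = comp_compose_list (as @ [d])"
      using * assms(3) by (simp add: comp_compose_list_snoc)
    show "comp_compose \<beta> d = comp_compose_list (bs @ [d])"
      using * bs bs' assms(3) by (simp add: comp_compose_list_snoc)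
  qed
qed

section \<open>Partial sums and coarsenings\<close>

lemma composition_set_take: "composition_set a = (\<lambda>i. sum_list (take i a)) ` {1..<length a}"
  unfolding composition_set_def by auto

lemma composition_set_Nil [simp]: "composition_set [] = {}"
  by (simp add: composition_set_take)

lemma composition_set_merge: "composition_set ((k + l) # xs) = (+) k ` composition_set (l # xs)"
proof -
  have "sum_list (take i ((k + l) # xs)) = k + sum_list (take i (l # xs))" if "1 \<le> i" for i
    using that by (cases i) auto
  then show ?thesis unfolding composition_set_take image_image by (intro image_cong) auto
qed

lemma composition_set_Cons:
  assumes "xs \<noteq> []" shows "composition_set (k # xs) = insert k ((+) k ` composition_set xs)"
proof -
  have "{1..<length (k # xs)} = insert 1 (Suc ` {1..<length xs})"
    unfolding image_Suc_atLeastLessThan using assms by (cases xs) auto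
  then show ?thesis unfolding composition_set_take image_image
    by (simp only: image_insert image_image) simp
qed

lemma composition_set_append:
  assumes "a \<noteq> []" "b \<noteq> []"
  shows "composition_set (a @ b)
    = composition_set a \<union> insert (sum_list a) ((+) (sum_list a) ` composition_set b)"
  using assms
proof (induction a)
  case (Cons k a)
  show ?case
  proof (cases "a = []")
    case False
    then show ?thesis using Cons
      by (simp add: composition_set_Cons image_Un image_image add.assoc insert_commute)
  qed (use Cons in \<open>simp add: composition_set_Cons\<close>)
qed simp

lemma composition_set_near_concat:
  assumes "a \<noteq> []" "b \<noteq> []"
  shows "composition_set (near_concat a b) = composition_set a \<union> (+) (sum_list a) ` composition_set b"
  using assms
proof (induction a)
  case (Cons k a)
  show ?case
  proof (cases "a = []")
    case True
    obtain l b' where "b = l # b'" using Cons by (cases b) auto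
    then show ?thesis using True by (simp add: composition_set_merge)
  next
    case False
    then show ?thesis using Cons
      by (simp add: near_concat_Cons composition_set_Cons image_Un image_image add.assoc)
  qed
qed simp

lemma composition_set_bounds:
  assumes "composition a" "i \<in> composition_set a" shows "0 < i" "i < sum_list a"
proof -
  show "i < sum_list a" using composition_set_less assms by blast
  obtain j where j: "i = sum_list (take j a)" "1 \<le> j" "j < length a"
    using assms(2) by (auto simp: composition_set_def)
  then have "take j a \<noteq> []" by auto
  moreover have "composition (take j a)"
    using assms(1) by (auto simp: composition_def dest: in_set_takeD)
  ultimately show "0 < i" using composition_sum_pos j(1) by blast
qed

lemma composition_set_rev:
  assumes "composition a"
  shows "composition_set (rev a) = (\<lambda>i. sum_list a - i) ` composition_set a"
  using assms
proof (induction a)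
  case (Cons k a)
  show ?case
  proof (cases "a = []")
    case False
    have "composition_set (rev (k # a)) = insert (sum_list a) ((\<lambda>i. sum_list a - i) ` composition_set a)"
      using False Cons by (simp add: composition_set_snoc)
    also have "\<dots> = (\<lambda>i. sum_list (k # a) - i) ` composition_set (k # a)"
      using False by (simp add: composition_set_Cons image_image)
    finally show ?thesis .
  qed simp
qed simp

lemma composition_set_near_power:
  assumes "composition b" "b \<noteq> []"
  shows "composition_set (near_power b k)
    = {i. i < k * sum_list b \<and> \<not> sum_list b dvd i \<and> i mod sum_list b \<in> composition_set b}"
proof (induction k)
  case (Suc k)
  let ?m = "sum_list b"
  have m: "0 < ?m" using composition_sum_pos[OF assms] .
  have nd: "\<not> ?m dvd i" if "i \<in> composition_set b" for i
    using nat_dvd_not_less composition_set_bounds[OF assms(1) that] by blast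
  have low: "composition_set b = {i. i < ?m \<and> \<not> ?m dvd i \<and> i mod ?m \<in> composition_set b}"
    using composition_set_bounds[OF assms(1)] nd by auto
  show ?case
  proof (cases "k = 0")
    case True
    then show ?thesis using low by simp
  next
    case False
    then have ne: "near_power b k \<noteq> []" using assms(2) by (simp add: near_power_eq_Nil)
    have "composition_set (near_power b (Suc k)) = composition_set b \<union>
      (+) ?m ` composition_set (near_power b k)"
      using ne assms(2) by (simp add: near_power_Suc composition_set_near_concat)
    also have "\<dots> = {i. i < Suc k * ?m \<and> \<not> ?m dvd i \<and> i mod ?m \<in> composition_set b}" (is "?L = ?R")
    proof
      show "?L \<subseteq> ?R" using composition_set_bounds[OF assms(1)] nd by (auto simp: Suc trans_less_add1)
      show "?R \<subseteq> ?L"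
      proof
        fix i assume i: "i \<in> ?R"
        show "i \<in> ?L"
        proof (cases "i < ?m")
          case True
          then show ?thesis using i by simp
        next
          case False
          then have "i = ?m + (i - ?m)" "i - ?m < k * ?m" "\<not> ?m dvd i - ?m" "(i - ?m) mod ?m \<in> composition_set b"
            using i by (auto simp: le_mod_geq not_less dvd_minus_self)
          then show ?thesis using Suc by blast
        qed
      qed
    qed
    finally show ?thesis .
  qed
qed simp

text \<open>This is how a right factor is recognized: as periodicity off the multiples of its
  size.\<close>

lemma composition_set_comp_compose:
  assumes "composition a" "composition b" "b \<noteq> []"
  shows "composition_set (comp_compose a b) = {i. i < sum_list a * sum_list b \<and>
    (if sum_list b dvd i then i div sum_list b \<in> composition_set a else i mod sum_list b \<in> composition_set b)}"
  using assms(1)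
proof (induction a)
  case (Cons k a)
  let ?m = "sum_list b"
  have m: "0 < ?m" using composition_sum_pos[OF assms(2,3)] .
  have k: "0 < k" "composition a" using Cons.prems by auto
  have np: "near_power b k \<noteq> []" using k assms(3) by (simp add: near_power_eq_Nil)
  show ?case
  proof (cases "a = []")
    case True
    then show ?thesis using m
      by (auto simp: comp_compose_Cons composition_set_near_power assms)
  next
    case False
    then have ne: "comp_compose a b \<noteq> []" using k assms(3) by (simp add: comp_compose_eq_Nil)
    have "composition_set (comp_compose (k # a) b) = composition_set (near_power b k) \<union>
        insert (k * ?m) ((+) (k * ?m) ` composition_set (comp_compose a b))"
      using np ne by (simp add: comp_compose_Cons composition_set_append)
    also have "\<dots> = {i. i < sum_list (k # a) * ?m \<and>
        (if ?m dvd i then i div ?m \<in> composition_set (k # a) else i mod ?m \<in> composition_set b)}" (is "?L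
          = ?R")
    proof (rule set_eqI)
      fix i
      have sa: "0 < sum_list a" using composition_sum_pos k(2) False by blast
      show "i \<in> ?L \<longleftrightarrow> i \<in> ?R"
      proof (cases "i < k * ?m")
        case True
        have "i \<notin> (+) (k * ?m) ` composition_set (comp_compose a b)" using True by auto
        moreover have "i < sum_list (k # a) * ?m" using True by (simp add: algebra_simps)
        moreover have "i div ?m \<notin> composition_set (k # a)" if "?m dvd i"
        proof -
          have "i div ?m < k" using True m by (simp add: less_mult_imp_div_less)
          then show ?thesis using False by (auto simp: composition_set_Cons)
        qed
        ultimately show ?thesis using True by (auto simp: composition_set_near_power assms)
      next
        case ge: False
        define j where "j = i - k * ?m"
        have i: "i = k * ?m + j" using ge by (simp add: j_def)
        have 1: "i \<notin> composition_set (near_power b k)"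
          using ge by (simp add: composition_set_near_power assms)
        have 2: "i \<in> (+) (k * ?m) ` composition_set (comp_compose a b) \<longleftrightarrow> j \<in> composition_set (comp_compose a b)"
          by (auto simp: i)
        have 3: "i < sum_list (k # a) * ?m \<longleftrightarrow> j < sum_list a * ?m" by (simp add: i algebra_simps)
        have 4: "?m dvd i \<longleftrightarrow> ?m dvd j" by (simp add: i)
        have 5: "i mod ?m = j mod ?m" "i div ?m = k + j div ?m"
          using div_mult_self3[of ?m k j] m by (simp_all only: i mod_mult_self3)
        have 6: "k + d \<in> composition_set (k # a) \<longleftrightarrow> d = 0 \<or> d \<in> composition_set a" for d
          using False by (auto simp: composition_set_Cons)
        have 7: "j div ?m = 0 \<longleftrightarrow> j = 0" if "?m dvd j" using that m by auto
        show ?thesis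
        proof (cases "j = 0")
          case True
          then show ?thesis using sa m 6[of 0] by (simp add: i 5)
        next
          case False
          have "i \<in> ?L \<longleftrightarrow> j \<in> composition_set (comp_compose a b)"
            unfolding Un_iff insert_iff 2 using 1 False by (simp add: i)
          also have "\<dots> \<longleftrightarrow> j < sum_list a * ?m \<and>
              (if ?m dvd j then j div ?m \<in> composition_set a else j mod ?m \<in> composition_set b)"
            unfolding Cons.IH[OF k(2)] by simp
          also have "\<dots> \<longleftrightarrow> i \<in> ?R"
            unfolding mem_Collect_eq 3 4 5 6 using 7 False by (cases "?m dvd j") simp_all
          finally show ?thesis .
        qed
      qed
    qed
    finally show ?thesis .
  qed
qed simp

section \<open>Expansion of ribbon functions over coarsenings\<close>

definition coarsenings :: "nat list \<Rightarrow> nat list set" where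
  "coarsenings a = {xs. composition xs \<and> sum_list xs = sum_list a \<and>
    composition_set xs \<subseteq> composition_set a}"

lemma coarsenings_single: "0 < k \<Longrightarrow> coarsenings [k] = {[k]}"
proof -
  assume k: "0 < k"
  have "xs = [k]" if xs: "composition xs" "sum_list xs = k" "composition_set xs = {}" for xs
    using composition_set_inject[OF xs(1), of "[k]"] xs k by simp
  then show ?thesis using k by (auto simp: coarsenings_def)
qed

text \<open>A coarsening keeps the first cut \<open>k\<close> or omits it, in parallel with the
  recursion of \<open>ribbon\<close>.\<close>

lemma coarsenings_Cons:
  assumes "composition (k # l # xs)"
  shows "coarsenings (k # l # xs) = (#) k ` coarsenings (l # xs) \<union> coarsenings ((k + l) # xs)"
    and "(#) k ` coarsenings (l # xs) \<inter> coarsenings ((k + l) # xs) = {}"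
proof -
  let ?S = "composition_set (l # xs)"
  have S: "composition_set (k # l # xs) = insert k ((+) k ` ?S)" by (simp add: composition_set_Cons)
  have pos: "0 < i" if "i \<in> ?S" for i using composition_set_bounds(1)[of "l # xs"] assms that by simp
  have kn: "k \<notin> (+) k ` ?S" using pos by force
  have big: "k \<le> i" if "i \<in> insert k ((+) k ` ?S)" for i using that by auto
  have hd: "\<exists>zs. ys = k # zs \<and> zs \<in> coarsenings (l # xs)"
    if ys: "ys \<in> coarsenings (k # l # xs)" "k \<in> composition_set ys" for ys
  proof -
    have c: "composition ys" "sum_list ys
      = k + sum_list (l # xs)" "composition_set ys \<subseteq> insert k ((+) k ` ?S)"
      using ys(1) S by (auto simp: coarsenings_def)
    obtain j zs where j: "ys = j # zs" using ys(2) by (cases ys) auto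
    have zs: "zs \<noteq> []" using ys(2) j by auto
    have jS: "j \<in> composition_set ys" using zs j by (simp add: composition_set_Cons)
    then have "k \<le> j" using c(3) big by blast
    moreover have "j \<le> k" using ys(2) zs j by (auto simp: composition_set_Cons)
    ultimately have jk: "j = k" by simp
    have "composition_set zs \<subseteq> ?S"
    proof
      fix i assume i: "i \<in> composition_set zs"
      then have "k + i \<in> composition_set ys" using j jk zs by (simp add: composition_set_Cons)
      moreover have "0 < i" using composition_set_bounds(1)[of zs i] i c(1) j by simp
      ultimately show "i \<in> ?S" using c(3) by auto
    qed
    then have "zs \<in> coarsenings (l # xs)" using c j jk by (simp add: coarsenings_def)
    then show ?thesis using j jk by blast
  qed
  have 1: "k # zs \<in> coarsenings (k # l # xs)" if "zs \<in> coarsenings (l # xs)" for zs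
  proof -
    have zs: "composition zs" "sum_list zs = sum_list (l # xs)" "composition_set zs \<subseteq> ?S"
      using that by (auto simp: coarsenings_def)
    have "zs \<noteq> []" using zs(2) assms by auto
    then show ?thesis using zs assms by (auto simp: coarsenings_def S composition_set_Cons)
  qed
  have 2: "coarsenings ((k + l) # xs) = {ys \<in> coarsenings (k # l # xs). k \<notin> composition_set ys}"
    using kn by (auto simp: coarsenings_def composition_set_merge S)
  have 3: "k \<in> composition_set (k # zs)" if "zs \<in> coarsenings (l # xs)" for zs
  proof -
    have "zs \<noteq> []" using that assms by (auto simp: coarsenings_def)
    then show ?thesis by (simp add: composition_set_Cons)
  qed
  show "coarsenings (k # l # xs) = (#) k ` coarsenings (l # xs) \<union> coarsenings ((k + l) # xs)"
    unfolding 2 using hd 1 by blast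
  show "(#) k ` coarsenings (l # xs) \<inter> coarsenings ((k + l) # xs) = {}"
    unfolding 2 using 3 by blast
qed

lemma finite_coarsenings: "composition a \<Longrightarrow> a \<noteq> [] \<Longrightarrow> finite (coarsenings a)"
proof (induction a rule: induct_list012)
  case (3 k l xs)
  have "finite (coarsenings zs)" if "composition zs" "zs \<noteq> []" "length zs \<le> Suc (length xs)" for zs
    using that
  proof (induction "length zs" arbitrary: zs rule: less_induct)
    case less
    show ?case
    proof (cases zs)
      case (Cons k zs')
      show ?thesis
      proof (cases zs')
        case Nil then show ?thesis using Cons less.prems by (simp add: coarsenings_single)
      next
        case (Cons l ys)
        note zs = \<open>zs = k # zs'\<close>[unfolded Cons]
        show ?thesis unfolding zs using coarsenings_Cons(1)[of k l ys] less.prems less.hyps[of "l # ys"] less.hyps[of "(k + l) # ys"]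
          by (simp add: zs)
      qed
    qed (use less in simp)
  qed
  then show ?case using 3 coarsenings_Cons(1)[of k l xs] by simp
qed (auto simp: coarsenings_single)

text \<open>In the expansion into products of values of \<open>h\<close> the signs depend on the
  lengths; writing \<open>h\<close> as \<open>- g\<close> collects them into one global
  sign.\<close>

lemma ribbon_coarsenings:
  fixes g :: "nat \<Rightarrow> 'a::comm_ring_1"
  assumes "composition a" "a \<noteq> []"
  shows "ribbon (\<lambda>k. - g k) a = (- 1) ^ length a * (\<Sum>xs\<in>coarsenings a. prod_list (map g xs))"
  using assms
proof (induction "\<lambda>k. - g k" a rule: ribbon.induct)
  case (2 k)
  then show ?case by (simp add: coarsenings_single)
next
  case (3 k l xs)
  have c: "composition (l # xs)" "composition ((k + l) # xs)" using 3(3) by auto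
  have "(\<Sum>ys\<in>coarsenings (k # l # xs). prod_list (map g ys))
      = (\<Sum>ys\<in>coarsenings (l # xs). g k * prod_list (map g ys))
        + (\<Sum>ys\<in>coarsenings ((k + l) # xs). prod_list (map g ys))"
    unfolding coarsenings_Cons(1)[OF 3(3)]
    using coarsenings_Cons(2)[OF 3(3)] finite_coarsenings[OF c(1)] finite_coarsenings[OF c(2)]
    by (subst sum.union_disjoint) (auto simp: sum.reindex)
  then show ?case using 3(1)[OF c(1)] 3(2)[OF c(2)]
    by (simp add: sum_distrib_left[symmetric] algebra_simps)
qed simp

section \<open>Compositions with equal ribbon functions\<close>

lemma digits_unique:
  fixes c d :: "nat \<Rightarrow> nat"
  assumes "\<And>i. c i < B" "\<And>i. d i < B" "(\<Sum>i<N. c i * B ^ i) = (\<Sum>i<N. d i * B ^ i)" "i < N"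
  shows "c i = d i"
  using assms
proof (induction N arbitrary: c d i)
  case (Suc N)
  have shift: "(\<Sum>i<Suc N. f i * B ^ i) = f 0 + B * (\<Sum>i<N. f (Suc i) * B ^ i)" for f :: "nat \<Rightarrow> nat"
    by (subst sum.lessThan_Suc_shift) (simp add: sum_distrib_left algebra_simps)
  have eq: "c 0 + B * (\<Sum>i<N. c (Suc i) * B ^ i) = d 0 + B * (\<Sum>i<N. d (Suc i) * B ^ i)"
    using Suc.prems(3) unfolding shift .
  have "(c 0 + B * (\<Sum>i<N. c (Suc i) * B ^ i)) mod B = c 0" using Suc.prems(1) by simp
  moreover have "(d 0 + B * (\<Sum>i<N. d (Suc i) * B ^ i)) mod B = d 0" using Suc.prems(2) by simp
  ultimately have 0: "c 0 = d 0" using eq by simp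
  have "0 < B" using Suc.prems(1)[of 0] by simp
  then have "(\<Sum>i<N. c (Suc i) * B ^ i) = (\<Sum>i<N. d (Suc i) * B ^ i)" using eq 0 by simp
  then have "c (Suc j) = d (Suc j)" if "j < N" for j
    using Suc.IH[of "\<lambda>i. c (Suc i)" "\<lambda>i. d (Suc i)" j] Suc.prems that by simp
  then show ?case using 0 Suc.prems(4) by (cases i) auto
qed simp

lemma mset_eq_if_power_sums_eq:
  fixes xs ys :: "nat list"
  assumes "length xs < B" "length ys < B" "\<forall>x\<in>set xs \<union> set ys. x < N"
    and "(\<Sum>x\<leftarrow>xs. B ^ x) = (\<Sum>x\<leftarrow>ys. B ^ x)"
  shows "mset xs = mset ys"
proof (rule multiset_eqI)
  fix i
  have lt: "count_list zs j \<le> length zs" for zs :: "nat list" and j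
    by (rule count_le_length)
  show "count (mset xs) i = count (mset ys) i"
  proof (cases "i < N")
    case True
    have "(\<Sum>j<N. count_list xs j * B ^ j) = (\<Sum>j<N. count_list ys j * B ^ j)"
    proof -
      have "set xs \<subseteq> {..<N}" "set ys \<subseteq> {..<N}" using assms(3) by auto
      from sum_list_map_eq_sum_count2[OF this(1), of "\<lambda>x. B ^ x"]
        sum_list_map_eq_sum_count2[OF this(2), of "\<lambda>x. B ^ x"]
      show ?thesis using assms(4) by simp
    qed
    moreover have "count_list xs j < B" "count_list ys j < B" for j
      using lt[of xs j] lt[of ys j] assms(1,2) by linarith+
    ultimately show ?thesis using digits_unique[of "count_list xs" B "count_list ys" N i] True
      by (simp add: count_mset)
  next
    case False
    then have "i \<notin> set xs" "i \<notin> set ys" using assms(3) by auto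
    then show ?thesis by (simp add: count_mset)
  qed
qed

lemma composition_length_le: "composition xs \<Longrightarrow> length xs \<le> sum_list xs"
  by (induction xs) auto

text \<open>It remains to compare the global signs. For \<open>g\<close> the indicator of
  \<open>n\<close> only the coarsening \<open>[n]\<close> contributes, so both sums are
  \<open>1\<close>.\<close>

lemma sum_coarsenings_eq:
  fixes \<alpha> \<beta> :: "nat list"
  assumes a: "composition \<alpha>" "\<alpha> \<noteq> []" and b: "composition \<beta>" "\<beta> \<noteq> []"
    and sum: "sum_list \<alpha> = sum_list \<beta>"
    and eq: "\<And>h :: nat \<Rightarrow> complex. ribbon h \<alpha> = ribbon h \<beta>"
  shows "(\<Sum>xs\<in>coarsenings \<alpha>. prod_list (map g xs))
    = (\<Sum>xs\<in>coarsenings \<beta>. prod_list (map (g :: nat \<Rightarrow> complex) xs))"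
proof -
  define S where "S \<gamma> g = (\<Sum>xs\<in>coarsenings \<gamma>. prod_list (map g xs))" for \<gamma> and g :: "nat \<Rightarrow> complex"
  define n where "n = sum_list \<alpha>"
  have n: "0 < n" using composition_sum_pos[OF a] by (simp add: n_def)
  have sg: "(- 1) ^ length \<alpha> * S \<alpha> g = (- 1) ^ length \<beta> * S \<beta> g" for g
    using eq[of "\<lambda>k. - g k"] unfolding ribbon_coarsenings[OF a] ribbon_coarsenings[OF b] S_def .
  define d where "d = (\<lambda>k. if k = n then 1 else 0 :: complex)"
  have one: "S \<gamma> d = 1" if c: "composition \<gamma>" "\<gamma> \<noteq> []" "sum_list \<gamma> = n" for \<gamma>
  proof -
    have "prod_list (map d xs) = (if xs = [n] then 1 else 0)" if xs: "xs \<in> coarsenings \<gamma>" for xs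
    proof (cases "xs = [n]")
      case False
      have *: "composition xs" "sum_list xs = n" using xs c by (auto simp: coarsenings_def)
      have "\<exists>x\<in>set xs. x \<noteq> n"
      proof (rule ccontr)
        assume all: "\<not> ?thesis"
        obtain x ys where ys: "xs = x # ys" using * n by (cases xs) auto
        then have "sum_list ys = 0" using all *(2) by simp
        then have "ys = []" using *(1) ys by (cases ys) auto
        then show False using False all ys by simp
      qed
      then show ?thesis using False by (auto simp: prod_list_zero_iff d_def)
    qed (simp add: d_def)
    then have "S \<gamma> d = (\<Sum>xs\<in>coarsenings \<gamma>. if xs = [n] then 1 else 0)"
      unfolding S_def by (intro sum.cong) auto
    also have "\<dots> = 1"
      using finite_coarsenings[OF c(1,2)] c(3) n by (simp add: coarsenings_def)
    finally show ?thesis .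
  qed
  have "(- 1 :: complex) ^ length \<alpha> = (- 1) ^ length \<beta>"
    using sg[of d] one[OF a] one[OF b] sum by (simp add: n_def)
  then show ?thesis using sg[of g] by (simp add: S_def)
qed

text \<open>For \<open>h\<^sub>k = T ^ (B ^ k)\<close> with \<open>B\<close> large, the monomial of a coarsening is a power of \<open>T\<close> whose exponent
  has the multiplicities of the parts as its digits in base \<open>B\<close>.\<close>

lemma coarsening_counts_eq:
  assumes a: "composition \<alpha>" "\<alpha> \<noteq> []" and b: "composition \<beta>" "\<beta> \<noteq> []"
    and sum: "sum_list \<alpha> = sum_list \<beta>"
    and eq: "\<And>h :: nat \<Rightarrow> complex. ribbon h \<alpha> = ribbon h \<beta>"
  shows "card {xs \<in> coarsenings \<alpha>. mset xs = X} = card {xs \<in> coarsenings \<beta>. mset xs = X}"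
proof -
  define n where "n = sum_list \<alpha>"
  define B where "B = Suc n"
  define w where "w xs = (\<Sum>x\<leftarrow>xs. B ^ x)" for xs :: "nat list"
  define p where "p \<gamma> = (\<Sum>xs\<in>coarsenings \<gamma>. monom (1 :: complex) (w xs))" for \<gamma>
  have pw: "prod_list (map (\<lambda>k. T ^ (B ^ k)) xs) = T ^ w xs" for T :: complex and xs
    by (induction xs) (auto simp: w_def power_add)
  have "poly (p \<gamma>) T = (\<Sum>xs\<in>coarsenings \<gamma>. prod_list (map (\<lambda>k. T ^ (B ^ k)) xs))" for \<gamma> T
    unfolding p_def pw by (simp add: poly_sum poly_monom)
  then have "poly (p \<alpha>) = poly (p \<beta>)"
    using sum_coarsenings_eq[OF assms] by auto
  then have pp: "p \<alpha> = p \<beta>" by (simp add: poly_eq_poly_eq_iff)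
  have cf: "coeff (p \<gamma>) m = of_nat (card {xs \<in> coarsenings \<gamma>. w xs = m})"
    if "composition \<gamma>" "\<gamma> \<noteq> []" for \<gamma> m
  proof -
    have "coeff (p \<gamma>) m = (\<Sum>xs\<in>coarsenings \<gamma>. if w xs = m then 1 else 0)"
      by (simp add: p_def coeff_sum)
    then show ?thesis by (simp add: sum.If_cases[OF finite_coarsenings[OF that]] Int_def)
  qed
  have W: "card {xs \<in> coarsenings \<alpha>. w xs = m} = card {xs \<in> coarsenings \<beta>. w xs = m}" for m
    using cf[OF a, of m] cf[OF b, of m] unfolding pp by simp
  have C: "length xs < B" "\<forall>x\<in>set xs. x < B" if "xs \<in> coarsenings \<alpha> \<union> coarsenings \<beta>" for xs
  proof -
    have *: "composition xs" "sum_list xs = n" using that sum by (auto simp: coarsenings_def n_def)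
    show "length xs < B" using composition_length_le[OF *(1)] *(2) by (simp add: B_def)
    show "\<forall>x\<in>set xs. x < B" using member_le_sum_list[of _ xs] *(2) by (auto simp: B_def less_Suc_eq_le)
  qed
  show ?thesis
  proof (cases "\<exists>ys\<in>coarsenings \<alpha> \<union> coarsenings \<beta>. mset ys = X")
    case True
    then obtain ys where ys: "ys \<in> coarsenings \<alpha> \<union> coarsenings \<beta>" "mset ys = X" by blast
    have iff: "mset xs = X \<longleftrightarrow> w xs = w ys" if "xs \<in> coarsenings \<alpha> \<union> coarsenings \<beta>" for xs
    proof
      assume "mset xs = X"
      then show "w xs = w ys" using ys(2) unfolding w_def
        by (metis mset_map sum_mset_sum_list)
    next
      assume "w xs = w ys"
      then show "mset xs = X"
        using mset_eq_if_power_sums_eq[of xs B ys B] C[OF that] C[OF ys(1)] ys(2) by (auto simp: w_def)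
    qed
    have "{xs \<in> coarsenings \<alpha>. mset xs = X} = {xs \<in> coarsenings \<alpha>. w xs = w ys}"
      "{xs \<in> coarsenings \<beta>. mset xs = X} = {xs \<in> coarsenings \<beta>. w xs = w ys}" using iff by auto
    then show ?thesis using W by simp
  next
    case False
    then have "{xs \<in> coarsenings \<alpha>. mset xs = X} = {xs \<in> coarsenings \<beta>. mset xs = X}" by blast
    then show ?thesis by (rule arg_cong)
  qed
qed

text \<open>The periodic extension of the cuts; for a composition, the multiples of its size get the
  value \<open>False\<close>.\<close>

definition position_seq :: "nat list \<Rightarrow> int \<Rightarrow> bool" where
  "position_seq \<gamma> i \<longleftrightarrow> nat (i mod int (sum_list \<gamma>)) \<in> composition_set \<gamma>"

lemma position_seq_nat: "i < sum_list \<gamma> \<Longrightarrow> position_seq \<gamma> (int i) \<longleftrightarrow> i \<in> composition_set \<gamma>"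
  by (simp add: position_seq_def flip: zmod_int)

text \<open>A list of type \<open>X\<close> is a coarsening exactly if its proper partial sums are
  cuts of \<open>\<gamma>\<close>; the bijection merely changes the number type.\<close>

lemma acount_coarsenings:
  assumes c: "composition \<gamma>" and X: "\<forall>x\<in>#X. 0 < x" "sum_mset X = int (sum_list \<gamma>)"
  shows "acount (position_seq \<gamma>) 0 X = card {xs \<in> coarsenings \<gamma>. mset xs = image_mset nat X}"
  unfolding acount_def
proof (rule bij_betw_same_card[OF bij_betw_byWitness[where f' = "map int"]])
  let ?n = "sum_list \<gamma>"
  have int_nat_map: "map int (map nat xs) = xs" if "mset xs = X" for xs
    using that X(1) by (auto intro!: map_idI less_imp_le)
  have si: "sum_list (map int ys) = int (sum_list ys)" for ys by (induction ys) auto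
  show "\<forall>xs\<in>arrangements (position_seq \<gamma>) 0 X. map int (map nat xs) = xs"
    using int_nat_map by (auto simp: arrangements_def)
  show "\<forall>ys\<in>{xs \<in> coarsenings \<gamma>. mset xs = image_mset nat X}. map nat (map int ys) = ys"
    by (auto intro!: map_idI)
  show "map nat ` arrangements (position_seq \<gamma>) 0 X \<subseteq> {xs \<in> coarsenings \<gamma>. mset xs = image_mset nat X}"
  proof (rule image_subsetI)
    fix xs assume xs: "xs \<in> arrangements (position_seq \<gamma>) 0 X"
    then have m: "mset xs = X" by (simp add: arrangements_def)
    define ys where "ys = map nat xs"
    have xy: "xs = map int ys" using int_nat_map[OF m] by (simp add: ys_def)
    have pos: "composition ys" using X(1) m by (auto simp: composition_def ys_def)
    have sum: "sum_list ys = ?n" using X(2) m si[of ys] xy by (metis of_nat_eq_iff sum_mset_sum_list)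
    have "composition_set ys \<subseteq> composition_set \<gamma>"
    proof
      fix s assume s: "s \<in> composition_set ys"
      then obtain i where i: "s = sum_list (take i ys)" "1 \<le> i" "i < length ys"
        by (auto simp: composition_set_def)
      have e: "sum_list (take i xs) = int s" by (simp add: xy take_map si i(1))
      have "position_seq \<gamma> (0 + sum_list (take i xs))"
        using xs i(2,3) unfolding arrangements_def xy by simp
      then have "position_seq \<gamma> (int s)" unfolding e by simp
      then show "s \<in> composition_set \<gamma>"
        using position_seq_nat composition_set_bounds(2)[OF pos s] sum by simp
    qed
    then show "map nat xs \<in> {xs \<in> coarsenings \<gamma>. mset xs = image_mset nat X}"
      using pos sum m by (simp add: coarsenings_def ys_def)
  qed
  show "map int ` {xs \<in> coarsenings \<gamma>. mset xs = image_mset nat X} \<subseteq> arrangements (position_seq \<gamma>) 0 X"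
  proof (rule image_subsetI)
    fix ys assume "ys \<in> {xs \<in> coarsenings \<gamma>. mset xs = image_mset nat X}"
    then have ys: "composition ys" "sum_list ys = ?n" "composition_set ys \<subseteq> composition_set \<gamma>"
      "mset ys = image_mset nat X" by (auto simp: coarsenings_def)
    have "image_mset int (image_mset nat X) = image_mset id X"
      unfolding multiset.map_comp using X(1) by (intro image_mset_cong) auto
    then have m: "mset (map int ys) = X" using ys(4) by simp
    have "position_seq \<gamma> (sum_list (take i (map int ys)))" if i: "0 < i" "i < length ys" for i
    proof -
      have s: "sum_list (take i ys) \<in> composition_set ys"
        using i by (auto simp: composition_set_def)
      then have "position_seq \<gamma> (int (sum_list (take i ys)))"
        using position_seq_nat composition_set_bounds(2)[OF ys(1) s] ys(2,3) by auto
      then show ?thesis by (simp add: take_map si)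
    qed
    then show "map int ys \<in> arrangements (position_seq \<gamma>) 0 X" using m by (simp add: arrangements_def)
  qed
qed

lemma position_seq_rev:
  assumes "composition \<gamma>" shows "position_seq (rev \<gamma>) i = position_seq \<gamma> (- i)"
proof (cases "\<gamma> = []")
  case False
  let ?n = "sum_list \<gamma>"
  have n: "0 < ?n" using composition_sum_pos[OF assms False] .
  define r where "r = nat (i mod int ?n)"
  have r: "int r = i mod int ?n" "r < ?n"
    using n pos_mod_sign[of "int ?n" i] pos_mod_bound[of "int ?n" i] by (auto simp: r_def nat_less_iff)
  show ?thesis
  proof (cases "r = 0")
    case True
    then have "(- i) mod int ?n = 0" using r by (simp add: zmod_zminus1_eq_if)
    then show ?thesis using True composition_set_bounds(1)[OF assms, of 0]
        composition_set_bounds(1)[of "rev \<gamma>" 0] assms by (auto simp: position_seq_def r_def)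
  next
    case F: False
    then have "(- i) mod int ?n = int (?n - r)" using r by (simp add: zmod_zminus1_eq_if)
    then have 1: "position_seq \<gamma> (- i) \<longleftrightarrow> ?n - r \<in> composition_set \<gamma>" by (simp add: position_seq_def)
    have 2: "position_seq (rev \<gamma>) i \<longleftrightarrow> r \<in> (\<lambda>i. ?n - i) ` composition_set \<gamma>"
      by (simp add: position_seq_def composition_set_rev[OF assms] r_def)
    have "r \<in> (\<lambda>i. ?n - i) ` composition_set \<gamma> \<longleftrightarrow> ?n - r \<in> composition_set \<gamma>"
      using r(2) composition_set_bounds[OF assms]
        by (auto simp: image_iff) (metis diff_diff_cancel less_imp_le)+
    then show ?thesis using 1 2 by simp
  qed
qed (simp add: position_seq_def)

lemma position_seq_inject:
  assumes "composition \<gamma>" "composition \<delta>" "sum_list \<gamma> = sum_list \<delta>"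
    "\<And>i. \<not> int (sum_list \<gamma>) dvd i \<Longrightarrow> position_seq \<gamma> i = position_seq \<delta> i"
  shows "\<gamma> = \<delta>"
proof (rule composition_set_inject[OF assms(1-3)])
  have "i \<in> composition_set \<gamma> \<longleftrightarrow> i \<in> composition_set \<delta>" for i
  proof (cases "0 < i \<and> i < sum_list \<gamma>")
    case True
    then have "\<not> int (sum_list \<gamma>) dvd int i" using nat_dvd_not_less by simp
    from assms(4)[OF this] show ?thesis using True position_seq_nat assms(3) by simp
  next
    case False
    then show ?thesis using composition_set_bounds assms(1-3) by metis
  qed
  then show "composition_set \<gamma> = composition_set \<delta>" by blast
qed

section \<open>Recognizing and cancelling a common right factor\<close>

lemma ribbon_cong:
  assumes "\<And>k. k \<le> sum_list a \<Longrightarrow> 0 < k \<Longrightarrow> h k = g k" "composition a"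
  shows "ribbon h a = ribbon g a"
  using assms
proof (induction h a rule: ribbon.induct)
  case (3 h k l xs)
  have "ribbon h (l # xs) = ribbon g (l # xs)" by (rule 3(1)) (use 3(3,4) in auto)
  moreover have "ribbon h ((k + l) # xs) = ribbon g ((k + l) # xs)" by (rule 3(2)) (use 3(3,4) in auto)
  ultimately show ?case using 3(3)[of k] 3(4) by simp
qed auto

text \<open>The largest index is contributed only by the coarsening with a single part, so its value
  enters linearly, with a sign as coefficient.\<close>

lemma ribbon_top:
  fixes h :: "nat \<Rightarrow> 'a::comm_ring_1"
  assumes "composition a" "a \<noteq> []"
  shows "\<exists>c. \<forall>v. ribbon (h(sum_list a := v)) a = (- 1) ^ (length a - 1) * v + c"
  using assms
proof (induction h a rule: ribbon.induct)
  case (2 h k)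
  then show ?case by (intro exI[of _ 0]) simp
next
  case (3 h k l xs)
  let ?n = "sum_list (k # l # xs)"
  have kl: "composition ((k + l) # xs)" using 3(3) by simp
  obtain c where c: "\<And>v. ribbon (h(sum_list ((k + l) # xs) := v)) ((k + l) # xs)
      = (- 1) ^ (length ((k + l) # xs) - 1) * v + c"
    using 3(2)[OF kl list.distinct(2)] by blast
  have e: "sum_list ((k + l) # xs) = ?n" by simp
  have kn: "k < ?n" using 3(3) by simp
  have rest: "ribbon (h(?n := v)) (l # xs) = ribbon h (l # xs)" for v
    by (rule ribbon_cong) (use 3(3) in auto)
  have "ribbon (h(?n := v)) (k # l # xs)
      = (- 1) ^ (length (k # l # xs) - 1) * v + (h k * ribbon h (l # xs) - c)" for v
  proof -
    have "(h(?n := v)) k = h k" by (rule fun_upd_other[OF less_imp_neq[OF kn]])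
    then show ?thesis using c[of v] unfolding e ribbon.simps(3) rest by simp
  qed
  then show ?case by blast
qed simp

text \<open>A triangular system: by \<open>ribbon_top\<close> the \<open>k\<close>th near power can
  be corrected through the value of \<open>h\<close> at its own size, which the smaller near powers
  do not involve.\<close>

lemma ribbon_near_power_surj:
  fixes y :: "nat \<Rightarrow> 'a::comm_ring_1"
  assumes "composition d" "d \<noteq> []"
  shows "\<exists>h. \<forall>k. 0 < k \<and> k \<le> N \<longrightarrow> ribbon h (near_power d k) = y k"
proof (induction N)
  case (Suc N)
  then obtain h where h: "\<And>k. 0 < k \<Longrightarrow> k \<le> N \<Longrightarrow> ribbon h (near_power d k) = y k" by blast
  let ?D = "near_power d (Suc N)"
  let ?m = "sum_list d"
  have m: "0 < ?m" using composition_sum_pos assms by blast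
  have D: "composition ?D" "?D \<noteq> []" using assms by (auto simp: composition_near_power near_power_eq_Nil)
  obtain c where c: "\<And>v. ribbon (h(sum_list ?D := v)) ?D = (- 1) ^ (length ?D - 1) * v + c"
    using ribbon_top[OF D, of h] by blast
  \<comment> \<open>The coefficient is a sign and thus its own inverse.\<close>
  define g where "g = h(sum_list ?D := (- 1) ^ (length ?D - 1) * (y (Suc N) - c))"
  have "ribbon g ?D = ((- 1) ^ (length ?D - 1) * (- 1) ^ (length ?D - 1)) * (y (Suc N) - c) + c"
    unfolding g_def c by (simp add: mult.assoc)
  also have "\<dots> = y (Suc N)" by (simp flip: power_add add: mult_2[symmetric])
  finally have 1: "ribbon g ?D = y (Suc N)" .
  have 2: "ribbon g (near_power d k) = y k" if k: "0 < k" "k \<le> N" for k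
  proof -
    have "k * ?m \<le> N * ?m" using k(2) by (rule mult_le_mono1)
    also have "\<dots> < Suc N * ?m" using m by (intro mult_less_mono1) auto
    finally have lt: "k * ?m < Suc N * ?m" .
    have "ribbon g (near_power d k) = ribbon h (near_power d k)"
      by (rule ribbon_cong) (use lt assms in \<open>auto simp: g_def composition_near_power\<close>)
    then show ?thesis using h k by simp
  qed
  show ?case
  proof (intro exI allI impI)
    fix k assume "0 < k \<and> k \<le> Suc N"
    then show "ribbon g (near_power d k) = y k" using 1 2 by (cases "k = Suc N") auto
  qed
qed simp

text \<open>Any values \<open>y\<close> arise from some \<open>h\<close> by the substitution that
  composition with \<open>d\<close> amounts to.\<close>

lemma ribbon_cancel_factor:
  fixes y :: "nat \<Rightarrow> 'a::comm_ring_1"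
  assumes A: "composition A" "A \<noteq> []" and B: "composition B" "B \<noteq> []" and sum: "sum_list A = sum_list B"
    and d: "composition d" "d \<noteq> []"
    and eq: "\<And>h :: nat \<Rightarrow> 'a. ribbon h (comp_compose A d) = ribbon h (comp_compose B d)"
  shows "ribbon y A = ribbon y B"
proof -
  obtain h where h: "\<And>k. 0 < k \<Longrightarrow> k \<le> sum_list A \<Longrightarrow> ribbon h (near_power d k) = y k"
    using ribbon_near_power_surj[OF d, of "sum_list A" y] by blast
  have "ribbon (\<lambda>k. ribbon h (near_power d k)) A = ribbon y A"
    by (rule ribbon_cong) (use h A in auto)
  moreover have "ribbon (\<lambda>k. ribbon h (near_power d k)) B = ribbon y B"
    by (rule ribbon_cong) (use h B sum in auto)
  ultimately show ?thesis using eq[of h] A B d by (simp add: ribbon_comp_compose)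
qed

text \<open>The left factor is read off from the cuts at multiples of \<open>m\<close>.\<close>

lemma periodic_decomposition:
  assumes c: "composition \<gamma>" and n: "sum_list \<gamma> = N * m" "0 < m" "0 < N"
    and d: "composition d" "d \<noteq> []" "sum_list d = m"
    and per: "\<And>i. i < N * m \<Longrightarrow> \<not> m dvd i \<Longrightarrow> i \<in> composition_set \<gamma> \<longleftrightarrow> i mod m \<in> composition_set d"
  obtains A where "composition A" "A \<noteq> []" "sum_list A = N" "\<gamma> = comp_compose A d"
proof -
  define S where "S = {j. j * m \<in> composition_set \<gamma>}"
  have "S \<subseteq> {1..<N}"
    using composition_set_bounds[OF c] n by (force simp: S_def)
  then obtain A where A: "composition A" "sum_list A = N" "composition_set A = S"
    using composition_with_set_exists by blast
  have "A \<noteq> []" using A(2) n(3) by auto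
  moreover have "\<gamma> = comp_compose A d"
  proof (rule composition_set_inject[OF c])
    show "composition (comp_compose A d)" using d by (simp add: composition_comp_compose)
    show "sum_list \<gamma> = sum_list (comp_compose A d)" using A d n by simp
    have mem: "i \<in> composition_set \<gamma> \<longleftrightarrow> i < N * m \<and>
        (if m dvd i then i div m \<in> composition_set A else i mod m \<in> composition_set d)" for i
    proof (cases "i < N * m")
      case True
      show ?thesis
      proof (cases "m dvd i")
        case dvd: True
        then have "i div m * m = i" by simp
        then show ?thesis using True dvd by (simp add: A(3) S_def)
      next
        case False
        then show ?thesis using per[OF True False] True by simp
      qed
    next
      case False
      then show ?thesis using composition_set_bounds(2)[OF c, of i] n by auto
    qed
    show "composition_set \<gamma> = composition_set (comp_compose A d)"
      by (rule set_eqI) (unfold composition_set_comp_compose[OF A(1) d(1,2)]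
        A(2) d(3) mem_Collect_eq, rule mem)
  qed
  ultimately show ?thesis using that A by blast
qed

lemma least_positive:
  fixes S :: "int set" assumes "i \<in> S" "0 < i"
  obtains q where "q \<in> S" "0 < q" "\<And>j. j \<in> S \<Longrightarrow> 0 < j \<Longrightarrow> q \<le> j"
proof -
  define q where "q = (LEAST k::nat. 0 < k \<and> int k \<in> S)"
  have ex: "\<exists>k::nat. 0 < k \<and> int k \<in> S" using assms by (intro exI[of _ "nat i"]) auto
  have "0 < q" "int q \<in> S" using LeastI_ex[OF ex] by (auto simp: q_def)
  moreover have "int q \<le> j" if "j \<in> S" "0 < j" for j
  proof -
    have "q \<le> nat j" unfolding q_def by (rule Least_le) (use that in auto)
    then show ?thesis using that by simp
  qed
  ultimately show ?thesis using that[of "int q"] by simp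
qed

lemma twins_position_seq:
  assumes "composition \<alpha>" "\<alpha> \<noteq> []" "composition \<beta>" "\<beta> \<noteq> []" "sum_list \<alpha> = sum_list \<beta>"
    and "\<And>h :: nat \<Rightarrow> complex. ribbon h \<alpha> = ribbon h \<beta>"
  shows "twins (int (sum_list \<alpha>)) (position_seq \<alpha>) (position_seq \<beta>)"
proof
  show "0 < int (sum_list \<alpha>)" using composition_sum_pos assms(1,2) by simp
  show "position_seq \<alpha> (i + int (sum_list \<alpha>)) = position_seq \<alpha> i" for i
    by (simp add: position_seq_def)
  show "position_seq \<beta> (i + int (sum_list \<alpha>)) = position_seq \<beta> i" for i
    using assms(5) by (simp add: position_seq_def)
  show "acount (position_seq \<alpha>) 0 X = acount (position_seq \<beta>) 0 X"
    if "\<forall>x\<in>#X. 0 < x" "sum_mset X = int (sum_list \<alpha>)" for X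
    using acount_coarsenings[of \<alpha> X] acount_coarsenings[of \<beta> X] coarsening_counts_eq[OF assms] that assms
    by simp
qed

lemma equiv_step:
  assumes a: "composition \<alpha>" "\<alpha> \<noteq> []" and b: "composition \<beta>" "\<beta> \<noteq> []"
    and sum: "sum_list \<alpha> = sum_list \<beta>"
    and eq: "\<And>h :: nat \<Rightarrow> complex. ribbon h \<alpha> = ribbon h \<beta>"
    and IH: "\<And>A B. sum_list A < sum_list \<alpha> \<Longrightarrow> composition A \<Longrightarrow> A \<noteq> [] \<Longrightarrow> composition B \<Longrightarrow> B \<noteq> [] \<Longrightarrow>
      sum_list A = sum_list B \<Longrightarrow> (\<And>h :: nat \<Rightarrow> complex. ribbon h A = ribbon h B) \<Longrightarrow> comp_equiv A B"
    and ord: "ordered_twins (int (sum_list \<alpha>)) (position_seq \<alpha>) (position_seq \<beta>) q x"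
  shows "comp_equiv \<alpha> \<beta>"
proof -
  interpret ordered_twins "int (sum_list \<alpha>)" "position_seq \<alpha>" "position_seq \<beta>" q x by (rule ord)
  let ?n = "sum_list \<alpha>"
  obtain d' where d': "0 < d'" "d' dvd int ?n" "\<forall>i\<in>Dm. d' dvd i" "\<not> d' dvd x"
    "\<And>i. \<not> d' dvd i \<Longrightarrow> position_seq \<alpha> (i + d') = position_seq \<alpha> i \<and> position_seq \<beta> i = position_seq \<alpha> i"
    using common_period by blast
  define m where "m = nat d'"
  have m: "int m = d'" "0 < m" using d'(1) by (auto simp: m_def)
  have "m dvd ?n" using d'(2) m(1) by (metis int_dvd_int_iff)
  then obtain N where N: "?n = N * m" by (metis dvdE mult.commute)
  have n: "0 < ?n" using composition_sum_pos[OF a] .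
  have N0: "0 < N" using N n by (metis mult_0 gr0I less_irrefl)
  \<comment> \<open>Missing \<open>x\<close> makes the period nontrivial, so the left factors are
    smaller and the induction hypothesis applies to them.\<close>
  have "m \<noteq> 1" using d'(4) m(1) by auto
  then have Nn: "N < ?n" using N N0 m(2)
    by (metis less_one linorder_neqE_nat mult.right_neutral mult_less_cancel1)
  \<comment> \<open>The common right factor consists of the cuts below \<open>m\<close>;
    \<open>\<beta>\<close> shares them, since both sequences agree off the multiples of
    \<open>m\<close>.\<close>
  have "composition_set \<alpha> \<inter> {1..<m} \<subseteq> {1..<m}" by simp
  then obtain d where d: "composition d" "sum_list d
    = m" "composition_set d = composition_set \<alpha> \<inter> {1..<m}"
    using composition_with_set_exists by blast
  have dne: "d \<noteq> []" using d(2) m(2) by auto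
  have mod: "position_seq \<alpha> (int i) = position_seq \<alpha> (int (i mod m))" if "\<not> m dvd i" for i
  proof (rule dvd_periodic[where l = d' and m = d'])
    show "\<not> d' dvd int (i mod m)" using that m(1) by (metis int_dvd_int_iff dvd_mod_iff dvd_refl)
    show "d' dvd int i - int (i mod m)" unfolding m(1)[symmetric] by (simp add: of_nat_mod)
  qed (use d'(5) in auto)
  have mn: "m \<le> ?n" using N N0 by simp
  have low: "i mod m \<in> composition_set d \<longleftrightarrow> i \<in> composition_set \<alpha>" if "i < N * m" "\<not> m dvd i" for i
  proof -
    have "0 < i mod m" "i mod m < m" using that(2) m(2) by (auto simp: mod_greater_zero_iff_not_dvd)
    then show ?thesis using mod[OF that(2)] position_seq_nat[of i \<alpha>] position_seq_nat[of "i mod m" \<alpha>] that(1) N mn d(3)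
      by auto
  qed
  obtain A where A: "composition A" "A \<noteq> []" "sum_list A = N" "\<alpha> = comp_compose A d"
    by (rule periodic_decomposition[OF a(1) N m(2) N0 d(1) dne d(2)]) (use low in auto)
  have lowb: "i mod m \<in> composition_set d \<longleftrightarrow> i \<in> composition_set \<beta>" if "i < N * m" "\<not> m dvd i" for i
  proof -
    have "\<not> d' dvd int i" using that(2) m(1) by (metis int_dvd_int_iff)
    then have "position_seq \<beta> (int i) = position_seq \<alpha> (int i)" using d'(5) by blast
    then show ?thesis using low[OF that] position_seq_nat[of i \<alpha>] position_seq_nat[of i \<beta>] that(1) N sum
      by simp
  qed
  obtain B where B: "composition B" "B \<noteq> []" "sum_list B = N" "\<beta> = comp_compose B d"
    by (rule periodic_decomposition[OF b(1) _ m(2) N0 d(1) dne d(2)]) (use lowb N sum in auto)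
  have "ribbon y A = ribbon y B" for y :: "nat \<Rightarrow> complex"
    by (rule ribbon_cancel_factor[OF A(1,2) B(1,2) _ d(1) dne]) (use A B eq in auto)
  then have "comp_equiv A B" using IH[of A B] A B Nn by simp
  then show ?thesis using comp_equiv_compose[OF _ d(1) dne] A(4) B(4) by simp
qed

theorem ribbon_eq_imp_comp_equiv:
  assumes "composition \<alpha>" "\<alpha> \<noteq> []" "composition \<beta>" "\<beta> \<noteq> []" "sum_list \<alpha> = sum_list \<beta>"
    and "\<And>h :: nat \<Rightarrow> complex. ribbon h \<alpha> = ribbon h \<beta>"
  shows "comp_equiv \<alpha> \<beta>"
  using assms
proof (induction "sum_list \<alpha>" arbitrary: \<alpha> \<beta> rule: less_induct)
  case less
  note a = less.prems(1,2) and b = less.prems(3,4) and sum = less.prems(5) and eq = less.prems(6)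
  interpret twins "int (sum_list \<alpha>)" "position_seq \<alpha>" "position_seq \<beta>"
    by (rule twins_position_seq[OF less.prems])
  define Dp where "Dp = {i \<in> D. position_seq \<beta> i = position_seq \<alpha> i}"
  consider "Dm = {}" | "Dp = {}" | i j where "i \<in> Dm" "j \<in> Dp" by blast
  then show ?case
  proof cases
    case 1
    have "\<alpha> = \<beta>"
      by (rule position_seq_inject[OF a(1) b(1) sum]) (use 1 not_D(2) in \<open>auto simp: Dm_def\<close>)
    then show ?thesis using comp_equiv_refl a by simp
  next
    case 2
    have "rev \<alpha> = \<beta>"
    proof (rule position_seq_inject)
      fix i assume i: "\<not> int (sum_list (rev \<alpha>)) dvd i"
      show "position_seq (rev \<alpha>) i = position_seq \<beta> i"
        unfolding position_seq_rev[OF a(1)]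
        using i 2 not_D[of i] D_uminus(2)[of i] by (cases "i \<in> D") (auto simp: Dp_def)
    qed (use a b sum in auto)
    then show ?thesis using comp_equiv_rev_self[OF a] by simp
  next
    case 3
    have "0 < i mod int (sum_list \<alpha>)" "i mod int (sum_list \<alpha>) \<in> Dm"
      using mod_n[of i] D_not_dvd[of i] Dm_cong[of "i mod int (sum_list \<alpha>)" i] 3(1)
        by (auto simp: Dm_def)
    then obtain q where q: "q \<in> Dm" "0 < q" "\<And>j. j \<in> Dm \<Longrightarrow> 0 < j \<Longrightarrow> q \<le> j"
      using least_positive[of _ Dm] by metis
    have "0 < j mod int (sum_list \<alpha>)" "j mod int (sum_list \<alpha>) \<in> Dp"
      using mod_n[of j] D_not_dvd[of j] D_cong[of "j mod int (sum_list \<alpha>)" j]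
        a_cong[of "j mod int (sum_list \<alpha>)" j] b_cong[of "j mod int (sum_list \<alpha>)" j] 3(2)
      by (auto simp: Dp_def)
    then obtain x where x: "x \<in> Dp" "0 < x" "\<And>j. j \<in> Dp \<Longrightarrow> 0 < j \<Longrightarrow> x \<le> j"
      using least_positive[of _ Dp] by metis
    have "x \<noteq> q" using x(1) q(1) by (auto simp: Dp_def Dm_def)
    then consider "x < q" | "q < x" by linarith
    then show ?thesis
    proof cases
      case 1
      have "ordered_twins (int (sum_list \<alpha>)) (position_seq \<alpha>) (position_seq \<beta>) q x"
        by unfold_locales (use q x 1 in \<open>auto simp: Dp_def\<close>)
      from equiv_step[OF a b sum eq less.hyps this] show ?thesis .
    next
      case 2
      \<comment> \<open>Reversing \<open>\<beta>\<close> exchanges \<open>Dm\<close> and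
        \<open>Dp\<close>: now \<open>x\<close> is the least mismatch, and \<open>q\<close> is a
        smaller position of agreement.\<close>
      have rb: "composition (rev \<beta>)" "rev \<beta> \<noteq> []" "sum_list \<alpha> = sum_list (rev \<beta>)" using b sum by auto
      have req: "ribbon h \<alpha> = ribbon h (rev \<beta>)" for h :: "nat \<Rightarrow> complex"
        using eq ribbon_rev by metis
      interpret R: twins "int (sum_list \<alpha>)" "position_seq \<alpha>" "position_seq (rev \<beta>)"
        by (rule twins_position_seq[OF a rb(1,2,3) req])
      have "R.Dm = Dp"
        unfolding R.Dm_def Dp_def position_seq_rev[OF b(1)] using D_uminus(3) by auto
      moreover have "Dm \<subseteq> D" by (auto simp: Dm_def)
      ultimately have "ordered_twins (int (sum_list \<alpha>)) (position_seq \<alpha>) (position_seq (rev \<beta>)) x q"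
        by unfold_locales (use q x 2 in auto)
      from equiv_step[OF a rb(1,2,3) req less.hyps this] have "comp_equiv \<alpha> (rev \<beta>)" .
      from comp_equiv_rev[OF this] show ?thesis by simp
    qed
  qed
qed

section \<open>Evaluation of the chromatic series at finitely many colours\<close>

definition bounded_colourings :: "nat \<Rightarrow> ('v, 'e) wgraph \<Rightarrow> ('v \<Rightarrow> nat) set" where
  "bounded_colourings M G = {\<kappa> \<in> wg_verts G \<rightarrow>\<^sub>E {1..M}.
     \<forall>e\<in>wg_edges G. \<forall>u v. wg_ends G e = {u, v} \<longrightarrow> \<kappa> u \<noteq> \<kappa> v}"

text \<open>The series evaluated at \<open>x 1\<close> up to \<open>x M\<close>, with all other
  variables zero. The ring is left open, because polynomials and complex numbers are both
  used.\<close>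

definition chrom_eval :: "(nat \<Rightarrow> 'a::comm_ring_1) \<Rightarrow> nat \<Rightarrow> ('v, 'e) wgraph \<Rightarrow> 'a" where
  "chrom_eval x M G = (\<Sum>\<kappa>\<in>bounded_colourings M G. \<Prod>v\<in>wg_verts G. x (\<kappa> v) ^ wg_weight G v)"

lemma finite_bounded_colourings: "finite (wg_verts G) \<Longrightarrow> finite (bounded_colourings M G)"
  by (rule finite_subset[of _ "wg_verts G \<rightarrow>\<^sub>E {1..M}"]) (auto simp: bounded_colourings_def finite_PiE)

lemma bounded_colourings_proper: "bounded_colourings M G \<subseteq> proper_colourings G"
  by (fastforce simp: bounded_colourings_def proper_colourings_def PiE_iff)

lemma lookup_colouring_monomial:
  "Poly_Mapping.lookup (colouring_monomial G \<kappa>) i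
    = (\<Sum>v\<in>wg_verts G. if \<kappa> v = i then wg_weight G v else 0)"
  by (simp add: colouring_monomial_def lookup_sum lookup_single when_def)

lemma keys_colouring_monomial:
  assumes "weighted_graph G"
  shows "Poly_Mapping.keys (colouring_monomial G \<kappa>) = \<kappa> ` wg_verts G"
proof -
  have fin: "finite (wg_verts G)" and pos: "\<And>v. v \<in> wg_verts G \<Longrightarrow> 0 < wg_weight G v"
    using assms by (auto simp: weighted_graph_def)
  show ?thesis
    using fin pos by (auto simp: in_keys_iff lookup_colouring_monomial sum_eq_0_iff split: if_splits)
qed

lemma bounded_colourings_of_monomial:
  assumes "weighted_graph G"
  shows "{\<kappa> \<in> bounded_colourings M G. colouring_monomial G \<kappa> = m}
    = (if Poly_Mapping.keys m \<subseteq> {1..M} then {\<kappa>. \<kappa> \<in> proper_colourings G \<and>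
      colouring_monomial G \<kappa> = m} else {})"
proof (cases "Poly_Mapping.keys m \<subseteq> {1..M}")
  case True
  have "\<kappa> \<in> bounded_colourings M G" if "\<kappa> \<in> proper_colourings G" "colouring_monomial G \<kappa> = m" for \<kappa>
  proof -
    have "\<kappa> ` wg_verts G \<subseteq> {1..M}" using True keys_colouring_monomial[OF assms, of \<kappa>] that(2) by simp
    then show ?thesis using that(1) by (auto simp: bounded_colourings_def proper_colourings_def PiE_iff)
  qed
  then show ?thesis using True bounded_colourings_proper[of M G] by auto
next
  case False
  have "colouring_monomial G \<kappa> \<noteq> m" if "\<kappa> \<in> bounded_colourings M G" for \<kappa>
  proof
    assume "colouring_monomial G \<kappa> = m"
    then have "Poly_Mapping.keys m = \<kappa> ` wg_verts G"
      using keys_colouring_monomial[OF assms, of \<kappa>] by simp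
    then show False using False that by (auto simp: bounded_colourings_def)
  qed
  then show ?thesis unfolding if_not_P[OF False] by blast
qed

lemma prod_power_colouring_monomial:
  fixes x :: "nat \<Rightarrow> 'a::comm_ring_1"
  assumes "finite (wg_verts G)" "\<kappa> ` wg_verts G \<subseteq> {1..M}"
  shows "(\<Prod>v\<in>wg_verts G. x (\<kappa> v) ^ wg_weight G v)
    = (\<Prod>i\<in>{1..M}. x i ^ Poly_Mapping.lookup (colouring_monomial G \<kappa>) i)"
proof -
  have "(\<Prod>i\<in>{1..M}. x i ^ Poly_Mapping.lookup (colouring_monomial G \<kappa>) i)
      = (\<Prod>i\<in>{1..M}. \<Prod>v\<in>wg_verts G. if \<kappa> v = i then x i ^ wg_weight G v else 1)"
    unfolding lookup_colouring_monomial power_sum by (intro prod.cong) auto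
  also have "\<dots> = (\<Prod>v\<in>wg_verts G. \<Prod>i\<in>{1..M}. if \<kappa> v = i then x i ^ wg_weight G v else 1)"
    by (rule prod.swap)
  also have "\<dots> = (\<Prod>v\<in>wg_verts G. x (\<kappa> v) ^ wg_weight G v)"
    using assms(2) by (intro prod.cong) (auto simp: image_subset_iff)
  finally show ?thesis ..
qed

text \<open>The index set \<open>S\<close> may exceed the occurring monomials, so that two graphs
  can be compared over the same set.\<close>

lemma chrom_eval_series:
  fixes x :: "nat \<Rightarrow> 'a::comm_ring_1"
  assumes G: "weighted_graph G" and S: "finite S" "colouring_monomial G ` bounded_colourings M G \<subseteq> S"
    and keys: "\<And>m. m \<in> S \<Longrightarrow> Poly_Mapping.keys m \<subseteq> {1..M}"
  shows "chrom_eval x M G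
    = (\<Sum>m\<in>S. of_int (chromatic_series G m) * (\<Prod>i\<in>{1..M}. x i ^ Poly_Mapping.lookup m i))"
proof -
  have fin: "finite (wg_verts G)" using G by (simp add: weighted_graph_def)
  define f where "f m = (\<Prod>i\<in>{1..M}. x i ^ Poly_Mapping.lookup m i)" for m :: "nat \<Rightarrow>\<^sub>0 nat"
  have "chrom_eval x M G = (\<Sum>\<kappa>\<in>bounded_colourings M G. f (colouring_monomial G \<kappa>))"
    unfolding chrom_eval_def f_def
    by (intro sum.cong refl prod_power_colouring_monomial fin) (auto simp: bounded_colourings_def)
  also have "\<dots> = (\<Sum>m\<in>S. \<Sum>\<kappa>\<in>{\<kappa> \<in> bounded_colourings M G. colouring_monomial G \<kappa> = m}. f (colouring_monomial G \<kappa>))"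
    by (rule sum.group[symmetric]) (use S fin finite_bounded_colourings in auto)
  also have "\<dots> = (\<Sum>m\<in>S. of_int (chromatic_series G m) * f m)"
  proof (rule sum.cong[OF refl])
    fix m assume m: "m \<in> S"
    have "(\<Sum>\<kappa>\<in>{\<kappa> \<in> bounded_colourings M G. colouring_monomial G \<kappa> = m}. f (colouring_monomial G \<kappa>))
        = (\<Sum>\<kappa>\<in>{\<kappa> \<in> bounded_colourings M G. colouring_monomial G \<kappa> = m}. f m)"
      by (rule sum.cong) auto
    then show "(\<Sum>\<kappa>\<in>{\<kappa> \<in> bounded_colourings M G. colouring_monomial G \<kappa> = m}. f (colouring_monomial G \<kappa>))
        = of_int (chromatic_series G m) * f m"
      using keys[OF m] by (simp add: bounded_colourings_of_monomial[OF G] chromatic_series_def)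
  qed
  finally show ?thesis by (simp add: f_def)
qed

lemma chrom_eval_eq_if_series_eq:
  fixes x :: "nat \<Rightarrow> 'a::comm_ring_1"
  assumes G: "weighted_graph G" and H: "weighted_graph H" and eq: "chromatic_series G
    = chromatic_series H"
  shows "chrom_eval x M G = chrom_eval x M H"
proof -
  define S where "S = colouring_monomial G ` bounded_colourings M G \<union>
    colouring_monomial H ` bounded_colourings M H"
  have fin: "finite S" using G H by (simp add: S_def finite_bounded_colourings weighted_graph_def)
  have keys: "Poly_Mapping.keys m \<subseteq> {1..M}" if "m \<in> S" for m
    using that by (auto simp: S_def keys_colouring_monomial[OF G] keys_colouring_monomial[OF
      H] bounded_colourings_def PiE_iff)
  show ?thesis
    using chrom_eval_series[OF G fin _ keys, of x] chrom_eval_series[OF H fin _ keys, of x] eq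
    by (simp add: S_def)
qed

text \<open>The variable \<open>x\<^sub>i\<close> in the ring of integer polynomials in countably
  many variables.\<close>

definition poly_var :: "nat \<Rightarrow> (nat \<Rightarrow>\<^sub>0 nat) \<Rightarrow>\<^sub>0 int" where
  "poly_var i = Poly_Mapping.single (Poly_Mapping.single i 1) 1"

lemma poly_var_power: "poly_var i ^ k = Poly_Mapping.single (Poly_Mapping.single i k) 1"
  by (induction k) (simp_all add: poly_var_def mult_single flip: single_add)

lemma prod_single_one:
  "finite A \<Longrightarrow> (\<Prod>v\<in>A. Poly_Mapping.single (f v) (1::int)) = Poly_Mapping.single (\<Sum>v\<in>A. f v) 1"
  by (induction A rule: finite_induct) (simp_all add: mult_single)

lemma lookup_chrom_eval_poly_var:
  assumes "finite (wg_verts G)"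
  shows "Poly_Mapping.lookup (chrom_eval poly_var M G) m
    = int (card {\<kappa> \<in> bounded_colourings M G. colouring_monomial G \<kappa> = m})"
proof -
  have "chrom_eval poly_var M G
    = (\<Sum>\<kappa>\<in>bounded_colourings M G. Poly_Mapping.single (colouring_monomial G \<kappa>) 1)"
    unfolding chrom_eval_def by (simp add: poly_var_power prod_single_one assms colouring_monomial_def)
  then have "Poly_Mapping.lookup (chrom_eval poly_var M G) m
      = (\<Sum>\<kappa>\<in>bounded_colourings M G. if colouring_monomial G \<kappa> = m then 1 else 0)"
    by (simp add: lookup_sum lookup_single when_def eq_commute[of m])
  then show ?thesis
    by (simp add: sum.If_cases[OF finite_bounded_colourings[OF assms]] Int_def)
qed

text \<open>A monomial involves finitely many variables, so finitely many colours determine its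
  coefficient. The index \<open>0\<close> is no colour.\<close>

lemma chromatic_series_lookup:
  assumes F: "weighted_graph F" and M: "\<And>i. i \<in> Poly_Mapping.keys m \<Longrightarrow> i \<le> M"
  shows "chromatic_series F m
    = (if 0 \<in> Poly_Mapping.keys m then 0 else Poly_Mapping.lookup (chrom_eval poly_var M F) m)"
proof (cases "0 \<in> Poly_Mapping.keys m")
  case True
  have "\<not> (\<kappa> \<in> proper_colourings F \<and> colouring_monomial F \<kappa> = m)" for \<kappa>
    using True keys_colouring_monomial[OF F, of \<kappa>] by (fastforce simp: proper_colourings_def PiE_iff)
  then have "{\<kappa>. \<kappa> \<in> proper_colourings F \<and> colouring_monomial F \<kappa> = m} = {}" by blast
  then show ?thesis unfolding if_P[OF True] by (simp only: chromatic_series_def sum.empty)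
next
  case False
  then have keys: "Poly_Mapping.keys m \<subseteq> {1..M}" using M by (auto simp: Suc_le_eq intro: gr0I)
  have "finite (wg_verts F)" using F by (simp add: weighted_graph_def)
  then show ?thesis
    using False keys by (simp add: lookup_chrom_eval_poly_var bounded_colourings_of_monomial[OF
      F] chromatic_series_def)
qed

lemma series_eq_if_chrom_eval_eq:
  assumes G: "weighted_graph G" and H: "weighted_graph H"
    and eq: "\<And>M. chrom_eval poly_var M G = chrom_eval poly_var M H"
  shows "chromatic_series G = chromatic_series H"
proof
  fix m :: x_monomial
  obtain M where M: "\<And>i. i \<in> Poly_Mapping.keys m \<Longrightarrow> i \<le> M"
    using finite_nat_set_iff_bounded_le[of "Poly_Mapping.keys m"] by auto
  show "chromatic_series G m = chromatic_series H m"
    using chromatic_series_lookup[OF G M] chromatic_series_lookup[OF H M] eq by simp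
qed

section \<open>Colourings of contractions and of chains of copies\<close>

lemma contraction_rel_sym: "(u, v) \<in> contraction_rel G S \<Longrightarrow> (v, u) \<in> contraction_rel G S"
proof -
  have "sym (wg_adjacency G S)" by (auto simp: sym_def wg_adjacency_def insert_commute)
  then show "(u, v) \<in> contraction_rel G S \<Longrightarrow> (v, u) \<in> contraction_rel G S"
    unfolding contraction_rel_def by (meson sym_rtrancl symD)
qed

lemma contraction_rel_trans:
  "(u, v) \<in> contraction_rel G S \<Longrightarrow> (v, w) \<in> contraction_rel G S \<Longrightarrow> (u, w) \<in> contraction_rel G S"
  unfolding contraction_rel_def by (rule rtrancl_trans)

lemma contraction_class_eq_iff:
  "contraction_rel G S `` {u} = contraction_rel G S `` {v} \<longleftrightarrow> (u, v) \<in> contraction_rel G S"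
proof
  assume "contraction_rel G S `` {u} = contraction_rel G S `` {v}"
  moreover have "v \<in> contraction_rel G S `` {v}" by (simp add: contraction_rel_def)
  ultimately show "(u, v) \<in> contraction_rel G S" by blast
next
  assume "(u, v) \<in> contraction_rel G S"
  then show "contraction_rel G S `` {u} = contraction_rel G S `` {v}"
    using contraction_rel_sym contraction_rel_trans
      by (metis (no_types, opaque_lifting) Image_singleton_iff subsetI subset_antisym)
qed

lemma weighted_graph_ends:
  assumes "weighted_graph G" "e \<in> wg_edges G" "wg_ends G e = {u, v}"
  shows "u \<in> wg_verts G" "v \<in> wg_verts G"
  using assms unfolding weighted_graph_def by (metis doubleton_eq_iff)+

lemma contraction_rel_verts:
  assumes "weighted_graph G" "S \<subseteq> wg_edges G" "(u, v) \<in> contraction_rel G S" "u \<in> wg_verts G"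
  shows "v \<in> wg_verts G"
  using assms(3,4) unfolding contraction_rel_def
proof (induction rule: rtrancl_induct)
  case (step y z)
  then show ?case using weighted_graph_ends[OF assms(1)] assms(2) by (auto simp: wg_adjacency_def)
qed

lemma quotient_contraction:
  "wg_verts G // contraction_rel G S = (\<lambda>v. contraction_rel G S `` {v}) ` wg_verts G"
  by (auto simp: quotient_def)

lemma class_fibre:
  assumes "weighted_graph G" "S \<subseteq> wg_edges G" "C \<in> wg_verts G // contraction_rel G S"
  shows "{v \<in> wg_verts G. contraction_rel G S `` {v} = C} = C"
proof -
  obtain u where u: "u \<in> wg_verts G" "C = contraction_rel G S `` {u}"
    using assms(3) by (auto simp: quotient_contraction)
  have "v \<in> wg_verts G \<and> contraction_rel G S `` {v} = C \<longleftrightarrow> v \<in> C" for v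
    unfolding u(2) contraction_class_eq_iff
    using contraction_rel_verts[OF assms(1,2) _ u(1)] contraction_rel_sym[of
      v u G S] contraction_rel_sym[of u v G S]
    by auto
  then show ?thesis by blast
qed

text \<open>A map on the classes generated by \<open>S\<close> amounts to a map on the vertices that
  is constant along \<open>S\<close>, and the weight of a class is the total of its members.\<close>

lemma chrom_eval_contract_edges:
  fixes x :: "nat \<Rightarrow> 'a::comm_ring_1"
  assumes G: "weighted_graph G" and S: "S \<subseteq> wg_edges G"
  shows "chrom_eval x M (contract_edges G S) =
    (\<Sum>\<kappa> | \<kappa> \<in> wg_verts G \<rightarrow>\<^sub>E {1..M} \<and>
        (\<forall>e\<in>wg_edges G - S. \<forall>u v. wg_ends G e = {u, v} \<longrightarrow> \<kappa> u \<noteq> \<kappa> v) \<and>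
        (\<forall>e\<in>S. \<forall>u v. wg_ends G e = {u, v} \<longrightarrow> \<kappa> u = \<kappa> v).
      \<Prod>v\<in>wg_verts G. x (\<kappa> v) ^ wg_weight G v)"
proof -
  let ?V = "wg_verts G"
  define cls where "cls v = contraction_rel G S `` {v}" for v
  define Q where "Q = ?V // contraction_rel G S"
  have Q: "Q = cls ` ?V" by (auto simp: Q_def quotient_contraction cls_def)
  have fin: "finite ?V" using G by (simp add: weighted_graph_def)
  define K where "K = {\<kappa>. \<kappa> \<in> ?V \<rightarrow>\<^sub>E {1..M} \<and>
        (\<forall>e\<in>wg_edges G - S. \<forall>u v. wg_ends G e = {u, v} \<longrightarrow> \<kappa> u \<noteq> \<kappa> v) \<and>
        (\<forall>e\<in>S. \<forall>u v. wg_ends G e = {u, v} \<longrightarrow> \<kappa> u = \<kappa> v)}"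
  have ver: "wg_verts (contract_edges G S) = Q" "wg_edges (contract_edges G S) = wg_edges G - S"
    "wg_ends (contract_edges G S) e = cls ` wg_ends G e"
    "wg_weight (contract_edges G S) C = (\<Sum>v\<in>C. wg_weight G v)" for e C
    by (auto simp: contract_edges_def Q_def cls_def)
  have const: "\<kappa> u = \<kappa> v" if k: "\<kappa> \<in> K" and uv: "cls u = cls v" for \<kappa> u v
  proof -
    have "(u, v) \<in> (wg_adjacency G S)\<^sup>*"
      using uv unfolding cls_def contraction_class_eq_iff by (simp add: contraction_rel_def)
    then show ?thesis
    proof (induction rule: rtrancl_induct)
      case (step y z)
      then show ?case using k unfolding K_def wg_adjacency_def by auto
    qed simp
  qed
  define up where "up \<kappa>' = restrict (\<lambda>v. \<kappa>' (cls v)) ?V" for \<kappa>' :: "_ \<Rightarrow> nat"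
  define down where "down \<kappa> = restrict (\<lambda>C. the_elem (\<kappa> ` C)) Q" for \<kappa> :: "_ \<Rightarrow> nat"
  have down: "down \<kappa> (cls v) = \<kappa> v" if k: "\<kappa> \<in> K" and v: "v \<in> ?V" for \<kappa> v
  proof -
    have "\<kappa> ` cls v = {\<kappa> v}"
    proof -
      have "\<kappa> ` cls v = (\<lambda>_. \<kappa> v) ` cls v"
      proof (rule image_cong[OF refl])
        fix u assume "u \<in> cls v"
        then have "cls v = cls u" unfolding cls_def contraction_class_eq_iff by simp
        from const[OF k this] show "\<kappa> u = \<kappa> v" ..
      qed
      moreover have "v \<in> cls v" by (simp add: cls_def contraction_rel_def)
      then have "cls v \<noteq> {}" by blast
      ultimately show ?thesis by (simp only: image_constant_conv if_False)
    qed
    then show ?thesis using v by (simp add: down_def Q)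
  qed
  have "chrom_eval x M (contract_edges G S)
      = (\<Sum>\<kappa>'\<in>bounded_colourings M (contract_edges G S). \<Prod>C\<in>Q. x (\<kappa>' C) ^ (\<Sum>v\<in>C. wg_weight G v))"
    by (simp add: chrom_eval_def ver)
  also have "\<dots> = (\<Sum>\<kappa>\<in>K. \<Prod>v\<in>?V. x (\<kappa> v) ^ wg_weight G v)"
  proof (rule sum.reindex_bij_witness[where i = down and j = up])
    fix \<kappa>' assume k': "\<kappa>' \<in> bounded_colourings M (contract_edges G S)"
    then have k'E: "\<kappa>' \<in> Q \<rightarrow>\<^sub>E {1..M}" by (simp add: bounded_colourings_def ver)
    have upv: "up \<kappa>' v = \<kappa>' (cls v)" if "v \<in> ?V" for v using that by (simp add: up_def)
    show upK: "up \<kappa>' \<in> K"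
      unfolding K_def
    proof (intro CollectI conjI ballI allI impI)
      show "up \<kappa>' \<in> ?V \<rightarrow>\<^sub>E {1..M}" using k'E by (auto simp: up_def Q PiE_iff)
    next
      fix e u v assume e: "e \<in> wg_edges G - S" "wg_ends G e = {u, v}"
      have "wg_ends (contract_edges G S) e = {cls u, cls v}" using e by (simp add: ver)
      then have "\<kappa>' (cls u) \<noteq> \<kappa>' (cls v)" using k' e(1) by (simp add: bounded_colourings_def ver)
      then show "up \<kappa>' u \<noteq> up \<kappa>' v" using weighted_graph_ends[OF G _ e(2)] e(1) upv by auto
    next
      fix e u v assume e: "e \<in> S" "wg_ends G e = {u, v}"
      then have "(u, v) \<in> contraction_rel G S" by (auto simp: contraction_rel_def wg_adjacency_def)
      then have "cls u = cls v" by (simp add: cls_def contraction_class_eq_iff)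
      then show "up \<kappa>' u = up \<kappa>' v" using weighted_graph_ends[OF G _ e(2)] e(1) S upv by auto
    qed
    show "down (up \<kappa>') = \<kappa>'"
    proof
      fix C show "down (up \<kappa>') C = \<kappa>' C"
      proof (cases "C \<in> Q")
        case True
        then obtain v where "v \<in> ?V" "C = cls v" by (auto simp: Q)
        then show ?thesis using down[OF upK] upv by simp
      next
        case False
        then show ?thesis using k'E by (auto simp: down_def PiE_iff extensional_def)
      qed
    qed
    have "(\<Prod>C\<in>Q. x (\<kappa>' C) ^ (\<Sum>v\<in>C. wg_weight G v))
        = (\<Prod>C\<in>Q. \<Prod>v\<in>{v \<in> ?V. cls v = C}. x (\<kappa>' (cls v)) ^ wg_weight G v)"
    proof (rule prod.cong[OF refl])
      fix C assume C: "C \<in> Q"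
      have e: "{v \<in> ?V. cls v = C} = C" using class_fibre[OF G S] C by (simp add: Q_def cls_def)
      have "(\<Prod>v\<in>{v \<in> ?V. cls v = C}. x (\<kappa>' (cls v)) ^ wg_weight G v)
          = (\<Prod>v\<in>{v \<in> ?V. cls v = C}. x (\<kappa>' C) ^ wg_weight G v)"
        by (rule prod.cong) auto
      then show "x (\<kappa>' C) ^ (\<Sum>v\<in>C. wg_weight G v)
          = (\<Prod>v\<in>{v \<in> ?V. cls v = C}. x (\<kappa>' (cls v)) ^ wg_weight G v)"
        by (simp add: e power_sum)
    qed
    also have "\<dots> = (\<Prod>v\<in>?V. x (\<kappa>' (cls v)) ^ wg_weight G v)"
      by (rule prod.group) (use fin Q in auto)
    also have "\<dots> = (\<Prod>v\<in>?V. x (up \<kappa>' v) ^ wg_weight G v)"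
      by (rule prod.cong) (auto simp: upv)
    finally show "(\<Prod>v\<in>?V. x (up \<kappa>' v) ^ wg_weight G v) = (\<Prod>C\<in>Q. x (\<kappa>' C) ^ (\<Sum>v\<in>C. wg_weight G v))" ..
  next
    fix \<kappa> assume k: "\<kappa> \<in> K"
    then have kE: "\<kappa> \<in> ?V \<rightarrow>\<^sub>E {1..M}" by (simp add: K_def)
    show "down \<kappa> \<in> bounded_colourings M (contract_edges G S)"
      unfolding bounded_colourings_def ver
    proof (intro CollectI conjI ballI allI impI)
      show "down \<kappa> \<in> Q \<rightarrow>\<^sub>E {1..M}"
      proof (rule PiE_I)
        fix C assume "C \<in> Q"
        then obtain v where "v \<in> ?V" "C = cls v" by (auto simp: Q)
        then show "down \<kappa> C \<in> {1..M}" using down[OF k] kE by (auto simp: PiE_iff)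
      qed (simp add: down_def)
    next
      fix e C D assume e: "e \<in> wg_edges G - S" "cls ` wg_ends G e = {C, D}"
      obtain u v where uv: "wg_ends G e = {u, v}" using G e(1) by (auto simp: weighted_graph_def)
      have "u \<in> ?V" "v \<in> ?V" using weighted_graph_ends[OF G _ uv] e(1) by auto
      moreover have "\<kappa> u \<noteq> \<kappa> v" using k e(1) uv by (simp add: K_def)
      moreover have "{cls u, cls v} = {C, D}" using e(2) uv by simp
      ultimately show "down \<kappa> C \<noteq> down \<kappa> D"
        using down[OF k] by (auto simp: doubleton_eq_iff)
    qed
    show "up (down \<kappa>) = \<kappa>"
    proof
      fix v show "up (down \<kappa>) v = \<kappa> v"
        using down[OF k, of v] kE by (cases "v \<in> ?V") (auto simp: up_def PiE_iff extensional_def)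
    qed
  qed
  finally show ?thesis by (simp add: K_def)
qed

text \<open>Links in \<open>A\<close> are kept and the others contracted. Working on the vertices of
  the uncontracted chain makes different sets \<open>A\<close> comparable.\<close>

definition chain_colourings :: "nat \<Rightarrow> ('v, 'e) wgraph \<Rightarrow> 'v \<Rightarrow> 'v \<Rightarrow> nat \<Rightarrow> nat set \<Rightarrow> (nat \<times> 'v \<Rightarrow> nat) set" where
  "chain_colourings M G a z n A = {\<kappa> \<in> ({1..n} \<times> wg_verts G) \<rightarrow>\<^sub>E {1..M}.
     (\<forall>i\<in>{1..n}. \<forall>e\<in>wg_edges G. \<forall>u v. wg_ends G e = {u, v} \<longrightarrow> \<kappa> (i, u) \<noteq> \<kappa> (i, v)) \<and>
     (\<forall>i\<in>{1..n - 1}. if i \<in> A then \<kappa> (i, z) \<noteq> \<kappa> (i + 1, a) else \<kappa> (i, z) = \<kappa> (i + 1, a))}"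

definition chain_eval :: "(nat \<Rightarrow> 'r::comm_ring_1) \<Rightarrow> nat \<Rightarrow> ('v, 'e) wgraph \<Rightarrow> 'v \<Rightarrow> 'v \<Rightarrow> nat \<Rightarrow> nat set \<Rightarrow> 'r" where
  "chain_eval x M G a z n A =
     (\<Sum>\<kappa>\<in>chain_colourings M G a z n A. \<Prod>i\<in>{1..n}. \<Prod>v\<in>wg_verts G. x (\<kappa> (i, v)) ^ wg_weight G v)"

lemma weighted_graph_chain:
  assumes G: "weighted_graph G" and az: "a \<in> wg_verts G" "z \<in> wg_verts G"
  shows "weighted_graph (chain_of_copies n G a z)"
  unfolding weighted_graph_def
proof (intro conjI ballI)
  have fin: "finite (wg_verts G)" "finite (wg_edges G)" using G by (auto simp: weighted_graph_def)
  show "finite (wg_verts (chain_of_copies n G a z))" "finite (wg_edges (chain_of_copies n G a z))"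
    using fin by (auto simp: chain_of_copies_def)
  show "0 < wg_weight (chain_of_copies n G a z) v" if "v \<in> wg_verts (chain_of_copies n G a z)" for v
    using that G by (auto simp: chain_of_copies_def weighted_graph_def)
  fix f assume f: "f \<in> wg_edges (chain_of_copies n G a z)"
  then consider i e where "f = Inl (i, e)" "i \<in> {1..n}" "e \<in> wg_edges G" | i where "f = Inr i" "i \<in> {1..n - 1}"
    by (auto simp: chain_of_copies_def)
  then show "\<exists>u\<in>wg_verts (chain_of_copies n G a z). \<exists>v\<in>wg_verts (chain_of_copies n G a z).
      wg_ends (chain_of_copies n G a z) f = {u, v}"
  proof cases
    case 1
    obtain u v where "u \<in> wg_verts G" "v \<in> wg_verts G" "wg_ends G e = {u, v}"
      using G 1(3) by (auto simp: weighted_graph_def)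
    then show ?thesis using 1
      by (intro bexI[of _ "(i, u)"] bexI[of _ "(i, v)"]) (auto simp: chain_of_copies_def)
  next
    case 2
    then show ?thesis using az
      by (intro bexI[of _ "(i, z)"] bexI[of _ "(i + 1, a)"]) (auto simp: chain_of_copies_def)
  qed
qed

lemma complement_edges:
  assumes "composition \<alpha>"
  shows "Inr ` composition_set (composition_complement \<alpha>) \<subseteq> wg_edges (chain_of_copies (sum_list \<alpha>) G a z)"
  using composition_complement(3)[OF assms] by (auto simp: chain_of_copies_def)

lemma chrom_eval_comp_graph:
  assumes G: "weighted_graph G" and az: "a \<in> wg_verts G" "z \<in> wg_verts G" and c: "composition \<alpha>"
  shows "chrom_eval x M (comp_graph \<alpha> G a z) = chain_eval x M G a z (sum_list \<alpha>) (composition_set \<alpha>)"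
proof -
  let ?n = "sum_list \<alpha>" and ?A = "composition_set \<alpha>"
  let ?H = "chain_of_copies ?n G a z"
  let ?S = "Inr ` composition_set (composition_complement \<alpha>) :: (nat \<times> 'b + nat) set"
  have sub: "?A \<subseteq> {1..?n - 1}" using composition_set_bounds[OF c] by fastforce
  have cs: "composition_set (composition_complement \<alpha>) = {1..?n - 1} - ?A"
    using composition_complement(3)[OF c] .
  have V: "wg_verts ?H = {1..?n} \<times> wg_verts G" by (simp add: chain_of_copies_def)
  have E: "wg_edges ?H - ?S = Inl ` ({1..?n} \<times> wg_edges G) \<union> Inr ` ?A"
    using sub unfolding cs by (auto simp: chain_of_copies_def)
  have ends: "wg_ends ?H (Inl (i, e)) = Pair i ` wg_ends G e" "wg_ends ?H (Inr i) = {(i, z), (i + 1, a)}"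
    for i e
    by (auto simp: chain_of_copies_def)
  have copy: "(\<forall>u v. Pair i ` wg_ends G e = {u, v} \<longrightarrow> \<kappa> u \<noteq> \<kappa> v) \<longleftrightarrow>
      (\<forall>u v. wg_ends G e = {u, v} \<longrightarrow> \<kappa> (i, u) \<noteq> \<kappa> (i, v))" (is "?P \<longleftrightarrow> ?R")
    if e: "e \<in> wg_edges G" for i e and \<kappa> :: "nat \<times> 'a \<Rightarrow> nat"
  proof
    assume P: ?P
    show ?R
    proof (intro allI impI)
      fix u v assume "wg_ends G e = {u, v}"
      then have "Pair i ` wg_ends G e = {(i, u), (i, v)}" by simp
      then show "\<kappa> (i, u) \<noteq> \<kappa> (i, v)" using P by blast
    qed
  next
    assume R: ?R
    obtain u v where uv: "wg_ends G e = {u, v}" using G e by (auto simp: weighted_graph_def)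
    then have "\<kappa> (i, u) \<noteq> \<kappa> (i, v)" using R by blast
    then show ?P unfolding uv by (auto simp: doubleton_eq_iff)
  qed
  have link: "(\<forall>u v. {(i, z), (i + 1, a)} = {u, v} \<longrightarrow> \<kappa> u \<noteq> \<kappa> v) \<longleftrightarrow> \<kappa> (i, z) \<noteq> \<kappa> (i + 1, a)"
    "(\<forall>u v. {(i, z), (i + 1, a)} = {u, v} \<longrightarrow> \<kappa> u = \<kappa> v) \<longleftrightarrow> \<kappa> (i, z) = \<kappa> (i + 1, a)"
    for i and \<kappa> :: "nat \<times> 'a \<Rightarrow> nat" by (auto simp: doubleton_eq_iff)
  have K: "{\<kappa>. \<kappa> \<in> wg_verts ?H \<rightarrow>\<^sub>E {1..M} \<and>
        (\<forall>e\<in>wg_edges ?H - ?S. \<forall>u v. wg_ends ?H e = {u, v} \<longrightarrow> \<kappa> u \<noteq> \<kappa> v) \<and>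
        (\<forall>e\<in>?S. \<forall>u v. wg_ends ?H e = {u, v} \<longrightarrow> \<kappa> u = \<kappa> v)} = chain_colourings M G a z ?n ?A"
  proof (rule set_eqI)
    fix \<kappa> :: "nat \<times> 'a \<Rightarrow> nat"
    have 1: "(\<forall>e\<in>wg_edges ?H - ?S. \<forall>u v. wg_ends ?H e = {u, v} \<longrightarrow> \<kappa> u \<noteq> \<kappa> v) \<longleftrightarrow>
      (\<forall>i\<in>{1..?n}. \<forall>e\<in>wg_edges G. \<forall>u v. wg_ends G e = {u, v} \<longrightarrow> \<kappa> (i, u) \<noteq> \<kappa> (i, v)) \<and>
      (\<forall>i\<in>?A. \<kappa> (i, z) \<noteq> \<kappa> (i + 1, a))"
      unfolding E ball_Un ball_simps(9) ends link using copy by (auto simp: ends)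
    have 2: "(\<forall>e\<in>?S. \<forall>u v. wg_ends ?H e = {u, v} \<longrightarrow> \<kappa> u = \<kappa> v) \<longleftrightarrow>
      (\<forall>i\<in>{1..?n - 1} - ?A. \<kappa> (i, z) = \<kappa> (i + 1, a))"
      unfolding cs ball_simps(9) ends link by simp
    have 3: "(\<forall>i\<in>?A. \<kappa> (i, z) \<noteq> \<kappa> (i + 1, a)) \<and> (\<forall>i\<in>{1..?n - 1} - ?A. \<kappa> (i, z) = \<kappa> (i + 1, a)) \<longleftrightarrow>
      (\<forall>i\<in>{1..?n - 1}. if i \<in> ?A then \<kappa> (i, z) \<noteq> \<kappa> (i + 1, a) else \<kappa> (i, z) = \<kappa> (i + 1, a))"
      using sub by auto
    show "\<kappa> \<in> {\<kappa>. \<kappa> \<in> wg_verts ?H \<rightarrow>\<^sub>E {1..M} \<and>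
        (\<forall>e\<in>wg_edges ?H - ?S. \<forall>u v. wg_ends ?H e = {u, v} \<longrightarrow> \<kappa> u \<noteq> \<kappa> v) \<and>
        (\<forall>e\<in>?S. \<forall>u v. wg_ends ?H e = {u, v} \<longrightarrow> \<kappa> u = \<kappa> v)} \<longleftrightarrow> \<kappa> \<in> chain_colourings M G a z ?n ?A"
      unfolding mem_Collect_eq chain_colourings_def 1 2 using 3 by (simp only: V conj_assoc)
  qed
  have W: "(\<Prod>v\<in>wg_verts ?H. x (\<kappa> v) ^ wg_weight ?H v)
      = (\<Prod>i\<in>{1..?n}. \<Prod>v\<in>wg_verts G. x (\<kappa> (i, v)) ^ wg_weight G v)" for \<kappa>
    unfolding V by (simp add: prod.cartesian_product chain_of_copies_def case_prod_beta)
  show ?thesis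
    unfolding comp_graph_def chain_eval_def
    unfolding chrom_eval_contract_edges[OF weighted_graph_chain[OF G az] complement_edges[OF c]] K W ..
qed

lemma chain_eval_cong: "A \<inter> {1..n - 1}
  = B \<inter> {1..n - 1} \<Longrightarrow> chain_eval x M G a z n A = chain_eval x M G a z n B"
proof -
  assume "A \<inter> {1..n - 1} = B \<inter> {1..n - 1}"
  then have "i \<in> A \<longleftrightarrow> i \<in> B" if "i \<in> {1..n - 1}" for i using that by blast
  then have "chain_colourings M G a z n A = chain_colourings M G a z n B"
    unfolding chain_colourings_def by (intro Collect_cong conj_cong refl ball_cong) auto
  then show ?thesis by (simp add: chain_eval_def)
qed

text \<open>The link after copy \<open>n1\<close> is contracted in one summand and kept in the
  other. Together they leave it unconstrained, and the chain falls into two independent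
  pieces.\<close>

lemma chain_eval_split:
  fixes x :: "nat \<Rightarrow> 'r::comm_ring_1"
  assumes G: "weighted_graph G" and az: "a \<in> wg_verts G" "z \<in> wg_verts G"
    and n: "0 < n1" "0 < n2" "n1 \<notin> A"
  shows "chain_eval x M G a z (n1 + n2) A + chain_eval x M G a z (n1 + n2) (insert n1 A)
    = chain_eval x M G a z n1 A * chain_eval x M G a z n2 {j. n1 + j \<in> A}"
proof -
  let ?V = "wg_verts G"
  let ?K = "chain_colourings M G a z"
  let ?B = "{j. n1 + j \<in> A}"
  define W where "W n \<kappa> = (\<Prod>i\<in>{1..n}. \<Prod>v\<in>?V. x (\<kappa> (i, v)) ^ wg_weight G v)"
    for n and \<kappa> :: "nat \<times> 'a \<Rightarrow> nat"
  have fin: "finite ?V" using G by (simp add: weighted_graph_def)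
  have finK: "finite (?K n A)" for n A
    by (rule finite_subset[of _ "({1..n} \<times> ?V) \<rightarrow>\<^sub>E
      {1..M}"]) (auto simp: chain_colourings_def finite_PiE fin)
  define copy where "copy \<kappa> i \<longleftrightarrow> (\<forall>e\<in>wg_edges G. \<forall>u v. wg_ends G e = {u, v} \<longrightarrow> \<kappa> (i, u) \<noteq> \<kappa> (i, v))"
    for \<kappa> :: "nat \<times> 'a \<Rightarrow> nat" and i
  have copy_cong: "copy \<kappa>' i'" if "copy \<kappa> i" "\<And>v. v \<in> ?V \<Longrightarrow> \<kappa>' (i', v) = \<kappa> (i, v)" for \<kappa> \<kappa>' i i'
    unfolding copy_def
  proof (intro ballI allI impI)
    fix e u v assume e: "e \<in> wg_edges G" "wg_ends G e = {u, v}"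
    then have "\<kappa> (i, u) \<noteq> \<kappa> (i, v)" using that(1) by (auto simp: copy_def)
    then show "\<kappa>' (i', u) \<noteq> \<kappa>' (i', v)" using weighted_graph_ends[OF G e] that(2) by simp
  qed
  define link where "link \<kappa> B i \<longleftrightarrow> (if i \<in> B then \<kappa> (i, z) \<noteq> \<kappa> (i + 1, a) else \<kappa> (i, z) = \<kappa> (i + 1, a))"
    for \<kappa> :: "nat \<times> 'a \<Rightarrow> nat" and B i
  have K: "\<kappa> \<in> ?K n B \<longleftrightarrow> \<kappa> \<in> ({1..n} \<times> ?V) \<rightarrow>\<^sub>E {1..M} \<and> (\<forall>i\<in>{1..n}. copy \<kappa> i) \<and>
    (\<forall>i\<in>{1..n - 1}. link \<kappa> B i)"
    for \<kappa> n B by (simp add: chain_colourings_def copy_def link_def)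
  define F where "F = {\<kappa> \<in> ({1..n1 + n2} \<times> ?V) \<rightarrow>\<^sub>E {1..M}. (\<forall>i\<in>{1..n1 + n2}. copy \<kappa> i) \<and>
      (\<forall>i\<in>{1..n1 + n2 - 1} - {n1}. link \<kappa> A i)}"
  have n1in: "n1 \<in> {1..n1 + n2 - 1}" using n by auto
  have lk: "link \<kappa> (insert n1 A) i \<longleftrightarrow> link \<kappa> A i" if "i \<noteq> n1" for \<kappa> i using that by (simp add: link_def)
  have U: "?K (n1 + n2) A \<union> ?K (n1 + n2) (insert n1 A) = F"
  proof (rule set_eqI)
    fix \<kappa>
    have "link \<kappa> A n1 \<or> link \<kappa> (insert n1 A) n1" using n(3) by (simp add: link_def)
    moreover have "(\<forall>i\<in>{1..n1 + n2 - 1}. link \<kappa> B i) \<longleftrightarrow> link \<kappa> B n1 \<and>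
      (\<forall>i\<in>{1..n1 + n2 - 1} - {n1}. link \<kappa> B i)" for B
      using n1in by blast
    moreover have "(\<forall>i\<in>{1..n1 + n2 - 1} - {n1}. link \<kappa> (insert n1 A) i) \<longleftrightarrow> (\<forall>i\<in>{1..n1 + n2 - 1} - {n1}. link \<kappa> A i)"
      using lk by simp
    ultimately show "\<kappa> \<in> ?K (n1 + n2) A \<union> ?K (n1 + n2) (insert n1 A) \<longleftrightarrow> \<kappa> \<in> F"
      unfolding Un_iff K F_def mem_Collect_eq by blast
  qed
  have I: "?K (n1 + n2) A \<inter> ?K (n1 + n2) (insert n1 A) = {}"
  proof -
    have "\<not> (link \<kappa> A n1 \<and> link \<kappa> (insert n1 A) n1)" for \<kappa> using n(3) by (simp add: link_def)
    moreover have "link \<kappa> A n1 \<and> link \<kappa> (insert n1 A) n1"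
      if "\<kappa> \<in> ?K (n1 + n2) A \<inter> ?K (n1 + n2) (insert n1 A)" for \<kappa>
      using that n1in unfolding Int_iff K by auto
    ultimately show ?thesis by (metis equals0I)
  qed
  define join where "join = (\<lambda>(\<kappa>1, \<kappa>2). restrict (\<lambda>(i, v). if i \<le> n1 then \<kappa>1 (i, v) else \<kappa>2 (i - n1, v)) ({1..n1 + n2} \<times> ?V) :: nat \<times> 'a \<Rightarrow> nat)"
  define cut where "cut \<kappa> = (restrict \<kappa> ({1..n1} \<times> ?V), restrict (\<lambda>(i, v). \<kappa> (n1 + i, v)) ({1..n2} \<times> ?V))" for \<kappa> :: "nat \<times> 'a \<Rightarrow> nat"
  have WW: "W (n1 + n2) \<kappa> = W n1 \<kappa> * W n2 (\<lambda>(i, v). \<kappa> (n1 + i, v))" for \<kappa>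
  proof -
    have "W (n1 + n2) \<kappa> = W n1 \<kappa> * (\<Prod>i\<in>{n1 + 1..n1 + n2}. \<Prod>v\<in>?V. x (\<kappa> (i, v)) ^ wg_weight G v)"
      unfolding W_def by (rule prod.ub_add_nat) simp
    also have "(\<Prod>i\<in>{n1 + 1..n1 + n2}. \<Prod>v\<in>?V. x (\<kappa> (i, v)) ^ wg_weight G v)
      = W n2 (\<lambda>(i, v). \<kappa> (n1 + i, v))"
      using prod.shift_bounds_cl_nat_ivl[of "\<lambda>i. \<Prod>v\<in>?V. x (\<kappa> (i, v)) ^ wg_weight G v" 1 n1 n2]
      by (simp add: W_def add.commute)
    finally show ?thesis .
  qed
  have Wcong: "W n \<kappa> = W n \<kappa>'" if "\<And>i v. i \<in> {1..n} \<Longrightarrow> v \<in> ?V \<Longrightarrow> \<kappa> (i, v) = \<kappa>' (i, v)" for n \<kappa> \<kappa>'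
    unfolding W_def using that by (intro prod.cong) auto
  have "(\<Sum>\<kappa>\<in>F. W (n1 + n2) \<kappa>) = (\<Sum>(\<kappa>1, \<kappa>2)\<in>?K n1 A \<times> ?K n2 ?B. W n1 \<kappa>1 * W n2 \<kappa>2)"
  proof (rule sum.reindex_bij_witness[where i = join and j = cut])
    fix \<kappa> assume \<kappa>: "\<kappa> \<in> F"
    then have E: "\<kappa> \<in> ({1..n1 + n2} \<times> ?V) \<rightarrow>\<^sub>E {1..M}" by (simp add: F_def)
    show "join (cut \<kappa>) = \<kappa>"
    proof
      fix p show "join (cut \<kappa>) p = \<kappa> p"
      proof (cases "p \<in> {1..n1 + n2} \<times> ?V")
        case False
        then have "join (cut \<kappa>) p = undefined"
          by (simp only: join_def cut_def prod.case restrict_apply if_False)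
        then show ?thesis using PiE_arb[OF E False] by simp
      qed (auto simp: join_def cut_def)
    qed
    have c1: "fst (cut \<kappa>) (i, v) = \<kappa> (i, v)" if "i \<in> {1..n1}" "v \<in> ?V" for i v using that
      by (simp add: cut_def)
    have c2: "snd (cut \<kappa>) (i, v) = \<kappa> (n1 + i, v)" if "i \<in> {1..n2}" "v \<in> ?V" for i v using that
      by (simp add: cut_def)
    have "fst (cut \<kappa>) \<in> ?K n1 A"
      unfolding K
    proof (intro conjI ballI)
      show "fst (cut \<kappa>) \<in> ({1..n1} \<times> ?V) \<rightarrow>\<^sub>E {1..M}" using E by (auto simp: cut_def PiE_iff)
      show "copy (fst (cut \<kappa>)) i" if "i \<in> {1..n1}" for i
      proof -
        have "copy \<kappa> i" using \<kappa> that by (simp add: F_def)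
        then show ?thesis by (rule copy_cong) (use that c1 in simp)
      qed
      show "link (fst (cut \<kappa>)) A i" if "i \<in> {1..n1 - 1}" for i
      proof -
        have "link \<kappa> A i" using \<kappa> that by (auto simp: F_def)
        then show ?thesis using that az unfolding link_def by (auto simp: cut_def)
      qed
    qed
    moreover have "snd (cut \<kappa>) \<in> ?K n2 ?B"
      unfolding K
    proof (intro conjI ballI)
      show "snd (cut \<kappa>) \<in> ({1..n2} \<times> ?V) \<rightarrow>\<^sub>E {1..M}" using E by (auto simp: cut_def PiE_iff)
      show "copy (snd (cut \<kappa>)) i" if "i \<in> {1..n2}" for i
      proof -
        have "copy \<kappa> (n1 + i)" using \<kappa> that by (simp add: F_def)
        then show ?thesis by (rule copy_cong) (use that c2 in simp)
      qed
      show "link (snd (cut \<kappa>)) ?B i" if "i \<in> {1..n2 - 1}" for i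
      proof -
        have "link \<kappa> A (n1 + i)" using \<kappa> that by (auto simp: F_def)
        then show ?thesis using that az unfolding link_def by (auto simp: cut_def)
      qed
    qed
    ultimately show "cut \<kappa> \<in> ?K n1 A \<times> ?K n2 ?B" by (simp add: mem_Times_iff)
    have "W n1 (fst (cut \<kappa>)) = W n1 \<kappa>" by (rule Wcong) (use c1 in auto)
    moreover have "W n2 (snd (cut \<kappa>)) = W n2 (\<lambda>(i, v). \<kappa> (n1 + i, v))" by (rule Wcong) (use c2 in auto)
    ultimately show "(case cut \<kappa> of (\<kappa>1, \<kappa>2) \<Rightarrow> W n1 \<kappa>1 * W n2 \<kappa>2) = W (n1 + n2) \<kappa>"
      unfolding WW by (simp add: case_prod_beta)
  next
    fix p assume "p \<in> ?K n1 A \<times> ?K n2 ?B"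
    then obtain k1 k2 where p: "p = (k1, k2)" "k1 \<in> ?K n1 A" "k2 \<in> ?K n2 ?B" by auto
    have E1: "k1 \<in> ({1..n1} \<times> ?V) \<rightarrow>\<^sub>E {1..M}" and E2: "k2 \<in> ({1..n2} \<times> ?V) \<rightarrow>\<^sub>E {1..M}"
      using p(2,3) by (auto simp: K)
    have j1: "join p (i, v) = k1 (i, v)" if "i \<in> {1..n1}" "v \<in> ?V" for i v
      using that by (simp add: p(1) join_def)
    have j2: "join p (n1 + i, v) = k2 (i, v)" if "i \<in> {1..n2}" "v \<in> ?V" for i v
      using that by (simp add: p(1) join_def)
    show "cut (join p) = p"
      unfolding p(1) cut_def prod.inject
    proof (intro conjI ext)
      fix q show "restrict (join (k1, k2)) ({1..n1} \<times> ?V) q = k1 q"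
        using j1 E1 p(1) by (cases q) (auto simp: restrict_def PiE_iff extensional_def)
    next
      fix q show "restrict (\<lambda>(i, v). join (k1, k2) (n1 + i, v)) ({1..n2} \<times> ?V) q = k2 q"
        using j2 E2 p(1) by (cases q) (auto simp: restrict_def PiE_iff extensional_def)
    qed
    have range: "join p \<in> ({1..n1 + n2} \<times> ?V) \<rightarrow>\<^sub>E {1..M}"
    proof (rule PiE_I)
      fix q assume q: "q \<in> {1..n1 + n2} \<times> ?V"
      obtain i v where iv: "q = (i, v)" by (cases q)
      show "join p q \<in> {1..M}"
      proof (cases "i \<le> n1")
        case True
        then show ?thesis using q iv j1[of i v] PiE_mem[OF E1, of q] by auto
      next
        case False
        then have "i = n1 + (i - n1)" "i - n1 \<in> {1..n2}" using q iv by auto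
        then show ?thesis using q iv j2[of "i - n1" v] PiE_mem[OF E2, of "(i - n1, v)"] by auto
      qed
    qed (simp add: join_def p(1) split: prod.splits)
    have split_i: "i \<in> {1..n1} \<or> (\<exists>j\<in>{1..n2}. i = n1 + j)" if "i \<in> {1..n1 + n2}" for i
    proof (cases "i \<le> n1")
      case False
      then show ?thesis using that by (intro disjI2 bexI[of _ "i - n1"]) auto
    qed (use that in auto)
    have copy1: "copy (join p) i" if i: "i \<in> {1..n1 + n2}" for i
      using split_i[OF i]
    proof (elim disjE bexE)
      assume i: "i \<in> {1..n1}"
      then have "copy k1 i" using p(2) by (simp add: K)
      then show ?thesis by (rule copy_cong) (use i j1 in simp)
    next
      fix j assume j: "j \<in> {1..n2}" "i = n1 + j"
      then have "copy k2 j" using p(3) by (simp add: K)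
      then show ?thesis by (rule copy_cong) (use j j2 in simp)
    qed
    have link1: "link (join p) A i" if i: "i \<in> {1..n1 + n2 - 1} - {n1}" for i
    proof (cases "i < n1")
      case True
      then have "link k1 A i" using p(2) i by (auto simp: K)
      then show ?thesis using True i az by (auto simp: link_def p(1) join_def)
    next
      case False
      define j where "j = i - n1"
      have j: "i = n1 + j" "j \<in> {1..n2 - 1}" using False i by (auto simp: j_def)
      then have "link k2 ?B j" using p(3) by (auto simp: K)
      then show ?thesis using j az by (auto simp: link_def p(1) join_def)
    qed
    show "join p \<in> F" using range copy1 link1 by (simp add: F_def)
  qed
  also have "\<dots> = (\<Sum>\<kappa>\<in>?K n1 A. W n1 \<kappa>) * (\<Sum>\<kappa>\<in>?K n2 ?B. W n2 \<kappa>)"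
    by (simp add: sum_product sum.cartesian_product)
  also have "(\<Sum>\<kappa>\<in>F. W (n1 + n2) \<kappa>)
    = (\<Sum>\<kappa>\<in>?K (n1 + n2) A. W (n1 + n2) \<kappa>) + (\<Sum>\<kappa>\<in>?K (n1 + n2) (insert n1 A). W (n1 + n2) \<kappa>)"
    unfolding U[symmetric] by (rule sum.union_disjoint[OF finK finK I])
  finally show ?thesis by (simp add: chain_eval_def W_def)
qed

text \<open>Contracting the link at the joint gives the near concatenation, keeping it the
  concatenation, so \<open>chain_eval_split\<close> is the ribbon rule.\<close>

lemma chrom_eval_ribbon:
  fixes x :: "nat \<Rightarrow> 'r::comm_ring_1"
  assumes G: "weighted_graph G" and az: "a \<in> wg_verts G" "z \<in> wg_verts G"
    and \<alpha>: "composition \<alpha>" "\<alpha> \<noteq> []"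
  shows "chrom_eval x M (comp_graph \<alpha> G a z) = ribbon (\<lambda>k. chrom_eval x M (comp_graph [k] G a z)) \<alpha>"
proof -
  let ?F = "\<lambda>\<alpha>. chain_eval x M G a z (sum_list \<alpha>) (composition_set \<alpha>)"
  have F: "?F (b @ c) = ?F b * ?F c - ?F (near_concat b c)"
    if bc: "composition b" "composition c" "b \<noteq> []" "c \<noteq> []" for b c
  proof -
    let ?s = "sum_list b"
    let ?N = "composition_set (near_concat b c)"
    have N: "?N = composition_set b \<union> (+) ?s ` composition_set c"
      using composition_set_near_concat[OF bc(3,4)] .
    have bb: "0 < i" "i < ?s" if "i \<in> composition_set b"
      for i using composition_set_bounds[OF bc(1) that] .
    have cc: "0 < i" if "i \<in> composition_set c" for i using composition_set_bounds[OF bc(2) that] by simp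
    have s: "?s \<notin> ?N" using bb cc unfolding N by force
    have ins: "insert ?s ?N = composition_set (b @ c)"
      unfolding N composition_set_append[OF bc(3,4)] by auto
    have e1: "chain_eval x M G a z ?s ?N = ?F b"
      by (rule chain_eval_cong) (use bb in \<open>auto simp: N\<close>)
    have e2: "{j. ?s + j \<in> ?N} = composition_set c"
      using bb unfolding N by fastforce
    have "?F (near_concat b c) + ?F (b @ c) = ?F b * ?F c"
      using chain_eval_split[OF G az composition_sum_pos[OF bc(1,3)] composition_sum_pos[OF
        bc(2,4)] s, of x M]
      unfolding ins e1 e2 by simp
    then show ?thesis by (simp add: algebra_simps eq_diff_eq)
  qed
  have "?F \<alpha> = ribbon (\<lambda>k. ?F [k]) \<alpha>"
    by (rule ribbon_unique[where F = ?F]) (use F \<alpha> in auto)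
  also have "\<dots> = ribbon (\<lambda>k. chrom_eval x M (comp_graph [k] G a z)) \<alpha>"
    by (rule ribbon_cong) (use \<alpha> chrom_eval_comp_graph[OF G az, of "[_]" x M] in auto)
  finally show ?thesis using chrom_eval_comp_graph[OF G az \<alpha>(1), of x M] by simp
qed

section \<open>Adjoining colours with vanishing power sums\<close>

text \<open>With edges as a list of vertex pairs, contraction is a renaming that preserves the
  vertex type, unlike \<open>contract_edges\<close>, and the list length supports induction.\<close>

definition list_colourings :: "'v set \<Rightarrow> ('v \<times> 'v) list \<Rightarrow> nat set \<Rightarrow> ('v \<Rightarrow> nat) set" where
  "list_colourings V es C = {\<kappa> \<in> V \<rightarrow>\<^sub>E C. \<forall>(p, q)\<in>set es. \<kappa> p \<noteq> \<kappa> q}"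

definition list_eval :: "'v set \<Rightarrow> ('v \<Rightarrow> nat) \<Rightarrow> ('v \<times> 'v) list \<Rightarrow> nat set \<Rightarrow> (nat \<Rightarrow> 'a::comm_ring_1) \<Rightarrow> 'a" where
  "list_eval V w es C x = (\<Sum>\<kappa>\<in>list_colourings V es C. \<Prod>v\<in>V. x (\<kappa> v) ^ w v)"

definition list_connected :: "'v set \<Rightarrow> ('v \<times> 'v) list \<Rightarrow> bool" where
  "list_connected V es \<longleftrightarrow> (\<forall>u\<in>V. \<forall>v\<in>V. (u, v) \<in> (set es \<union> (set es)\<inverse>)\<^sup>*)"

definition merge_vertex :: "'v \<Rightarrow> 'v \<Rightarrow> 'v \<Rightarrow> 'v" where
  "merge_vertex u v p = (if p = v then u else p)"

definition merge_edges :: "'v \<Rightarrow> 'v \<Rightarrow> ('v \<times> 'v) list \<Rightarrow> ('v \<times> 'v) list" where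
  "merge_edges u v es = map (\<lambda>(p, q). (merge_vertex u v p, merge_vertex u v q)) es"

lemma finite_list_colourings: "finite V \<Longrightarrow> finite C \<Longrightarrow> finite (list_colourings V es C)"
  by (rule finite_subset[of _ "V \<rightarrow>\<^sub>E C"]) (auto simp: list_colourings_def finite_PiE)

lemma list_eval_Nil:
  fixes x :: "nat \<Rightarrow> 'a::comm_ring_1"
  assumes "finite V" "finite C"
  shows "list_eval V w [] C x = (\<Prod>v\<in>V. \<Sum>c\<in>C. x c ^ w v)"
  using prod_sum_PiE[OF assms(1), of "\<lambda>_. C" "\<lambda>v c. x c ^ w v"] assms(2)
  by (simp add: list_eval_def list_colourings_def)

lemma list_eval_loop: "list_eval V w ((v, v) # es) C x = 0"
  by (simp add: list_eval_def list_colourings_def)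

text \<open>Deletion and contraction: colourings with equal colours at \<open>u\<close> and
  \<open>v\<close> are those of the graph with \<open>v\<close> merged into
  \<open>u\<close>.\<close>

lemma list_eval_Cons:
  fixes x :: "nat \<Rightarrow> 'a::comm_ring_1"
  assumes fin: "finite V" "finite C" and uv: "u \<in> V" "v \<in> V" "u \<noteq> v"
    and es: "\<forall>(p, q)\<in>set es. p \<in> V \<and> q \<in> V"
  shows "list_eval V w ((u, v) # es) C x = list_eval V w es C x
     - list_eval (V - {v}) (w(u := w u + w v)) (merge_edges u v es) C x"
proof -
  let ?f = "\<lambda>\<kappa>. \<Prod>v\<in>V. x (\<kappa> v) ^ w v"
  define E where "E = {\<kappa> \<in> list_colourings V es C. \<kappa> u = \<kappa> v}"
  have un: "list_colourings V es C = list_colourings V ((u, v) # es) C \<union> E"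
    "list_colourings V ((u, v) # es) C \<inter> E = {}"
    by (auto simp: E_def list_colourings_def)
  have "(\<Sum>\<kappa>\<in>E. ?f \<kappa>) = list_eval (V - {v}) (w(u := w u + w v)) (merge_edges u v es) C x"
    unfolding list_eval_def
  proof (rule sum.reindex_bij_witness[where i = "\<lambda>\<kappa>. \<kappa>(v := \<kappa> u)" and j = "\<lambda>\<kappa>. restrict \<kappa> (V - {v})"])
    fix \<kappa> assume k: "\<kappa> \<in> E"
    then have kE: "\<kappa> \<in> V \<rightarrow>\<^sub>E C" and kuv: "\<kappa> u = \<kappa> v" and kp: "\<And>p q. (p, q) \<in> set es \<Longrightarrow> \<kappa> p \<noteq> \<kappa> q"
      by (auto simp: E_def list_colourings_def)
    show "(restrict \<kappa> (V - {v}))(v := restrict \<kappa> (V - {v}) u) = \<kappa>"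
      using kE kuv uv by (auto simp: fun_eq_iff restrict_def PiE_iff extensional_def)
    have m: "restrict \<kappa> (V - {v}) (merge_vertex u v p) = \<kappa> p" if "p \<in> V" for p
      using that uv kuv by (simp add: merge_vertex_def)
    show "restrict \<kappa> (V - {v}) \<in> list_colourings (V - {v}) (merge_edges u v es) C"
    proof -
      have "restrict \<kappa> (V - {v}) \<in> (V - {v}) \<rightarrow>\<^sub>E C" using kE by auto
      moreover have "restrict \<kappa> (V - {v}) p' \<noteq> restrict \<kappa> (V - {v}) q'"
        if e: "(p', q') \<in> set (merge_edges u v es)" for p' q'
      proof -
        obtain p q where pq: "(p, q) \<in> set es" "p' = merge_vertex u v p" "q' = merge_vertex u v q"
          using e by (auto simp: merge_edges_def)
        then have "p \<in> V" "q \<in> V" using es by auto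
        then show ?thesis using m kp[OF pq(1)] by (simp add: pq(2,3))
      qed
      ultimately show ?thesis unfolding list_colourings_def by blast
    qed
    have "(\<Prod>t\<in>V - {v}. x (restrict \<kappa> (V - {v}) t) ^ (w(u := w u + w v)) t)
        = x (\<kappa> u) ^ (w u + w v) * (\<Prod>t\<in>V - {v} - {u}. x (\<kappa> t) ^ w t)"
      using uv fin(1) by (subst prod.remove[of "V - {v}" u]) (auto intro!:
        prod.cong arg_cong2[where f = "(*)"])
    also have "\<dots> = ?f \<kappa>"
    proof -
      have "?f \<kappa> = x (\<kappa> v) ^ w v * (x (\<kappa> u) ^ w u * (\<Prod>t\<in>V - {v} - {u}. x (\<kappa> t) ^ w t))"
        using uv fin(1) by (simp add: prod.remove[of V v] prod.remove[of "V - {v}" u])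
      then show ?thesis by (simp add: kuv power_add algebra_simps)
    qed
    finally show "(\<Prod>t\<in>V - {v}. x (restrict \<kappa> (V - {v}) t) ^ (w(u := w u + w v)) t) = ?f \<kappa>" .
  next
    fix \<kappa> assume k: "\<kappa> \<in> list_colourings (V - {v}) (merge_edges u v es) C"
    then have kE: "\<kappa> \<in> (V - {v}) \<rightarrow>\<^sub>E C"
      and kp: "\<And>p q. (p, q) \<in> set es \<Longrightarrow> \<kappa> (merge_vertex u v p) \<noteq> \<kappa> (merge_vertex u v q)"
      by (auto simp: list_colourings_def merge_edges_def)
    show "restrict (\<kappa>(v := \<kappa> u)) (V - {v}) = \<kappa>"
      using kE by (auto simp: fun_eq_iff restrict_def PiE_iff extensional_def)
    have m: "(\<kappa>(v := \<kappa> u)) p = \<kappa> (merge_vertex u v p)" for p by (simp add: merge_vertex_def)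
    have "\<kappa>(v := \<kappa> u) \<in> V \<rightarrow>\<^sub>E C"
      using kE uv by (auto simp: PiE_iff extensional_def)
    moreover have "(\<kappa>(v := \<kappa> u)) p \<noteq> (\<kappa>(v := \<kappa> u)) q" if "(p, q) \<in> set es" for p q
      unfolding m by (rule kp[OF that])
    ultimately have "\<kappa>(v := \<kappa> u) \<in> list_colourings V es C" unfolding list_colourings_def by blast
    then show "\<kappa>(v := \<kappa> u) \<in> E" using uv by (simp add: E_def)
  qed
  moreover have "(\<Sum>\<kappa>\<in>list_colourings V es C. ?f \<kappa>)
    = (\<Sum>\<kappa>\<in>list_colourings V ((u, v) # es) C. ?f \<kappa>) + (\<Sum>\<kappa>\<in>E. ?f \<kappa>)"
    unfolding un(1) using un(2) finite_list_colourings[OF fin, of es] finite_list_colourings[OF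
      fin, of "(u, v) # es"]
    by (intro sum.union_disjoint) (auto simp: E_def)
  ultimately show ?thesis by (simp add: list_eval_def algebra_simps)
qed

lemma merge_path:
  assumes "(p, q) \<in> (set ((u, v) # es) \<union> (set ((u, v) # es))\<inverse>)\<^sup>*"
  shows "(merge_vertex u v p, merge_vertex u v q) \<in> (set (merge_edges u v es) \<union>
    (set (merge_edges u v es))\<inverse>)\<^sup>*"
  using assms
proof (induction rule: rtrancl_induct)
  case (step y z)
  have "merge_vertex u v y = merge_vertex u v z \<or>
    (merge_vertex u v y, merge_vertex u v z) \<in> set (merge_edges u v es) \<union> (set (merge_edges u v es))\<inverse>"
    using step.hyps(2) by (force simp: merge_edges_def merge_vertex_def)
  then show ?case using step.IH by (metis rtrancl.rtrancl_into_rtrancl)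
qed simp

text \<open>The integer \<open>c\<close> is the coefficient of the power sum of degree \<open>w(V)\<close> in the power sum expansion. Its
  sign only depends on \<open>card V\<close>, so that nothing cancels in the deletion-contraction recurrence.\<close>

lemma block_coefficient:
  assumes "finite V" "V \<noteq> {}" "\<forall>v\<in>V. 0 < w v" "\<forall>(p, q)\<in>set es. p \<in> V \<and> q \<in> V"
  shows "\<exists>c::int. 0 \<le> (- 1) ^ (card V - 1) * c \<and>
    (list_connected V es \<and> (\<forall>(p, q)\<in>set es. p \<noteq> q) \<longrightarrow> c \<noteq> 0) \<and>
    (\<forall>C B. \<forall>x :: nat \<Rightarrow> complex. finite C \<and> finite B \<and> C \<inter> B = {} \<and> (\<forall>j. 0 < j \<and>
      j < sum w V \<longrightarrow> (\<Sum>b\<in>B. x b ^ j) = 0) \<longrightarrow>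
      list_eval V w es (C \<union> B) x = list_eval V w es C x + of_int c * (\<Sum>b\<in>B. x b ^ sum w V))"
  using assms
proof (induction "length es" arbitrary: V w es)
  case 0
  then have es: "es = []" by simp
  show ?case
  proof (cases "card V = 1")
    case True
    then obtain v where v: "V = {v}" by (meson card_1_singletonE)
    show ?thesis
      by (rule exI[of _ 1]) (auto simp: es v list_eval_Nil sum.union_disjoint)
  next
    case False
    have nc: "\<not> list_connected V es"
    proof
      assume "list_connected V es"
      then have "u = v" if "u \<in> V" "v \<in> V" for u v using that by (simp add: list_connected_def es)
      then have "card V \<le> 1" using 0 by (auto simp: card_le_Suc0_iff_eq)
      then show False using False 0 by (metis One_nat_def card_gt_0_iff le_antisym Suc_leI)
    qed
    \<comment> \<open>With several vertices and no edges, each factor is a power sum of degree below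
      \<open>sum w V\<close>, which the new colours do not change; so the coefficient is
      \<open>0\<close>.\<close>
    have lt: "w v < sum w V" if v: "v \<in> V" for v
    proof -
      have "V - {v} \<noteq> {}" using False v
        by (metis card.empty card.insert finite.emptyI insert_Diff insert_absorb empty_iff One_nat_def)
      then have "0 < sum w (V - {v})" using 0 by (intro sum_pos) auto
      then show ?thesis using sum.remove[OF 0(2) v, of w] by simp
    qed
    have "list_eval V w es (C \<union> B) x = list_eval V w es C x"
      if C: "finite C" "finite B" "C \<inter> B = {}" "\<forall>j. 0 < j \<and> j < sum w V \<longrightarrow> (\<Sum>b\<in>B. x b ^ j) = 0"
      for C B and x :: "nat \<Rightarrow> complex"
    proof -
      have "(\<Sum>c\<in>C \<union> B. x c ^ w v) = (\<Sum>c\<in>C. x c ^ w v)" if "v \<in> V" for v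
        using C lt[OF that] 0(4) that by (simp add: sum.union_disjoint)
      then show ?thesis using C 0(2) by (simp add: es list_eval_Nil)
    qed
    then show ?thesis using nc by (intro exI[of _ 0]) auto
  qed
next
  case (Suc m)
  then obtain u v es' where es: "es = (u, v) # es'" "length es' = m"
    by (metis length_Suc_conv surj_pair)
  have uv: "u \<in> V" "v \<in> V" and es'V: "\<forall>(p, q)\<in>set es'. p \<in> V \<and> q \<in> V" using Suc.prems(4) es by auto
  show ?case
  proof (cases "u = v")
    case True
    then show ?thesis by (intro exI[of _ 0]) (auto simp: es list_eval_loop)
  next
    case False
    let ?V = "V - {v}" and ?w = "w(u := w u + w v)" and ?es = "merge_edges u v es'"
    have sw: "sum ?w ?V = sum w V"
    proof -
      have "sum ?w ?V = (w u + w v) + sum w (V - {v} - {u})"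
        using uv False Suc.prems(1) by (subst sum.remove[of ?V u]) (auto intro!: sum.cong)
      moreover have "sum w V = w v + (w u + sum w (V - {v} - {u}))"
        using uv False Suc.prems(1) by (simp add: sum.remove[of V v] sum.remove[of ?V u])
      ultimately show ?thesis by simp
    qed
    have cardV: "card V - 1 = Suc (card ?V - 1)"
    proof -
      have "card ?V = card V - 1" using uv by simp
      moreover have "finite ?V" "?V \<noteq> {}" using uv False Suc.prems(1) by auto
      then have "0 < card ?V" using card_gt_0_iff by blast
      ultimately show ?thesis by simp
    qed
    have IH1: "\<exists>c::int. 0 \<le> (- 1) ^ (card V - 1) * c \<and>
      (list_connected V es' \<and> (\<forall>(p, q)\<in>set es'. p \<noteq> q) \<longrightarrow> c \<noteq> 0) \<and>
      (\<forall>C B. \<forall>x :: nat \<Rightarrow> complex. finite C \<and> finite B \<and> C \<inter> B = {} \<and> (\<forall>j. 0 < j \<and>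
        j < sum w V \<longrightarrow> (\<Sum>b\<in>B. x b ^ j) = 0) \<longrightarrow>
        list_eval V w es' (C \<union> B) x = list_eval V w es' C x + of_int c * (\<Sum>b\<in>B. x b ^ sum w V))"
      by (rule Suc.hyps(1)[OF es(2)[symmetric] Suc.prems(1-3) es'V])
    then obtain c1 :: int where c1: "0 \<le> (- 1) ^ (card V - 1) * c1"
      "list_connected V es' \<and> (\<forall>(p, q)\<in>set es'. p \<noteq> q) \<longrightarrow> c1 \<noteq> 0"
      and c1': "\<forall>C B. \<forall>x :: nat \<Rightarrow> complex. finite C \<and> finite B \<and> C \<inter> B = {} \<and> (\<forall>j. 0 < j \<and>
        j < sum w V \<longrightarrow> (\<Sum>b\<in>B. x b ^ j) = 0) \<longrightarrow>
        list_eval V w es' (C \<union> B) x = list_eval V w es' C x + of_int c1 * (\<Sum>b\<in>B. x b ^ sum w V)"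
      by (elim exE conjE)
    have Vm: "finite ?V" "?V \<noteq> {}" "\<forall>v\<in>?V. 0 < ?w v" "\<forall>(p, q)\<in>set ?es. p \<in> ?V \<and> q \<in> ?V"
      using Suc.prems(1-3) uv False es'V
        by (auto simp: merge_edges_def merge_vertex_def split: if_splits)
    have lm: "m = length ?es" using es by (simp add: merge_edges_def)
    obtain c2 :: int where c2: "0 \<le> (- 1) ^ (card ?V - 1) * c2"
      "list_connected ?V ?es \<and> (\<forall>(p, q)\<in>set ?es. p \<noteq> q) \<longrightarrow> c2 \<noteq> 0"
      and c2': "\<forall>C B. \<forall>x :: nat \<Rightarrow> complex. finite C \<and> finite B \<and> C \<inter> B = {} \<and> (\<forall>j. 0 < j \<and>
        j < sum w V \<longrightarrow> (\<Sum>b\<in>B. x b ^ j) = 0) \<longrightarrow>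
        list_eval ?V ?w ?es (C \<union> B) x = list_eval ?V ?w ?es C x + of_int c2 * (\<Sum>b\<in>B. x b ^ sum w V)"
      using Suc.hyps(1)[OF lm Vm] unfolding sw by (elim exE conjE)
    have sgn: "(- 1) ^ (card V - 1) * (c1 - c2) = (- 1) ^ (card V - 1) * c1 + (- 1) ^ (card ?V - 1) * c2"
      unfolding cardV by (simp add: algebra_simps)
    show ?thesis
    proof (intro exI[of _ "c1 - c2"] conjI impI allI)
      show "0 \<le> (- 1) ^ (card V - 1) * (c1 - c2)" unfolding sgn using c1(1) c2(1) by simp
    next
      assume con: "list_connected V es \<and> (\<forall>(p, q)\<in>set es. p \<noteq> q)"
      \<comment> \<open>If a parallel edge remains, deletion preserves connectedness and
        looplessness; otherwise contraction does.\<close>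
      have "c1 \<noteq> 0 \<or> c2 \<noteq> 0"
      proof (cases "(u, v) \<in> set es' \<or> (v, u) \<in> set es'")
        case True
        then have "set es \<union> (set es)\<inverse> = set es' \<union> (set es')\<inverse>" by (auto simp: es)
        then have "list_connected V es'" using con by (simp add: list_connected_def)
        moreover have "\<forall>(p, q)\<in>set es'. p \<noteq> q" using con by (simp add: es(1))
        ultimately show ?thesis using c1(2) by blast
      next
        case F: False
        have "p' \<noteq> q'" if pq: "(p', q') \<in> set ?es" for p' q'
        proof -
          obtain p q where "(p, q) \<in> set es'" "p' = merge_vertex u v p" "q' = merge_vertex u v q"
            using pq by (auto simp: merge_edges_def)
          moreover from this(1) have "p \<noteq> q" using con by (auto simp: es)
          ultimately show ?thesis using F by (auto simp: merge_vertex_def)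
        qed
        moreover have "list_connected ?V ?es"
          unfolding list_connected_def
        proof (intro ballI)
          fix p q assume pq: "p \<in> ?V" "q \<in> ?V"
          then have "(p, q) \<in> (set es \<union> (set es)\<inverse>)\<^sup>*" using con by (simp add: list_connected_def)
          from merge_path[OF this[unfolded es(1)]] pq show "(p, q) \<in> (set ?es \<union> (set ?es)\<inverse>)\<^sup>*"
            by (simp add: merge_vertex_def)
        qed
        ultimately show ?thesis using c2(2) by blast
      qed
      then have "0 < (- 1) ^ (card V - 1) * c1 \<or> 0 < (- 1) ^ (card ?V - 1) * c2"
        using c1(1) c2(1) by (auto simp: order_less_le)
      then have "0 < (- 1) ^ (card V - 1) * (c1 - c2)" unfolding sgn using c1(1) c2(1) by linarith
      then show "c1 - c2 \<noteq> 0" by (metis less_irrefl mult_zero_right)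
    next
      fix C B and x :: "nat \<Rightarrow> complex"
      assume CB: "finite C \<and> finite B \<and> C \<inter> B = {} \<and> (\<forall>j. 0 < j \<and> j < sum w V \<longrightarrow> (\<Sum>b\<in>B. x b ^ j) = 0)"
      then have fin: "finite C" "finite (C \<union> B)" by auto
      show "list_eval V w es (C \<union> B) x = list_eval V w es C x + of_int (c1 - c2) * (\<Sum>b\<in>B. x b ^ sum w V)"
        unfolding es(1) list_eval_Cons[OF Suc.prems(1) fin(1) uv False es'V] list_eval_Cons[OF
          Suc.prems(1) fin(2) uv False es'V]
          c1'[rule_format, OF CB] c2'[rule_format, OF CB] by (simp add: algebra_simps)
    qed
  qed
qed

text \<open>Up to the factor \<open>t ^ j\<close> this sums all powers of an \<open>N\<close>th root
  of unity, which differs from \<open>1\<close> because \<open>N\<close> does not divide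
  \<open>j\<close>.\<close>

lemma roots_of_unity_power_sum:
  assumes "0 < j" "j < N"
  shows "(\<Sum>b\<in>{1..N}. (t * cis (2 * pi / real N) ^ b) ^ j) = 0"
proof -
  define \<omega> where "\<omega> = cis (2 * pi / real N) ^ j"
  have w: "\<omega> = cis (2 * pi * real j / real N)" by (simp add: \<omega>_def DeMoivre mult_ac)
  have inj: "inj_on (\<lambda>k. cis (2 * pi * real k / real N)) {..<N}"
    using bij_betw_roots_unity[of N] assms by (auto simp: bij_betw_def)
  have "\<omega> \<noteq> 1"
  proof
    assume "\<omega> = 1"
    then have "cis (2 * pi * real j / real N) = cis (2 * pi * real 0 / real N)" by (simp add: w)
    from inj_onD[OF inj this] assms show False by simp
  qed
  moreover have "\<omega> ^ N = 1"
  proof -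
    have "\<omega> ^ N = cis (real N * (2 * pi * real j / real N))" unfolding w by (rule DeMoivre)
    also have "real N * (2 * pi * real j / real N) = 2 * pi * real j" using assms by simp
    finally show ?thesis by (metis cis_multiple_2pi Ints_of_nat)
  qed
  ultimately have "(\<Sum>b<N. \<omega> ^ b) = 0" by (simp add: geometric_sum)
  have "(\<Sum>b\<in>{1..N}. (t * cis (2 * pi / real N) ^ b) ^ j) = (\<Sum>b\<in>{1..N}. t ^ j * \<omega> ^ b)"
    unfolding \<omega>_def by (intro sum.cong refl) (simp add: power_mult_distrib
      power_mult[symmetric] mult.commute)
  also have "\<dots> = t ^ j * (\<omega> * (\<Sum>b<N. \<omega> ^ b))"
    unfolding sum_distrib_left
    by (rule sum.reindex_bij_witness[where i = Suc and j = "\<lambda>b. b - 1"]) (auto simp flip: power_Suc)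
  also have "\<dots> = 0" using \<open>(\<Sum>b<N. \<omega> ^ b) = 0\<close> by simp
  finally show ?thesis .
qed

lemma roots_of_unity_power_sum_top:
  assumes "0 < N"
  shows "(\<Sum>b\<in>{1..N}. (t * cis (2 * pi / real N) ^ b) ^ N) = of_nat N * t ^ N"
proof -
  have "cis (2 * pi / real N) ^ N = 1" using assms by (simp add: DeMoivre)
  then have "(cis (2 * pi / real N) ^ b) ^ N = 1" for b
    by (metis power_commutes power_mult mult.commute power_one)
  then show ?thesis by (simp add: power_mult_distrib)
qed

lemma complex_root_exists:
  assumes "0 < N" shows "\<exists>t::complex. t ^ N = y"
proof (cases "y = 0")
  case False
  then have "card {t. t ^ N = y} = N" using assms by (intro card_nth_roots)
  then have "{t. t ^ N = y} \<noteq> {}" using assms by (metis card.empty less_irrefl)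
  then show ?thesis by blast
qed (use assms in \<open>auto intro: exI[of _ 0]\<close>)

section \<open>The equality theorem\<close>

text \<open>Choosing an order of the two ends of every edge translates the graph into an edge
  list.\<close>

lemma block_coefficient_graph:
  assumes H: "weighted_graph H" "connected_wgraph H" "wg_verts H \<noteq> {}"
    and loopless: "\<forall>e\<in>wg_edges H. \<forall>v. wg_ends H e \<noteq> {v}"
  shows "\<exists>c::int. c \<noteq> 0 \<and> (\<forall>M N. \<forall>x :: nat \<Rightarrow> complex.
    (\<forall>j. 0 < j \<and> j < sum (wg_weight H) (wg_verts H) \<longrightarrow> (\<Sum>b\<in>{M + 1..M + N}. x b ^ j) = 0) \<longrightarrow>
    chrom_eval x (M + N) H = chrom_eval x M H + of_int c * (\<Sum>b\<in>{M + 1..M + N}. x b ^ sum (wg_weight H) (wg_verts H)))"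
proof -
  let ?V = "wg_verts H" and ?w = "wg_weight H"
  have fin: "finite ?V" "finite (wg_edges H)" and pos: "\<forall>v\<in>?V. 0 < ?w v"
    using H(1) by (auto simp: weighted_graph_def)
  have "\<exists>p. wg_ends H e = {fst p, snd p}" if "e \<in> wg_edges H" for e
  proof -
    obtain u v where "wg_ends H e = {u, v}"
      using H(1) \<open>e \<in> wg_edges H\<close> by (auto simp: weighted_graph_def)
    then show ?thesis by (intro exI[of _ "(u, v)"]) simp
  qed
  then obtain pick where pick: "\<And>e. e \<in> wg_edges H \<Longrightarrow> wg_ends H e = {fst (pick e), snd (pick e)}"
    by metis
  obtain el where el: "set el = wg_edges H" using finite_list[OF fin(2)] by blast
  define es where "es = map pick el"
  have es: "set es = pick ` wg_edges H" by (simp add: es_def el)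
  have esV: "\<forall>(p, q)\<in>set es. p \<in> ?V \<and> q \<in> ?V"
    using weighted_graph_ends[OF H(1) _ pick] by (auto simp: es) (metis fst_conv snd_conv)+
  have con: "list_connected ?V es"
  proof -
    have "wg_adjacency H (wg_edges H) \<subseteq> set es \<union> (set es)\<inverse>"
    proof
      fix uv assume "uv \<in> wg_adjacency H (wg_edges H)"
      then obtain u v e where e: "uv = (u, v)" "e \<in> wg_edges H" "wg_ends H e = {u, v}"
        by (auto simp: wg_adjacency_def)
      then have "pick e = (u, v) \<or> pick e = (v, u)"
        using pick[OF e(2)] by (auto simp: doubleton_eq_iff prod_eq_iff)
      then show "uv \<in> set es \<union> (set es)\<inverse>" using e(1,2) unfolding es by force
    qed
    from rtrancl_mono[OF this] show ?thesis
      using H(2) unfolding connected_wgraph_def list_connected_def by blast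
  qed
  have nl: "\<forall>(p, q)\<in>set es. p \<noteq> q"
  proof -
    have "fst (pick e) \<noteq> snd (pick e)" if e: "e \<in> wg_edges H" for e
    proof
      assume "fst (pick e) = snd (pick e)"
      then have "wg_ends H e = {snd (pick e)}" using pick[OF e] by simp
      then show False using loopless e by blast
    qed
    then show ?thesis by (simp add: es case_prod_beta)
  qed
  have ev: "list_eval ?V ?w es {1..M} x = chrom_eval x M H" for M and x :: "nat \<Rightarrow> complex"
  proof -
    have "(\<forall>e\<in>wg_edges H. \<forall>u v. wg_ends H e = {u, v} \<longrightarrow> \<kappa> u \<noteq> \<kappa> v) \<longleftrightarrow> (\<forall>(p, q)\<in>set es. \<kappa> p \<noteq> \<kappa> q)"
      for \<kappa> :: "'a \<Rightarrow> nat"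
    proof -
      have "(\<forall>u v. wg_ends H e = {u, v} \<longrightarrow> \<kappa> u \<noteq> \<kappa> v) \<longleftrightarrow> \<kappa> (fst (pick e)) \<noteq> \<kappa> (snd (pick e))"
        if "e \<in> wg_edges H" for e
        unfolding pick[OF that] doubleton_eq_iff by auto
      then show ?thesis by (simp add: es case_prod_beta)
    qed
    then show ?thesis by (simp add: chrom_eval_def list_eval_def bounded_colourings_def list_colourings_def)
  qed
  obtain c :: int where c: "list_connected ?V es \<and> (\<forall>(p, q)\<in>set es. p \<noteq> q) \<longrightarrow> c \<noteq> 0"
    "\<forall>C B. \<forall>x :: nat \<Rightarrow> complex. finite C \<and> finite B \<and> C \<inter> B = {} \<and> (\<forall>j. 0 < j \<and>
      j < sum ?w ?V \<longrightarrow> (\<Sum>b\<in>B. x b ^ j) = 0) \<longrightarrow>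
      list_eval ?V ?w es (C \<union> B) x = list_eval ?V ?w es C x + of_int c * (\<Sum>b\<in>B. x b ^ sum ?w ?V)"
    using block_coefficient[OF fin(1) H(3) pos esV] by (elim exE conjE)
  show ?thesis
  proof (intro exI[of _ c] conjI allI impI)
    show "c \<noteq> 0" using c(1) con nl by blast
  next
    fix M N and x :: "nat \<Rightarrow> complex"
    assume x: "\<forall>j. 0 < j \<and> j < sum ?w ?V \<longrightarrow> (\<Sum>b\<in>{M + 1..M + N}. x b ^ j) = 0"
    have u: "{1..M + N} = {1..M} \<union> {M + 1..M + N}" by auto
    have "finite {1..M} \<and> finite {M + 1..M + N} \<and> {1..M} \<inter> {M + 1..M + N} = {} \<and>
      (\<forall>j. 0 < j \<and> j < sum ?w ?V \<longrightarrow> (\<Sum>b\<in>{M + 1..M + N}. x b ^ j) = 0)" using x by auto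
    from c(2)[rule_format, OF this]
    show "chrom_eval x (M + N) H = chrom_eval x M H + of_int c * (\<Sum>b\<in>{M + 1..M + N}. x b ^ sum ?w ?V)"
      unfolding u[symmetric] ev .
  qed
qed

section \<open>Total weight, connectedness and loops of contracted chains\<close>

lemma sum_weight_contract:
  assumes "weighted_graph G" "S \<subseteq> wg_edges G"
  shows "sum (wg_weight (contract_edges G S)) (wg_verts (contract_edges G S))
    = sum (wg_weight G) (wg_verts G)"
proof -
  let ?cls = "\<lambda>v. contraction_rel G S `` {v}" and ?Q = "wg_verts G // contraction_rel G S"
  have fin: "finite (wg_verts G)" using assms(1) by (simp add: weighted_graph_def)
  have "(\<Sum>C\<in>?Q. \<Sum>v\<in>C. wg_weight G v) = (\<Sum>C\<in>?Q. \<Sum>v\<in>{v \<in> wg_verts G. ?cls v = C}. wg_weight G v)"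
    using class_fibre[OF assms] by (intro sum.cong) auto
  also have "\<dots> = sum (wg_weight G) (wg_verts G)"
    by (rule sum.group) (use fin in \<open>auto simp: quotient_contraction\<close>)
  finally show ?thesis by (simp add: contract_edges_def)
qed

lemma weighted_graph_contract:
  assumes G: "weighted_graph G" and S: "S \<subseteq> wg_edges G"
  shows "weighted_graph (contract_edges G S)"
  unfolding weighted_graph_def
proof (intro conjI ballI)
  have fin: "finite (wg_verts G)" "finite (wg_edges G)" using G by (auto simp: weighted_graph_def)
  show "finite (wg_verts (contract_edges G S))" "finite (wg_edges (contract_edges G S))"
    using fin by (auto simp: contract_edges_def quotient_contraction)
  show "0 < wg_weight (contract_edges G S) C" if C: "C \<in> wg_verts (contract_edges G S)" for C
  proof -
    obtain v where v: "v \<in> wg_verts G" "C = contraction_rel G S `` {v}"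
      using C by (auto simp: contract_edges_def quotient_contraction)
    have sub: "C \<subseteq> wg_verts G" using class_fibre[OF G S, of C] C by (auto simp: contract_edges_def)
    have "v \<in> C" by (simp add: v(2) contraction_rel_def)
    have "0 < sum (wg_weight G) C"
      by (rule sum_pos) (use sub \<open>v \<in> C\<close> G finite_subset[OF
        sub fin(1)] in \<open>auto simp: weighted_graph_def\<close>)
    then show ?thesis by (simp add: contract_edges_def)
  qed
  fix e assume e: "e \<in> wg_edges (contract_edges G S)"
  then obtain u v where "u \<in> wg_verts G" "v \<in> wg_verts G" "wg_ends G e = {u, v}"
    using G by (auto simp: contract_edges_def weighted_graph_def)
  then show "\<exists>u\<in>wg_verts (contract_edges G S). \<exists>v\<in>wg_verts (contract_edges G S). wg_ends (contract_edges G S) e = {u, v}"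
    by (intro bexI[of _ "contraction_rel G S `` {u}"] bexI[of _ "contraction_rel G S `` {v}"])
      (auto simp: contract_edges_def quotient_contraction)
qed

lemma connected_contract:
  assumes "connected_wgraph G"
  shows "connected_wgraph (contract_edges G S)"
  unfolding connected_wgraph_def
proof (intro ballI)
  let ?cls = "\<lambda>v. contraction_rel G S `` {v}" and ?H = "contract_edges G S"
  let ?R = "(wg_adjacency ?H (wg_edges ?H))\<^sup>*"
  fix C D assume "C \<in> wg_verts ?H" "D \<in> wg_verts ?H"
  then obtain u v where uv: "u \<in> wg_verts G" "v \<in> wg_verts G" "C = ?cls u" "D = ?cls v"
    by (auto simp: contract_edges_def quotient_contraction)
  have "(u, v) \<in> (wg_adjacency G (wg_edges G))\<^sup>*" using assms uv by (simp add: connected_wgraph_def)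
  then have "(?cls u, ?cls v) \<in> ?R"
  proof (induction rule: rtrancl_induct)
    case (step y z)
    then obtain e where e: "e \<in> wg_edges G" "wg_ends G e = {y, z}" by (auto simp: wg_adjacency_def)
    show ?case
    proof (cases "e \<in> S")
      case True
      then have "(y, z) \<in> contraction_rel G S"
        using e by (auto simp: contraction_rel_def wg_adjacency_def)
      then have "?cls y = ?cls z" by (simp only: contraction_class_eq_iff)
      then show ?thesis using step.IH by simp
    next
      case False
      have "(?cls y, ?cls z) \<in> wg_adjacency ?H (wg_edges ?H)"
      proof -
        have "e \<in> wg_edges ?H" "wg_ends ?H e = {?cls y, ?cls z}"
          using e False by (simp_all add: contract_edges_def)
        then show ?thesis unfolding wg_adjacency_def by blast
      qed
      then show ?thesis using step.IH by (rule rtrancl_into_rtrancl[rotated])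
    qed
  qed simp
  then show "(C, D) \<in> ?R" by (simp add: uv)
qed

lemma connected_chain:
  assumes con: "connected_wgraph G" and az: "a \<in> wg_verts G" "z \<in> wg_verts G"
  shows "connected_wgraph (chain_of_copies n G a z)"
proof -
  let ?H = "chain_of_copies n G a z"
  let ?A = "wg_adjacency ?H (wg_edges ?H)"
  have sym: "sym (?A\<^sup>*)" by (rule sym_rtrancl) (auto simp: sym_def wg_adjacency_def insert_commute)
  have copy: "((i, u), (i, v)) \<in> ?A\<^sup>*"
    if i: "i \<in> {1..n}" and uv: "u \<in> wg_verts G" "v \<in> wg_verts G" for i u v
  proof -
    have "(u, v) \<in> (wg_adjacency G (wg_edges G))\<^sup>*" using con uv by (simp add: connected_wgraph_def)
    then show ?thesis
    proof (induction rule: rtrancl_induct)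
      case (step y t)
      then obtain e where e: "e \<in> wg_edges G" "wg_ends G e = {y, t}" by (auto simp: wg_adjacency_def)
      have "((i, y), (i, t)) \<in> ?A"
      proof -
        have "Inl (i, e) \<in> wg_edges ?H" "wg_ends ?H (Inl (i, e)) = {(i, y), (i, t)}"
          using e i by (auto simp: chain_of_copies_def)
        then show ?thesis unfolding wg_adjacency_def by blast
      qed
      then show ?case using step.IH by (rule rtrancl_into_rtrancl[rotated])
    qed simp
  qed
  have start: "((1, a), (Suc i, a)) \<in> ?A\<^sup>*" if "Suc i \<le> n" for i
    using that
  proof (induction i)
    case (Suc i)
    have "((Suc i, z), (Suc (Suc i), a)) \<in> ?A"
    proof -
      have "Inr (Suc i) \<in> wg_edges ?H" "wg_ends ?H (Inr (Suc i)) = {(Suc i, z), (Suc (Suc i), a)}"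
        using Suc.prems by (auto simp: chain_of_copies_def)
      then show ?thesis unfolding wg_adjacency_def by blast
    qed
    moreover have "((Suc i, a), (Suc i, z)) \<in> ?A\<^sup>*" using copy az Suc.prems by simp
    ultimately show ?case using Suc by (meson Suc_leD rtrancl.rtrancl_into_rtrancl rtrancl_trans)
  qed simp
  have from1: "((1, a), p) \<in> ?A\<^sup>*" if p: "p \<in> wg_verts ?H" for p
  proof -
    obtain i v where iv: "p = (Suc i, v)" "Suc i \<le> n" "v \<in> wg_verts G"
      using p by (cases p; cases "fst p") (auto simp: chain_of_copies_def)
    have "((Suc i, a), p) \<in> ?A\<^sup>*" using copy[of "Suc i" a v] iv az by simp
    then show ?thesis using start[OF iv(2)] rtrancl_trans by fast
  qed
  show ?thesis
    unfolding connected_wgraph_def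
  proof (intro ballI)
    fix p q assume "p \<in> wg_verts ?H" "q \<in> wg_verts ?H"
    then show "(p, q) \<in> ?A\<^sup>*" using from1 sym rtrancl_trans by (metis symD)
  qed
qed

lemma comp_graph_single:
  assumes "0 < k"
  shows "comp_graph [k] G a z = contract_edges (chain_of_copies k G a z) (Inr ` {1..k - 1})"
  using composition_complement(3)[of "[k]"] assms by (simp add: comp_graph_def)

lemma weighted_graph_comp_graph:
  assumes "weighted_graph G" "a \<in> wg_verts G" "z \<in> wg_verts G" "composition \<alpha>"
  shows "weighted_graph (comp_graph \<alpha> G a z)"
  unfolding comp_graph_def
  by (rule weighted_graph_contract[OF weighted_graph_chain complement_edges]) (use assms in auto)

text \<open>Contracting the links only identifies vertices of different copies, so an edge inside a
  copy keeps distinct ends.\<close>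

lemma loopless_comp_graph_single:
  assumes G: "weighted_graph G" and simple: "\<forall>e\<in>wg_edges G. \<forall>v. wg_ends G e \<noteq> {v}" and k: "0 < k"
  shows "\<forall>f\<in>wg_edges (comp_graph [k] G a z). \<forall>C. wg_ends (comp_graph [k] G a z) f \<noteq> {C}"
proof (intro ballI allI notI)
  let ?H = "chain_of_copies k G a z" and ?S = "Inr ` {1..k - 1} :: (nat \<times> 'b + nat) set"
  let ?cls = "\<lambda>v. contraction_rel ?H ?S `` {v}"
  fix f C assume f: "f \<in> wg_edges (comp_graph [k] G a z)" "wg_ends (comp_graph [k] G a z) f = {C}"
  then obtain i e where ie: "f = Inl (i, e)" "i \<in> {1..k}" "e \<in> wg_edges G"
    by (auto simp: comp_graph_single[OF k] contract_edges_def chain_of_copies_def)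
  obtain u v where uv: "wg_ends G e = {u, v}" using G ie(3) by (auto simp: weighted_graph_def)
  have ne: "u \<noteq> v" using simple ie(3) uv by auto
  have "?cls ` Pair i ` {u, v} = {C}"
    using f(2) by (simp add: comp_graph_single[OF k] contract_edges_def chain_of_copies_def ie(1) uv)
  then have "?cls (i, u) = ?cls (i, v)" by auto
  then have rel: "((i, u), (i, v)) \<in> contraction_rel ?H ?S" by (simp only: contraction_class_eq_iff)
  \<comment> \<open>\<open>\<phi>\<close> is constant on the contracted classes, but injective on each copy of \<open>G\<close>.\<close>
  define \<phi> where "\<phi> = (\<lambda>(j::nat, t). if a = z then (0, Some t) else if t = z then (j, None)
      else if t = a then (j - 1, None) else (j, Some t))"
  have "\<phi> p = \<phi> q" if "(p, q) \<in> contraction_rel ?H ?S" for p q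
    using that unfolding contraction_rel_def
  proof (induction rule: rtrancl_induct)
    case (step y t)
    then obtain j where j: "{(j, z), (j + 1, a)} = {y, t}"
      by (auto simp: wg_adjacency_def chain_of_copies_def)
    have "\<phi> (j, z) = \<phi> (j + 1, a)" by (simp add: \<phi>_def)
    then have "\<phi> y = \<phi> t" using j by (auto simp: doubleton_eq_iff)
    then show ?case using step.IH by simp
  qed simp
  from this[OF rel] show False using ne ie(2) by (auto simp: \<phi>_def split: if_splits)
qed

lemma chrom_eval_cong:
  assumes "\<And>i. 0 < i \<Longrightarrow> i \<le> M \<Longrightarrow> x i = y i"
  shows "chrom_eval x M G = chrom_eval y M G"
  unfolding chrom_eval_def
proof (intro sum.cong prod.cong refl)
  fix \<kappa> v assume "\<kappa> \<in> bounded_colourings M G" "v \<in> wg_verts G"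
  then have "\<kappa> v \<in> {1..M}" by (auto simp: bounded_colourings_def)
  then show "x (\<kappa> v) ^ wg_weight G v = y (\<kappa> v) ^ wg_weight G v" using assms by simp
qed

lemma chrom_eval_surj:
  fixes y :: "nat \<Rightarrow> complex"
  assumes G: "weighted_graph G" and az: "a \<in> wg_verts G" "z \<in> wg_verts G"
    and con: "connected_wgraph G" and simple: "\<forall>e\<in>wg_edges G. \<forall>v. wg_ends G e \<noteq> {v}"
  shows "\<exists>M x. \<forall>k. 0 < k \<and> k \<le> K \<longrightarrow> chrom_eval x M (comp_graph [k] G a z) = y k"
proof -
  define W where "W = sum (wg_weight G) (wg_verts G)"
  have W: "0 < W"
    unfolding W_def using G az(1) by (intro sum_pos) (auto simp: weighted_graph_def)
  have block: "\<exists>c::int. c \<noteq> 0 \<and> (\<forall>M N. \<forall>x :: nat \<Rightarrow> complex.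
      (\<forall>j. 0 < j \<and> j < k * W \<longrightarrow> (\<Sum>b\<in>{M + 1..M + N}. x b ^ j) = 0) \<longrightarrow>
      chrom_eval x (M + N) (comp_graph [k] G a z)
        = chrom_eval x M (comp_graph [k] G a z) + of_int c * (\<Sum>b\<in>{M + 1..M + N}. x b ^ (k * W)))"
    if k: "0 < k" for k
  proof -
    let ?H = "chain_of_copies k G a z"
    have H: "weighted_graph ?H" by (rule weighted_graph_chain[OF G az])
    have S: "Inr ` {1..k - 1} \<subseteq> wg_edges ?H" by (auto simp: chain_of_copies_def)
    have "sum (wg_weight ?H) (wg_verts ?H) = (\<Sum>i\<in>{1..k}. \<Sum>v\<in>wg_verts G. wg_weight G v)"
      unfolding sum.cartesian_product by (simp add: chain_of_copies_def)
    then have sw: "sum (wg_weight (comp_graph [k] G a z)) (wg_verts (comp_graph [k] G a z)) = k * W"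
      unfolding comp_graph_single[OF k] sum_weight_contract[OF H S] by (simp add: W_def)
    have ne: "wg_verts (comp_graph [k] G a z) \<noteq> {}"
      using sw k W by (metis mult_pos_pos sum.empty less_irrefl)
    have cn: "connected_wgraph (comp_graph [k] G a z)"
      unfolding comp_graph_single[OF k] by (rule connected_contract[OF connected_chain[OF con az]])
    have wg: "weighted_graph (comp_graph [k] G a z)"
      using k by (intro weighted_graph_comp_graph G az) simp
    show ?thesis
      using block_coefficient_graph[OF wg cn ne loopless_comp_graph_single[OF G simple k]] unfolding sw .
  qed
  show ?thesis
  proof (induction K)
    case (Suc K)
    then obtain M x where x: "\<And>k. 0 < k \<Longrightarrow> k \<le> K \<Longrightarrow> chrom_eval x M (comp_graph [k] G a z) = y k" by blast
    define N where "N = Suc K * W"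
    have N: "0 < N" using W by (simp add: N_def)
    obtain c :: int where c: "c \<noteq> 0" "\<And>M N'. \<And>x :: nat \<Rightarrow> complex.
        (\<forall>j. 0 < j \<and> j < N \<longrightarrow> (\<Sum>b\<in>{M + 1..M + N'}. x b ^ j) = 0) \<Longrightarrow>
        chrom_eval x (M + N') (comp_graph [Suc K] G a z)
          = chrom_eval x M (comp_graph [Suc K] G a z) + of_int c * (\<Sum>b\<in>{M + 1..M + N'}. x b ^ N)"
      using block[of "Suc K"] unfolding N_def by blast
    \<comment> \<open>The \<open>N\<close> new colours contribute \<open>of_nat N * t ^ N\<close> to
      the power sum of degree \<open>N\<close>; \<open>t\<close> is chosen to make up exactly the
      missing difference.\<close>
    obtain t :: complex where t: "t ^ N
      = (y (Suc K) - chrom_eval x M (comp_graph [Suc K] G a z)) / (of_int c * of_nat N)"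
      using complex_root_exists[OF N] by blast
    define x' where "x' i = (if i \<le> M then x i else t * cis (2 * pi / real N) ^ (i - M))" for i
    have shift: "(\<Sum>b\<in>{M + 1..M + N}. x' b ^ j) = (\<Sum>b\<in>{1..N}. (t * cis (2 * pi / real N) ^ b) ^ j)" for j
      by (rule sum.reindex_bij_witness[where i = "\<lambda>b. b + M" and j = "\<lambda>b. b - M"]) (auto simp: x'_def)
    have zero: "(\<Sum>b\<in>{M + 1..M + N}. x' b ^ j) = 0" if "0 < j" "j < N" for j
      unfolding shift by (rule roots_of_unity_power_sum[OF that])
    have old: "chrom_eval x' M H = chrom_eval x M H" for H :: "((nat \<times> 'a) set, nat \<times> 'b + nat) wgraph"
      by (rule chrom_eval_cong) (simp add: x'_def)
    have top: "chrom_eval x' (M + N) (comp_graph [Suc K] G a z) = y (Suc K)"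
    proof -
      have "chrom_eval x' (M + N) (comp_graph [Suc K] G a z)
          = chrom_eval x M (comp_graph [Suc K] G a z) + of_int c * (of_nat N * t ^ N)"
        using c(2)[of x' M N] zero old unfolding shift roots_of_unity_power_sum_top[OF N] by simp
      then show ?thesis using c(1) N by (simp add: t)
    qed
    have low: "chrom_eval x' (M + N) (comp_graph [k] G a z) = y k" if k: "0 < k" "k \<le> K" for k
    proof -
      \<comment> \<open>For \<open>k \<le> K\<close> even the power sum of the top degree
        \<open>k * W\<close> vanishes, so the values already prescribed persist.\<close>
      have kN: "k * W < N" unfolding N_def by (rule mult_less_mono1) (use k W in auto)
      have kW: "0 < k * W" using k W by simp
      obtain d :: int where d: "\<And>M N'. \<And>x :: nat \<Rightarrow> complex.
          (\<forall>j. 0 < j \<and> j < k * W \<longrightarrow> (\<Sum>b\<in>{M + 1..M + N'}. x b ^ j) = 0) \<Longrightarrow>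
          chrom_eval x (M + N') (comp_graph [k] G a z)
            = chrom_eval x M (comp_graph [k] G a z) + of_int d * (\<Sum>b\<in>{M + 1..M + N'}. x b ^ (k * W))"
        using block[OF k(1)] by blast
      have "\<forall>j. 0 < j \<and> j < k * W \<longrightarrow> (\<Sum>b\<in>{M + 1..M + N}. x' b ^ j) = 0" using zero kN by simp
      from d[OF this] show ?thesis using zero[OF kW kN] old x[OF k] by simp
    qed
    show ?case
    proof (intro exI allI impI)
      fix k assume "0 < k \<and> k \<le> Suc K"
      then show "chrom_eval x' (M + N) (comp_graph [k] G a z) = y k"
        using top low by (cases "k = Suc K") auto
    qed
  qed simp
qed

lemma ribbon_zero: "a \<noteq> [] \<Longrightarrow> ribbon (\<lambda>_. 0) a = 0"
  by (induction "\<lambda>_::nat. 0 :: 'a::comm_ring_1" a rule: ribbon.induct) auto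

text \<open>If \<open>\<beta>\<close> were larger, the value of \<open>h\<close> at its size would
  influence its ribbon function, but not that of \<open>\<alpha>\<close>.\<close>

lemma ribbon_eq_sum_le:
  assumes a: "composition \<alpha>" "\<alpha> \<noteq> []" and b: "composition \<beta>" "\<beta> \<noteq> []"
    and eq: "\<And>h :: nat \<Rightarrow> complex. ribbon h \<alpha> = ribbon h \<beta>"
  shows "sum_list \<beta> \<le> sum_list \<alpha>"
proof (rule ccontr)
  assume lt: "\<not> ?thesis"
  obtain c where c: "\<And>v. ribbon ((\<lambda>_. 0 :: complex)(sum_list \<beta> := v)) \<beta> = (- 1) ^ (length \<beta> - 1) * v + c"
    using ribbon_top[OF b, of "\<lambda>_. 0"] by blast
  have "(\<lambda>_. 0 :: complex)(sum_list \<beta> := 0) = (\<lambda>_. 0)" by auto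
  then have "c = 0" using c[of 0] ribbon_zero[OF b(2), where 'a = complex] by simp
  moreover have "ribbon ((\<lambda>_. 0 :: complex)(sum_list \<beta> := 1)) \<alpha> = ribbon (\<lambda>_. 0) \<alpha>"
    by (rule ribbon_cong) (use lt a in auto)
  ultimately show False using c[of 1] eq[of "(\<lambda>_. 0)(sum_list \<beta> := 1)"] ribbon_zero[OF a(2), where 'a
    = complex] by simp
qed

theorem theorem7p3:
  fixes G :: "('v, 'e) wgraph" and a z :: 'v and \<alpha> \<beta> :: "nat list"
  assumes "weighted_graph G"
    and "a \<in> wg_verts G" and "z \<in> wg_verts G"
    and "composition \<alpha>" and "\<alpha> \<noteq> []"
    and "composition \<beta>" and "\<beta> \<noteq> []"
  shows "(comp_equiv \<alpha> \<beta> \<longrightarrow>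
            chromatic_series (comp_graph \<alpha> G a z) = chromatic_series (comp_graph \<beta> G a z)) \<and>
         (simple_wgraph G \<and> connected_wgraph G \<longrightarrow>
            (chromatic_series (comp_graph \<alpha> G a z) = chromatic_series (comp_graph \<beta> G a z)
               \<longleftrightarrow> comp_equiv \<alpha> \<beta>))"
proof -
  note G = assms(1-3) and a = assms(4,5) and b = assms(6,7)
  have wg: "weighted_graph (comp_graph \<alpha> G a z)" "weighted_graph (comp_graph \<beta> G a z)"
    using weighted_graph_comp_graph[OF G] a b by auto
  have if_part: "chromatic_series (comp_graph \<alpha> G a z) = chromatic_series (comp_graph \<beta> G a z)"
    if "comp_equiv \<alpha> \<beta>"
    by (rule series_eq_if_chrom_eval_eq[OF wg])
      (simp only: chrom_eval_ribbon[OF G a] chrom_eval_ribbon[OF G b] comp_equiv_ribbon[OF that])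
  have only_if: "comp_equiv \<alpha> \<beta>"
    if sc: "simple_wgraph G" "connected_wgraph G"
      and eq: "chromatic_series (comp_graph \<alpha> G a z) = chromatic_series (comp_graph \<beta> G a z)"
  proof -
    have loopless: "\<forall>e\<in>wg_edges G. \<forall>v. wg_ends G e \<noteq> {v}" using sc(1) by (simp add: simple_wgraph_def)
    have rib: "ribbon h \<alpha> = ribbon h \<beta>" for h :: "nat \<Rightarrow> complex"
    proof -
      \<comment> \<open>Every \<open>h\<close> is, up to the sizes involved, the sequence of
        evaluations at suitable colours, so equality of the series yields equality of all ribbon
        values.\<close>
      obtain M x where x: "\<And>k. 0 < k \<Longrightarrow> k \<le> max (sum_list \<alpha>) (sum_list \<beta>) \<Longrightarrow>
          chrom_eval x M (comp_graph [k] G a z) = h k"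
        using chrom_eval_surj[OF G sc(2) loopless, of "max (sum_list \<alpha>) (sum_list \<beta>)" h] by blast
      have "ribbon h \<alpha> = ribbon (\<lambda>k. chrom_eval x M (comp_graph [k] G a z)) \<alpha>"
        by (rule ribbon_cong) (use x a in auto)
      also have "\<dots> = ribbon (\<lambda>k. chrom_eval x M (comp_graph [k] G a z)) \<beta>"
        using chrom_eval_eq_if_series_eq[OF wg eq, of x M]
        unfolding chrom_eval_ribbon[OF G a] chrom_eval_ribbon[OF G b] .
      also have "\<dots> = ribbon h \<beta>"
        by (rule ribbon_cong) (use x b in auto)
      finally show ?thesis .
    qed
    have "sum_list \<alpha> = sum_list \<beta>"
      using ribbon_eq_sum_le[OF a b rib] ribbon_eq_sum_le[OF b a rib[symmetric]] by simp
    then show ?thesis using ribbon_eq_imp_comp_equiv[OF a b _ rib] by blast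
  qed
  show ?thesis using if_part only_if by blast
qed

end
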